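(* Let $T>0$, $\gamma\in(1/2,1)$, $\kappa\in(0,1)$ with $\gamma(\kappa+1)<1$, and let $x\in\mathcal{C}^\gamma([0,T];\mathbb{R})$. Let $\sigma:\mathbb{R}^m\to\mathbb{R}^m$ satisfy $\sigma(0)=0$ and, for some constant $C$, $|\sigma(\xi_2)-\sigma(\xi_1)|\le C\,\big||\xi_2|^\kappa-|\xi_1|^\kappa\big|$ for all $\xi_1,\xi_2\in\mathbb{R}^m$. Let $\eta$ be such that $\frac{1-\gamma(1+\kappa)}{\gamma}<\eta<1-\kappa$, and let $y\in\mathcal{C}^\gamma([0,T];\mathbb{R}^m)$ with $|y|^{-1}\in L^\eta([0,T])$. Then for all $0\le a<b\le T$, $$\lim_{n\to\infty}\int_a^bz^n_s\,dx_s=\int_a^b\sigma(y_s)\,dx_s,$$ where, for $n\ge2$, $\Pi_n=\{a=t_1<t_2<\dots<t_n=b\}$ is the uniform partition of $[a,b]$ with mesh $|\Pi_n|=\frac{b-a}{n-1}=t_{j+1}-t_j$, and $$z^n_s=\sum_{i=2}^n\frac1{|\Pi_n|}\left(\int_{t_{i-1}}^{t_i}\sigma(y_r)\,dr\right)\mathbf{1}_{(t_{i-1},t_i]}(s),\qquad s\in[a,b].$$ All integrals with respect to $x$ are understood in the fractional sense described in the context.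
   Context: Fractional integral. For $0\le a<b\le T$, $\alpha\in(0,1)$: $I_{a+}^\alpha f_t=\frac1{\Gamma(\alpha)}\int_a^t(t-r)^{\alpha-1}f_r\,dr$, $I_{b-}^\alpha f_t=\frac1{\Gamma(\alpha)}\int_t^b(r-t)^{\alpha-1}f_r\,dr$; $I_{a+}^\alpha(L^p)$, $I_{b-}^\alpha(L^p)$ denote the images of $L^p([a,b])$. Their inverses are the fractional derivatives $D_{a+}^\alpha f_t=\frac1{\Gamma(1-\alpha)}\Big(\frac{f_t}{(t-a)^\alpha}+\alpha\int_a^t\frac{f_t-f_r}{(t-r)^{1+\alpha}}dr\Big)$ and $D_{b-}^\alpha f_t=\frac1{\Gamma(1-\alpha)}\Big(\frac{f_t}{(b-t)^\alpha}+\alpha\int_t^b\frac{f_t-f_r}{(r-t)^{1+\alpha}}dr\Big)$ (in general the inner integrals are $L^p$-limits of the integrals over $[a,t-\varepsilon]$, resp. $[t+\varepsilon,b]$, as $\varepsilon\downarrow0$, with $f$ extended by $0$ outside $[a,b]$). Let $g^{b-}_r=g_r-g_{b-}$. If for some $\alpha\in(0,1)$ one has $f\in I_{a+}^\alpha(L^1)$, $g^{b-}\in I_{b-}^{1-\alpha}(L^1)$ and $(D_{a+}^\alpha f)\,D_{b-}^{1-\alpha}g^{b-}\in L^1([a,b])$, then $f$ is said to be integrable with respect to $g$ and $\int_a^bf_r\,dg_r:=-\int_a^b(D_{a+}^\alpha f_r)\,D_{b-}^{1-\alpha}g^{b-}_r\,dr$. For vector-valued $f$ the definition is componentwise. (In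 particular $\int_a^bz^n_s\,dx_s=\sum_{i=2}^n\frac1{|\Pi_n|}\big(\int_{t_{i-1}}^{t_i}\sigma(y_s)ds\big)(x_{t_i}-x_{t_{i-1}})$.) *)

theory Defs
  imports "HOL-Analysis.Analysis"
begin

definition holder_on :: "real \<Rightarrow> real set \<Rightarrow> (real \<Rightarrow> 'a::metric_space) \<Rightarrow> bool" where
  "holder_on \<gamma> S f \<longleftrightarrow> (\<exists>C. \<forall>s\<in>S. \<forall>t\<in>S. dist (f s) (f t) \<le> C * \<bar>s - t\<bar> powr \<gamma>)"

text \<open>The membership \<open>|y|\<^sup>-\<^sup>1 \<in> L\<^sup>\<eta>([0,T])\<close>. The reciprocal is taken in \<open>ennreal\<close>,
  where \<open>inverse 0 = \<infinity>\<close>, so that zeros of \<open>y\<close> contribute \<open>\<infinity>\<close>; in type \<open>real\<close> one would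
  have \<open>inverse 0 = 0\<close>.\<close>
definition recip_norm_in_L :: "real \<Rightarrow> real \<Rightarrow> (real \<Rightarrow> 'a::real_normed_vector) \<Rightarrow> bool" where
  "recip_norm_in_L \<eta> T y \<longleftrightarrow>
     (\<integral>\<^sup>+ t\<in>{0..T}. inverse (ennreal (norm (y t) powr \<eta>)) \<partial>lborel) < \<infinity>"


definition frac_int_left :: "real \<Rightarrow> real \<Rightarrow> (real \<Rightarrow> real) \<Rightarrow> real \<Rightarrow> real" where
  "frac_int_left \<alpha> a f t =
     1 / Gamma \<alpha> * (LINT r:{a..t}|lborel. (t - r) powr (\<alpha> - 1) * f r)"

definition frac_int_right :: "real \<Rightarrow> real \<Rightarrow> (real \<Rightarrow> real) \<Rightarrow> real \<Rightarrow> real" where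
  "frac_int_right \<alpha> b f t =
     1 / Gamma \<alpha> * (LINT r:{t..b}|lborel. (r - t) powr (\<alpha> - 1) * f r)"

text \<open>The images of \<open>L\<^sup>1([a,b])\<close> under the fractional integrals. Elements of these spaces are
  classes modulo null sets, hence the equality almost everywhere.\<close>
definition in_frac_image_left :: "real \<Rightarrow> real \<Rightarrow> real \<Rightarrow> (real \<Rightarrow> real) \<Rightarrow> bool" where
  "in_frac_image_left \<alpha> a b f \<longleftrightarrow>
     (\<exists>\<phi>. set_integrable lborel {a..b} \<phi> \<and>
          (AE t in lborel. t \<in> {a..b} \<longrightarrow> f t = frac_int_left \<alpha> a \<phi> t))"

definition in_frac_image_right :: "real \<Rightarrow> real \<Rightarrow> real \<Rightarrow> (real \<Rightarrow> real) \<Rightarrow> bool" where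
  "in_frac_image_right \<alpha> a b f \<longleftrightarrow>
     (\<exists>\<phi>. set_integrable lborel {a..b} \<phi> \<and>
          (AE t in lborel. t \<in> {a..b} \<longrightarrow> f t = frac_int_right \<alpha> b \<phi> t))"


definition zero_ext :: "real \<Rightarrow> real \<Rightarrow> (real \<Rightarrow> real) \<Rightarrow> real \<Rightarrow> real" where
  "zero_ext a b f t = (if t \<in> {a..b} then f t else 0)"

text \<open>Truncated fractional derivatives. The interval integrals are oriented: if \<open>t - \<epsilon> < a\<close>
  (resp. \<open>b < t + \<epsilon>\<close>), the integral below is minus the integral over \<open>[t - \<epsilon>, a]\<close>
  (resp. \<open>[b, t + \<epsilon>]\<close>), where the extended function is \<open>0\<close> at the integration variable.\<close>
definition frac_deriv_left_trunc ::
    "real \<Rightarrow> real \<Rightarrow> real \<Rightarrow> (real \<Rightarrow> real) \<Rightarrow> real \<Rightarrow> real \<Rightarrow> real" where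
  "frac_deriv_left_trunc \<alpha> a b f \<epsilon> t =
     1 / Gamma (1 - \<alpha>) *
       (zero_ext a b f t / (t - a) powr \<alpha> +
        \<alpha> * (LBINT r=ereal a..ereal (t - \<epsilon>).
               (zero_ext a b f t - zero_ext a b f r) / (t - r) powr (1 + \<alpha>)))"

definition frac_deriv_right_trunc ::
    "real \<Rightarrow> real \<Rightarrow> real \<Rightarrow> (real \<Rightarrow> real) \<Rightarrow> real \<Rightarrow> real \<Rightarrow> real" where
  "frac_deriv_right_trunc \<alpha> a b f \<epsilon> t =
     1 / Gamma (1 - \<alpha>) *
       (zero_ext a b f t / (b - t) powr \<alpha> +
        \<alpha> * (LBINT r=ereal (t + \<epsilon>)..ereal b.
               (zero_ext a b f t - zero_ext a b f r) / (r - t) powr (1 + \<alpha>)))"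

text \<open>Convergence \<open>F \<epsilon> \<rightarrow> h\<close> in \<open>L\<^sup>1([a,b])\<close> as \<open>\<epsilon> \<down> 0\<close>. Integrability of \<open>F \<epsilon>\<close> has to be
  demanded, since the Bochner integral of a non-integrable function is \<open>0\<close>.\<close>
definition L1_limit :: "real \<Rightarrow> real \<Rightarrow> (real \<Rightarrow> real \<Rightarrow> real) \<Rightarrow> (real \<Rightarrow> real) \<Rightarrow> bool" where
  "L1_limit a b F h \<longleftrightarrow>
     set_integrable lborel {a..b} h \<and>
     (\<forall>\<^sub>F \<epsilon> in at_right 0. set_integrable lborel {a..b} (F \<epsilon>)) \<and>
     ((\<lambda>\<epsilon>. LINT t:{a..b}|lborel. \<bar>F \<epsilon> t - h t\<bar>) \<longlongrightarrow> 0) (at_right 0)"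

text \<open>The fractional derivatives are determined up to null sets only; an arbitrary
  representative is chosen.\<close>
definition frac_deriv_left :: "real \<Rightarrow> real \<Rightarrow> real \<Rightarrow> (real \<Rightarrow> real) \<Rightarrow> real \<Rightarrow> real" where
  "frac_deriv_left \<alpha> a b f = (SOME h. L1_limit a b (frac_deriv_left_trunc \<alpha> a b f) h)"

definition frac_deriv_right :: "real \<Rightarrow> real \<Rightarrow> real \<Rightarrow> (real \<Rightarrow> real) \<Rightarrow> real \<Rightarrow> real" where
  "frac_deriv_right \<alpha> a b f = (SOME h. L1_limit a b (frac_deriv_right_trunc \<alpha> a b f) h)"


definition minus_left_limit :: "real \<Rightarrow> (real \<Rightarrow> real) \<Rightarrow> real \<Rightarrow> real" where
  "minus_left_limit b g r = g r - Lim (at_left b) g"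

definition frac_integrable_at ::
    "real \<Rightarrow> (real \<Rightarrow> real) \<Rightarrow> (real \<Rightarrow> real) \<Rightarrow> real \<Rightarrow> real \<Rightarrow> bool" where
  "frac_integrable_at \<alpha> f g a b \<longleftrightarrow>
     in_frac_image_left \<alpha> a b f \<and>
     in_frac_image_right (1 - \<alpha>) a b (minus_left_limit b g) \<and>
     set_integrable lborel {a..b}
       (\<lambda>t. frac_deriv_left \<alpha> a b f t * frac_deriv_right (1 - \<alpha>) a b (minus_left_limit b g) t)"

definition has_frac_integral ::
    "(real \<Rightarrow> real) \<Rightarrow> (real \<Rightarrow> real) \<Rightarrow> real \<Rightarrow> real \<Rightarrow> real \<Rightarrow> bool" where
  "has_frac_integral f g a b I \<longleftrightarrow>
     (\<exists>\<alpha>\<in>{0<..<1}. frac_integrable_at \<alpha> f g a b \<and>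
        I = - (LINT t:{a..b}|lborel.
                 frac_deriv_left \<alpha> a b f t * frac_deriv_right (1 - \<alpha>) a b (minus_left_limit b g) t))"

definition frac_integrable :: "(real \<Rightarrow> real) \<Rightarrow> (real \<Rightarrow> real) \<Rightarrow> real \<Rightarrow> real \<Rightarrow> bool" where
  "frac_integrable f g a b \<longleftrightarrow> (\<exists>\<alpha>\<in>{0<..<1}. frac_integrable_at \<alpha> f g a b)"

text \<open>The value is meaningful only if all admissible orders \<open>\<alpha>\<close> give the same number.\<close>
definition frac_integral :: "(real \<Rightarrow> real) \<Rightarrow> (real \<Rightarrow> real) \<Rightarrow> real \<Rightarrow> real \<Rightarrow> real" where
  "frac_integral f g a b = (THE I. has_frac_integral f g a b I)"

definition frac_integrable_vec ::
    "(real \<Rightarrow> real ^ 'm::finite) \<Rightarrow> (real \<Rightarrow> real) \<Rightarrow> real \<Rightarrow> real \<Rightarrow> bool" where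
  "frac_integrable_vec f g a b \<longleftrightarrow> (\<forall>i. frac_integrable (\<lambda>t. f t $ i) g a b)"

definition frac_integral_vec ::
    "(real \<Rightarrow> real ^ 'm::finite) \<Rightarrow> (real \<Rightarrow> real) \<Rightarrow> real \<Rightarrow> real \<Rightarrow> real ^ 'm" where
  "frac_integral_vec f g a b = (\<chi> i. frac_integral (\<lambda>t. f t $ i) g a b)"


definition mesh :: "real \<Rightarrow> real \<Rightarrow> nat \<Rightarrow> real" where
  "mesh a b n = (b - a) / (real n - 1)"

text \<open>Partition points are numbered from 1: \<open>part_pt a b n 1 = a\<close>, \<open>part_pt a b n n = b\<close>.\<close>
definition part_pt :: "real \<Rightarrow> real \<Rightarrow> nat \<Rightarrow> nat \<Rightarrow> real" where
  "part_pt a b n i = a + (real i - 1) * mesh a b n"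

definition step_average ::
    "real \<Rightarrow> real \<Rightarrow> nat \<Rightarrow> (real \<Rightarrow> real ^ 'm::finite) \<Rightarrow> real \<Rightarrow> real ^ 'm" where
  "step_average a b n f s =
     (\<Sum>i=2..n. indicat_real {part_pt a b n (i - 1)<..part_pt a b n i} s *\<^sub>R
        ((1 / mesh a b n) *\<^sub>R (LINT r:{part_pt a b n (i - 1)..part_pt a b n i}|lborel. f r)))"

end

theory Submission
  imports Defs
begin

text \<open>
  Fix an order \<open>\<alpha>0\<close> with \<open>1 - \<gamma> < \<alpha>0\<close>. The right-sided derivative of order \<open>1 - \<alpha>0\<close> of the
  \<open>\<gamma>\<close>-Hoelder path \<open>x\<close> is then a bounded function, so that the integral against \<open>x\<close> is an
  \<open>L\<^sup>1\<close>-continuous functional of the left-sided derivative of order \<open>\<alpha>0\<close> of the integrand. It is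
  enough to show that these derivatives of the step averages converge in \<open>L\<^sup>1\<close>.

  The tool is the \<open>L\<^sup>1\<close> modulus of continuity \<open>\<omega>(u) = \<integral> \<bar>f t - f (t - u)\<bar> dt\<close> of the extension of
  \<open>f\<close> by \<open>0\<close>. If \<open>\<omega>(u) \<le> M * u powr \<beta>\<close> with \<open>\<alpha>0 < \<beta>\<close>, then \<open>f\<close> is a fractional integral of order
  \<open>\<alpha>0\<close>, of the Marchaud derivative of \<open>f\<close> (\<open>riesz_marchaud_AE\<close>), whose \<open>L\<^sup>1\<close> norm is at most a
  multiple of \<open>\<integral> \<omega>(u) * u powr (- 1 - \<alpha>0) du\<close>. Splitting that integral at a small \<open>u\<close> shows:
  if a sequence tends to \<open>0\<close> in \<open>L\<^sup>1\<close> and its moduli are bounded by one \<open>M * u powr \<beta>\<close>, then its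
  derivatives tend to \<open>0\<close> in \<open>L\<^sup>1\<close> (\<open>singular_kernel_L1_modulus_tendsto_0\<close>).

  For \<open>f = \<sigma> \<circ> y\<close>, interpolation between the \<open>\<kappa>\<close>-Hoelder bound and the Lipschitz bound away
  from \<open>0\<close> of \<open>u \<mapsto> u powr \<kappa>\<close> gives \<open>\<bar>f t - f s\<bar> \<le> W t * \<bar>t - s\<bar> powr \<beta>\<close> with
  \<open>\<beta> = \<gamma> * (\<kappa> + \<eta>)\<close> and \<open>W\<close> a multiple of \<open>norm (y t) powr (- \<eta>)\<close>, which is integrable. The lower
  bound on \<open>\<eta>\<close> says exactly that \<open>1 - \<gamma> < \<beta>\<close>, so an order \<open>\<alpha>0\<close> between the two exists. The step
  averages satisfy the same modulus bound up to a constant (\<open>step_mean_error_L1_modulus\<close>): for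
  shifts below the mesh only the jumps contribute, and a jump is the average over a cell of
  \<open>f t - f (t - mesh)\<close>; larger shifts are covered by the \<open>L\<^sup>1\<close> error, at most a multiple of
  \<open>mesh powr \<beta>\<close>.

  Since the value of the integral is a definite description over all admissible orders \<open>\<alpha>\<close>, it
  must be shown not to depend on \<open>\<alpha>\<close> (\<open>frac_pairing_unique\<close>). For \<open>\<alpha> > \<alpha>0\<close> this is fractional
  integration by parts, justified by Fubini. For \<open>\<alpha> < \<alpha>0\<close> the right-sided derivative of \<open>x\<close> may
  be an arbitrary \<open>L\<^sup>1\<close> function, and all that is known about its product with the left-sided
  derivative \<open>F\<close> of \<open>f\<close> is integrability, so Fubini is not available. But \<open>F\<close> is itself a
  fractional integral, hence has an \<open>L\<^sup>1\<close> modulus bound, and this bound survives truncation of the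
  values of \<open>F\<close> to \<open>[-N, N]\<close>. For the bounded truncated functions integration by parts follows
  by mollification (\<open>bounded_duality\<close>), and both sides converge as \<open>N \<rightarrow> \<infinity>\<close>, one by dominated
  convergence and the other by the splitting argument above.

  The derivatives are defined as arbitrary \<open>L\<^sup>1\<close> limits of truncated expressions. They are
  identified by \<open>frac_image_left_L1_limit\<close>: the truncated derivative of the fractional integral of
  \<open>\<phi>\<close> is the convolution of \<open>\<phi>\<close> with an approximate identity. All statements about right-sided
  operators are obtained from the left-sided ones by the reflection \<open>t \<mapsto> - t\<close>.
\<close>

section \<open>Integrals and translations on the real line\<close>

abbreviation L1norm :: "(real \<Rightarrow> real) \<Rightarrow> ennreal" where
  "L1norm f \<equiv> \<integral>\<^sup>+t. ennreal \<bar>f t\<bar> \<partial>lborel"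

abbreviation L1norm_on :: "real set \<Rightarrow> (real \<Rightarrow> real) \<Rightarrow> ennreal" where
  "L1norm_on A f \<equiv> \<integral>\<^sup>+t\<in>A. ennreal \<bar>f t\<bar> \<partial>lborel"

text \<open>The Bochner integral of a non-integrable function is \<open>0\<close>, so that the bound holds for every \<open>f\<close>.\<close>
lemma ennreal_abs_integral_le:
  fixes f :: "'a \<Rightarrow> real"
  shows "ennreal \<bar>LINT x|M. f x\<bar> \<le> (\<integral>\<^sup>+x. ennreal \<bar>f x\<bar> \<partial>M)"
proof (cases "integrable M f")
  case True
  show ?thesis using integral_norm_bound_ennreal[OF True] by simp
qed (simp add: not_integrable_integral_eq)

lemma tendsto_zero_at_right_le:
  fixes f g :: "real \<Rightarrow> ennreal"
  assumes "(g \<longlongrightarrow> 0) (at_right 0)" and "\<And>\<epsilon>. 0 < \<epsilon> \<Longrightarrow> f \<epsilon> \<le> g \<epsilon>"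
  shows "(f \<longlongrightarrow> 0) (at_right 0)"
  by (rule tendsto_sandwich[OF _ _ tendsto_const assms(1)])
     (auto intro!: eventually_at_rightI[of 0 1] assms(2))

lemma LIMSEQ_zero_le:
  fixes f g :: "nat \<Rightarrow> ennreal"
  assumes "g \<longlonglongrightarrow> 0" and "\<And>n. f n \<le> g n"
  shows "f \<longlonglongrightarrow> 0"
  by (rule tendsto_sandwich[OF _ _ tendsto_const assms(1)]) (auto intro!: always_eventually assms(2))

lemma integrable_borel: "integrable lborel f \<Longrightarrow> f \<in> borel_measurable borel"
  by (auto dest: borel_measurable_integrable)

lemma nn_integral_shift:
  fixes f :: "real \<Rightarrow> ennreal"
  assumes [measurable]: "f \<in> borel_measurable borel"
  shows "(\<integral>\<^sup>+t. f (t - u) \<partial>lborel) = (\<integral>\<^sup>+t. f t \<partial>lborel)"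
  using nn_integral_real_affine[of f 1 "-u"] by simp

lemma integral_reflect_shift:
  fixes f :: "real \<Rightarrow> real"
  shows "(LBINT u. f (t - u)) = (LBINT u. f u)"
  using lborel_integral_real_affine[of "-1" f t] by simp

lemma integrable_reflect_shift:
  fixes f :: "real \<Rightarrow> real"
  shows "integrable lborel (\<lambda>u. f (t - u)) \<longleftrightarrow> integrable lborel f"
  using lborel_integrable_real_affine_iff[of "-1" f t] by simp

lemma AE_reflect_shift:
  assumes [measurable]: "Measurable.pred borel P" and "AE u in lborel. P u"
  shows "AE u in lborel. P (t - u :: real)"
  using AE_borel_affine[of "-1" P t] assms by simp

lemma integrable_nn_finite:
  fixes f :: "'a \<Rightarrow> real"
  shows "integrable M f \<Longrightarrow> (\<integral>\<^sup>+x. ennreal \<bar>f x\<bar> \<partial>M) < \<infinity>"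
  by (simp add: integrable_iff_bounded)

text \<open>A set of finite measure lies between a compact \<open>K\<close> and an open \<open>U\<close> with \<open>U - K\<close> small. A shift
  smaller than the distance from \<open>K\<close> to the complement of \<open>U\<close> changes the indicator only at points
  of \<open>U - K\<close> or of its translate.\<close>
lemma indicator_translation_bound:
  assumes [measurable]: "A \<in> sets (lborel::real measure)" and fin: "emeasure lborel A < \<infinity>" and e: "e > 0"
  shows "\<exists>d>0. \<forall>h. \<bar>h\<bar> < d \<longrightarrow>
    L1norm (\<lambda>t. indicator A (t - h) - indicator A t) \<le> ennreal e"
proof -
  define \<epsilon> where "\<epsilon> = e / 4"
  have \<epsilon>: "\<epsilon> > 0" using e by (simp add: \<epsilon>_def)
  have A[measurable]: "A \<in> sets borel" using assms(1) by simp
  obtain U where U: "open U" "A \<subseteq> U" "emeasure lborel (U - A) < ennreal \<epsilon>"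
    using outer_regular_lborel[OF A \<epsilon>] by blast
  let ?M = "density lborel (indicator A)"
  have em: "emeasure ?M X = emeasure lborel (A \<inter> X)" if "X \<in> sets borel" for X
    using that by (simp add: emeasure_density borel_measurable_indicator indicator_inter_arith[symmetric])
  have "emeasure ?M A = (SUP K \<in> {K. K \<subseteq> A \<and> compact K}. emeasure ?M K)"
    by (rule inner_regular) (use fin em in auto)
  then have *: "emeasure lborel A = (SUP K \<in> {K. K \<subseteq> A \<and> compact K}. emeasure lborel K)"
    using em[OF A] by (simp add: em compact_imp_closed Int_absorb1 cong: SUP_cong_simp)
  have "\<exists>K\<in>{K. K \<subseteq> A \<and> compact K}. emeasure lborel A < emeasure lborel K + ennreal \<epsilon>"
  proof (rule SUP_approx_ennreal)
    show "{K. K \<subseteq> A \<and> compact K} \<noteq> {}" by (auto intro: exI[of _ "{}"])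
    show "emeasure lborel A = (SUP K \<in> {K. K \<subseteq> A \<and> compact K}. emeasure lborel K)" by (rule *)
    show "emeasure lborel A \<noteq> \<infinity>" using fin by simp
  qed (rule \<epsilon>)
  then obtain K where K: "compact K" "K \<subseteq> A" "emeasure lborel A < emeasure lborel K + ennreal \<epsilon>"
    by blast
  have [measurable]: "K \<in> sets borel" "U \<in> sets borel"
    using K(1) U(1) by (auto simp: compact_imp_closed)
  have finK: "emeasure lborel K < \<infinity>"
    using K(2) fin emeasure_mono[of K A lborel] by (auto simp: less_top[symmetric] top_unique)
  have "emeasure lborel (A - K) = emeasure lborel A - emeasure lborel K"
    by (rule emeasure_Diff) (use finK K in auto)
  also have "\<dots> \<le> ennreal \<epsilon>"
    using K(3) finK fin by (auto simp: ennreal_minus_le_iff add.commute less_imp_le)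
  finally have AK: "emeasure lborel (A - K) \<le> ennreal \<epsilon>" .
  have "emeasure lborel (U - K) \<le> emeasure lborel ((U - A) \<union> (A - K))"
    using U K by (intro emeasure_mono) auto
  also have "\<dots> \<le> emeasure lborel (U - A) + emeasure lborel (A - K)"
    by (rule emeasure_subadditive) auto
  also have "\<dots> \<le> ennreal \<epsilon> + ennreal \<epsilon>"
    using AK U(3) by (intro add_mono) (auto intro: less_imp_le)
  finally have UK: "emeasure lborel (U - K) \<le> ennreal (2*\<epsilon>)"
    using \<epsilon> by (simp flip: ennreal_plus)
  obtain d where d: "d > 0" "(\<Union>x\<in>K. ball x d) \<subseteq> U"
    using compact_subset_open_imp_ball_epsilon_subset[OF K(1) U(1)] K(2) U(2) by blast
  show ?thesis
  proof (intro exI[of _ d] conjI allI impI)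
    fix h :: real assume h: "\<bar>h\<bar> < d"
    have in1: "t \<in> U" if "t - h \<in> K" for t using d(2) h that by (force simp: dist_real_def)
    have in2: "t - h \<in> U" if "t \<in> K" for t using d(2) h that by (force simp: dist_real_def)
    have "L1norm (\<lambda>t. indicator A (t - h) - indicator A t)
      \<le> (\<integral>\<^sup>+t. indicator (U - K) t + indicator (U-K) (t - h) \<partial>lborel)"
      using in1 in2 U(2) K(2) by (intro nn_integral_mono) (auto simp: indicator_def)
    also have "\<dots> = emeasure lborel (U - K) + emeasure lborel (U - K)"
      using nn_integral_shift[of "indicator (U - K)" h] by (subst nn_integral_add) auto
    also have "\<dots> \<le> ennreal (2*\<epsilon>) + ennreal (2*\<epsilon>)" using UK by (intro add_mono)
    also have "\<dots> = ennreal e" using \<epsilon> by (simp add: \<epsilon>_def flip: ennreal_plus)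
    finally show "L1norm (\<lambda>t. indicator A (t - h) - indicator A t) \<le> ennreal e" .
  qed (use d in auto)
qed

text \<open>The property holds for indicators and passes to sums and to \<open>L\<^sup>1\<close> limits, since translation is an
  isometry of \<open>L\<^sup>1\<close>.\<close>
lemma translation_continuous_L1:
  fixes f :: "real \<Rightarrow> real"
  assumes "integrable lborel f" "e > 0"
  shows "\<exists>d>0. \<forall>h. \<bar>h\<bar> < d \<longrightarrow> L1norm (\<lambda>t. f (t - h) - f t) \<le> ennreal e"
  using assms
proof (induction arbitrary: e rule: integrable_induct)
  case (base A c)
  obtain d where d: "d > 0" "\<And>h. \<bar>h\<bar> < d \<Longrightarrow>
    L1norm (\<lambda>t. indicator A (t - h) - indicator A t) \<le> ennreal (e / (\<bar>c\<bar> + 1))"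
    using indicator_translation_bound[of A "e / (\<bar>c\<bar>+1)"] base by auto
  have [measurable]: "A \<in> sets borel" using base by simp
  show ?case
  proof (intro exI[of _ d] conjI allI impI)
    fix h :: real assume h: "\<bar>h\<bar> < d"
    have "L1norm (\<lambda>t. indicator A (t - h) *\<^sub>R c - indicator A t *\<^sub>R c)
      = (\<integral>\<^sup>+t. ennreal \<bar>c\<bar> * ennreal \<bar>indicator A (t - h) - indicator A t\<bar> \<partial>lborel)"
      by (intro nn_integral_cong) (simp add: abs_mult[symmetric] algebra_simps flip: ennreal_mult)
    also have "\<dots> = ennreal \<bar>c\<bar> * L1norm (\<lambda>t. indicator A (t - h) - indicator A t)"
      by (rule nn_integral_cmult) measurable
    also have "\<dots> \<le> ennreal \<bar>c\<bar> * ennreal (e / (\<bar>c\<bar> + 1))" using d(2)[OF h] by (rule mult_left_mono) simp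
    also have "\<dots> = ennreal (\<bar>c\<bar> * (e / (\<bar>c\<bar> + 1)))"
      by (rule ennreal_mult[symmetric]) (use base in auto)
    also have "\<dots> \<le> ennreal e" using base by (intro ennreal_leI) (simp add: field_simps)
    finally show "L1norm (\<lambda>t. indicator A (t - h) *\<^sub>R c - indicator A t *\<^sub>R c) \<le> ennreal e" .
  qed (use d in auto)
next
  case (add f g)
  have [measurable]: "f \<in> borel_measurable borel" "g \<in> borel_measurable borel"
    using add by (auto dest: borel_measurable_integrable)
  obtain d1 where d1: "d1 > 0" "\<And>h. \<bar>h\<bar> < d1 \<Longrightarrow> L1norm (\<lambda>t. f (t - h) - f t) \<le> ennreal (e/2)"
    using add.IH(1)[of "e/2"] add.prems by auto
  obtain d2 where d2: "d2 > 0" "\<And>h. \<bar>h\<bar> < d2 \<Longrightarrow> L1norm (\<lambda>t. g (t - h) - g t) \<le> ennreal (e/2)"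
    using add.IH(2)[of "e/2"] add.prems by auto
  show ?case
  proof (intro exI[of _ "min d1 d2"] conjI allI impI)
    fix h :: real assume h: "\<bar>h\<bar> < min d1 d2"
    have "L1norm (\<lambda>t. f (t - h) + g (t - h) - (f t + g t))
      \<le> (\<integral>\<^sup>+t. ennreal \<bar>f (t - h) - f t\<bar> + ennreal \<bar>g (t - h) - g t\<bar> \<partial>lborel)"
      by (intro nn_integral_mono) (auto simp flip: ennreal_plus intro!: ennreal_leI)
    also have "\<dots> = L1norm (\<lambda>t. f (t - h) - f t) + L1norm (\<lambda>t. g (t - h) - g t)"
      by (rule nn_integral_add) measurable
    also have "\<dots> \<le> ennreal (e/2) + ennreal (e/2)" using d1 d2 h by (intro add_mono) auto
    also have "\<dots> = ennreal e" using add.prems by (simp flip: ennreal_plus)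
    finally show "L1norm (\<lambda>t. f (t - h) + g (t - h) - (f t + g t)) \<le> ennreal e" .
  qed (use d1 d2 in auto)
next
  case (lim f s)
  have [measurable]: "f \<in> borel_measurable borel" "\<And>i. s i \<in> borel_measurable borel"
    using lim by (auto dest: borel_measurable_integrable)
  have "(\<lambda>i. \<integral>\<^sup>+t. ennreal (norm (f t - s i t)) \<partial>lborel) \<longlonglongrightarrow> 0"
  proof (rule nn_integral_dominated_convergence_norm[where w="\<lambda>t. 2 * norm (f t)"])
    show "(\<integral>\<^sup>+t. ennreal (2 * norm (f t)) \<partial>lborel) < \<infinity>"
      by (rule integrable_nn_finite[of lborel "\<lambda>t. 2 * norm (f t)", simplified abs_mult abs_norm_cancel abs_numeral])
         (use lim.hyps in auto)
  qed (use lim in auto)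
  then have "\<forall>\<^sub>F i in sequentially. (\<integral>\<^sup>+t. ennreal (norm (f t - s i t)) \<partial>lborel) < ennreal (e/4)"
    using lim.prems by (intro order_tendstoD) auto
  then obtain i where i: "L1norm (\<lambda>t. f t - s i t) < ennreal (e/4)"
    by (auto simp: eventually_sequentially)
  obtain d where d: "d > 0" "\<And>h. \<bar>h\<bar> < d \<Longrightarrow> L1norm (\<lambda>t. s i (t - h) - s i t) \<le> ennreal (e/2)"
    using lim.IH[of "e/2" i] lim.prems by auto
  show ?case
  proof (intro exI[of _ d] conjI allI impI)
    fix h :: real assume h: "\<bar>h\<bar> < d"
    have "L1norm (\<lambda>t. f (t - h) - f t)
      \<le> (\<integral>\<^sup>+t. (ennreal \<bar>f (t - h) - s i (t - h)\<bar> + ennreal \<bar>s i (t - h) - s i t\<bar>) + ennreal \<bar>f t - s i t\<bar> \<partial>lborel)"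
      by (intro nn_integral_mono) (auto simp flip: ennreal_plus intro!: ennreal_leI)
    also have "\<dots> = (L1norm (\<lambda>t. f (t - h) - s i (t - h)) + L1norm (\<lambda>t. s i (t - h) - s i t))
        + L1norm (\<lambda>t. f t - s i t)"
      by ((subst nn_integral_add, measurable)+)
    also have "\<dots> \<le> (ennreal (e/4) + ennreal (e/2)) + ennreal (e/4)"
      using d h i nn_integral_shift[of "\<lambda>t. ennreal \<bar>f t - s i t\<bar>" h] by (intro add_mono) auto
    also have "\<dots> = ennreal e" using lim.prems by (simp flip: ennreal_plus)
    finally show "L1norm (\<lambda>t. f (t - h) - f t) \<le> ennreal e" .
  qed (use d in auto)
qed

section \<open>Convolution\<close>

definition conv :: "(real \<Rightarrow> real) \<Rightarrow> (real \<Rightarrow> real) \<Rightarrow> real \<Rightarrow> real" where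
  "conv k f t = (LBINT u. k u * f (t - u))"

lemma conv_measurable [measurable]:
  assumes [measurable]: "k \<in> borel_measurable borel" "f \<in> borel_measurable borel"
  shows "conv k f \<in> borel_measurable borel"
  unfolding conv_def by measurable

lemma conv_commute: "conv k f t = conv f k t"
  unfolding conv_def using integral_reflect_shift[of "\<lambda>u. k u * f (t - u)" t] by (simp add: mult.commute)

lemma nn_integral_conv_kernel:
  fixes k f :: "real \<Rightarrow> real"
  assumes [measurable]: "k \<in> borel_measurable borel" "f \<in> borel_measurable borel"
  shows "(\<integral>\<^sup>+t. \<integral>\<^sup>+u. ennreal \<bar>k u * f (t - u)\<bar> \<partial>lborel \<partial>lborel)
    = L1norm k * L1norm f"
proof -
  have "(\<integral>\<^sup>+t. \<integral>\<^sup>+u. ennreal \<bar>k u * f (t - u)\<bar> \<partial>lborel \<partial>lborel)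
    = (\<integral>\<^sup>+u. \<integral>\<^sup>+t. ennreal \<bar>k u * f (t - u)\<bar> \<partial>lborel \<partial>lborel)"
    by (rule lborel_pair.Fubini'[symmetric]) measurable
  also have "\<dots> = (\<integral>\<^sup>+u. ennreal \<bar>k u\<bar> * L1norm f \<partial>lborel)"
    by (intro nn_integral_cong)
       (simp add: abs_mult ennreal_mult nn_integral_cmult nn_integral_shift[of "\<lambda>t. ennreal \<bar>f t\<bar>"])
  also have "\<dots> = L1norm k * L1norm f"
    by (rule nn_integral_multc) measurable
  finally show ?thesis .
qed

lemma nn_integral_conv_le:
  fixes k f :: "real \<Rightarrow> real"
  assumes [measurable]: "k \<in> borel_measurable borel" "f \<in> borel_measurable borel"
  shows "L1norm (\<lambda>t. conv k f t)
    \<le> L1norm k * L1norm f"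
  unfolding nn_integral_conv_kernel[OF assms, symmetric]
  by (intro nn_integral_mono) (simp add: conv_def ennreal_abs_integral_le)

lemma conv_AE_integrable:
  fixes f :: "real \<Rightarrow> real"
  assumes "integrable lborel k" "integrable lborel f"
  shows "AE t in lborel. integrable lborel (\<lambda>u. k u * f (t - u))"
proof -
  have [measurable]: "k \<in> borel_measurable borel" "f \<in> borel_measurable borel"
    using assms by (auto dest: borel_measurable_integrable)
  have "(\<integral>\<^sup>+t. \<integral>\<^sup>+u. ennreal \<bar>k u * f (t - u)\<bar> \<partial>lborel \<partial>lborel) < \<infinity>"
    using assms[THEN integrable_nn_finite] by (simp add: nn_integral_conv_kernel ennreal_mult_less_top)
  then have "AE t in lborel. L1norm (\<lambda>u. k u * f (t - u)) \<noteq> \<infinity>"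
    by (intro nn_integral_PInf_AE) auto
  then show ?thesis
    by eventually_elim (simp add: integrable_iff_bounded less_top)
qed

lemma conv_integrable:
  fixes f :: "real \<Rightarrow> real"
  assumes "integrable lborel k" "integrable lborel f"
  shows "integrable lborel (conv k f)"
proof -
  have [measurable]: "k \<in> borel_measurable borel" "f \<in> borel_measurable borel"
    using assms by (auto dest: borel_measurable_integrable)
  have "L1norm (\<lambda>t. conv k f t) < \<infinity>"
    using assms[THEN integrable_nn_finite]
    by (intro le_less_trans[OF nn_integral_conv_le]) (auto simp: ennreal_mult_less_top)
  then show ?thesis by (simp add: integrable_iff_bounded)
qed

lemma conv_diff_left_AE:
  fixes f :: "real \<Rightarrow> real"
  assumes "integrable lborel k" "integrable lborel l" "integrable lborel f"
  shows "AE t in lborel. conv (\<lambda>u. k u - l u) f t = conv k f t - conv l f t"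
  using conv_AE_integrable[OF assms(1,3)] conv_AE_integrable[OF assms(2,3)]
  by eventually_elim (simp add: conv_def left_diff_distrib)

lemma conv_diff_right_AE:
  fixes f :: "real \<Rightarrow> real"
  assumes "integrable lborel k" "integrable lborel f" "integrable lborel g"
  shows "AE t in lborel. conv k (\<lambda>u. f u - g u) t = conv k f t - conv k g t"
  using conv_AE_integrable[OF assms(1,2)] conv_AE_integrable[OF assms(1,3)]
  by eventually_elim (simp add: conv_def right_diff_distrib)

text \<open>Both sides are iterated integrals of the same function of two variables. It is absolutely
  integrable for almost every \<open>t\<close>, because the integral of its absolute value over \<open>t\<close> as well is
  the product of three \<open>L\<^sup>1\<close> norms.\<close>
lemma conv_assoc_AE:
  fixes f :: "real \<Rightarrow> real"
  assumes j: "integrable lborel j" and k: "integrable lborel k" and f: "integrable lborel f"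
  shows "AE t in lborel. conv j (conv k f) t = conv (conv j k) f t"
proof -
  have [measurable]: "j \<in> borel_measurable borel" "k \<in> borel_measurable borel" "f \<in> borel_measurable borel"
    using assms by (auto dest: borel_measurable_integrable)
  let ?H = "\<lambda>t u w. j u * k (w - u) * f (t - w)"
  have "(\<integral>\<^sup>+t. \<integral>\<^sup>+w. \<integral>\<^sup>+u. ennreal \<bar>?H t u w\<bar> \<partial>lborel \<partial>lborel \<partial>lborel)
      = (\<integral>\<^sup>+w. \<integral>\<^sup>+t. \<integral>\<^sup>+u. ennreal \<bar>?H t u w\<bar> \<partial>lborel \<partial>lborel \<partial>lborel)"
    by (rule lborel_pair.Fubini'[symmetric]) measurable
  also have "\<dots> = (\<integral>\<^sup>+w. L1norm (\<lambda>u. j u * k (w - u)) * L1norm f \<partial>lborel)"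
  proof (intro nn_integral_cong)
    fix w :: real
    have "(\<integral>\<^sup>+t. \<integral>\<^sup>+u. ennreal \<bar>?H t u w\<bar> \<partial>lborel \<partial>lborel)
      = (\<integral>\<^sup>+t. L1norm (\<lambda>u. j u * k (w - u)) * ennreal \<bar>f (t - w)\<bar> \<partial>lborel)"
      by (intro nn_integral_cong, subst abs_mult, subst ennreal_mult) (auto simp: nn_integral_multc)
    also have "\<dots> = L1norm (\<lambda>u. j u * k (w - u)) * L1norm f"
      by (simp add: nn_integral_cmult nn_integral_shift[of "\<lambda>t. ennreal \<bar>f t\<bar>"])
    finally show "(\<integral>\<^sup>+t. \<integral>\<^sup>+u. ennreal \<bar>?H t u w\<bar> \<partial>lborel \<partial>lborel)
      = L1norm (\<lambda>u. j u * k (w - u)) * L1norm f" .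
  qed
  also have "\<dots> = (\<integral>\<^sup>+w. \<integral>\<^sup>+u. ennreal \<bar>j u * k (w - u)\<bar> \<partial>lborel \<partial>lborel) * L1norm f"
    by (rule nn_integral_multc) measurable
  also have "\<dots> < \<infinity>"
    using assms[THEN integrable_nn_finite] by (simp add: nn_integral_conv_kernel ennreal_mult_less_top)
  finally have "AE t in lborel. (\<integral>\<^sup>+w. \<integral>\<^sup>+u. ennreal \<bar>?H t u w\<bar> \<partial>lborel \<partial>lborel) \<noteq> \<infinity>"
    by (intro nn_integral_PInf_AE) auto
  then show ?thesis
  proof eventually_elim
    case (elim t)
    have "(\<integral>\<^sup>+p. ennreal (norm (case p of (w, u) \<Rightarrow> ?H t u w)) \<partial>(lborel \<Otimes>\<^sub>M lborel))
       = (\<integral>\<^sup>+w. \<integral>\<^sup>+u. ennreal \<bar>?H t u w\<bar> \<partial>lborel \<partial>lborel)"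
      by (subst lborel.nn_integral_fst[symmetric]) auto
    then have int: "integrable (lborel \<Otimes>\<^sub>M lborel) (\<lambda>(w, u). ?H t u w)"
      using elim by (intro integrableI_bounded) (auto simp: less_top)
    have "conv (conv j k) f t = (LBINT w. LBINT u. ?H t u w)"
      unfolding conv_def by simp
    also have "\<dots> = (LBINT u. LBINT w. ?H t u w)"
      by (rule lborel_pair.Fubini_integral[OF int, symmetric])
    also have "\<dots> = (LBINT u. j u * (LBINT w. k (w - u) * f (t - w)))"
      by (simp add: mult.assoc)
    also have "\<dots> = conv j (conv k f) t"
      unfolding conv_def
    proof (intro Bochner_Integration.integral_cong refl)
      fix u show "j u * (LBINT w. k (w - u) * f (t - w)) = j u * (LBINT v. k v * f (t - u - v))"
        using lborel_integral_real_affine[of 1 "\<lambda>w. k (w - u) * f (t - w)" u] by (simp add: algebra_simps)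
    qed
    finally show ?case ..
  qed
qed

text \<open>A kernel that vanishes on negative arguments sees only the past of the function. This is what
  makes the cut-off at the right end point of an interval harmless.\<close>
lemma conv_cong_past:
  assumes [measurable]: "k \<in> borel_measurable borel" "f \<in> borel_measurable borel" "g \<in> borel_measurable borel"
    and k: "\<And>u. u < 0 \<Longrightarrow> k u = 0" and fg: "AE r in lborel. r \<le> b \<longrightarrow> f r = g r" and t: "t \<le> b"
  shows "conv k f t = conv k g t"
  unfolding conv_def
proof (rule integral_cong_AE)
  have "AE u in lborel. t - u \<le> b \<longrightarrow> f (t - u) = g (t - u)"
    by (rule AE_reflect_shift[OF _ fg]) measurable
  then show "AE u in lborel. k u * f (t - u) = k u * g (t - u)"
  proof eventually_elim
    case (elim u)
    then show ?case using k[of u] t by (cases "u < 0") auto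
  qed
qed measurable

text \<open>If the function vanishes before \<open>a\<close>, only the kernel at lags up to \<open>t - a\<close> matters.\<close>
lemma conv_cong_kernel:
  assumes f: "\<And>r. r < a \<Longrightarrow> f r = 0" and kl: "\<And>u. u \<le> t - a \<Longrightarrow> k u = l u"
  shows "conv k f t = conv l f t"
  unfolding conv_def using assms by (intro Bochner_Integration.integral_cong refl) (metis diff_gt_0_iff_gt diff_diff_eq2 diff_less_eq less_diff_eq linorder_not_less mult_zero_right add.commute)

text \<open>After the substitution \<open>v = \<epsilon> * s\<close> the error is an average, with weight \<open>K\<close>, of the \<open>L\<^sup>1\<close> distances
  between \<open>f\<close> and its translates by \<open>\<epsilon> * s\<close>. These tend to \<open>0\<close> and are at most twice the norm of \<open>f\<close>.\<close>
lemma approximate_identity_L1: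
  fixes f K :: "real \<Rightarrow> real"
  assumes K: "integrable lborel K" "(LBINT s. K s) = 1" and f: "integrable lborel f"
  shows "((\<lambda>\<epsilon>. L1norm (\<lambda>t. conv (\<lambda>v. K (v / \<epsilon>) / \<epsilon>) f t - f t)) \<longlongrightarrow> 0) (at_right 0)"
proof -
  have [measurable]: "K \<in> borel_measurable borel" "f \<in> borel_measurable borel"
    using assms by (auto dest: borel_measurable_integrable)
  define \<tau> where "\<tau> h = L1norm (\<lambda>t. f (t - h) - f t)" for h
  define N where "N = L1norm f"
  have N: "N < \<infinity>" unfolding N_def by (rule integrable_nn_finite[OF f])
  have [measurable]: "\<tau> \<in> borel_measurable borel" unfolding \<tau>_def by measurable
  have \<tau>_le: "\<tau> h \<le> 2 * N" for h
  proof -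
    have "\<tau> h \<le> (\<integral>\<^sup>+t. ennreal \<bar>f (t - h)\<bar> + ennreal \<bar>f t\<bar> \<partial>lborel)"
      unfolding \<tau>_def by (intro nn_integral_mono) (auto simp flip: ennreal_plus intro!: ennreal_leI)
    also have "\<dots> = N + N"
      unfolding N_def by (subst nn_integral_add) (auto simp: nn_integral_shift[of "\<lambda>t. ennreal \<bar>f t\<bar>"])
    finally show ?thesis by (simp add: mult_2)
  qed
  have \<tau>_lim: "(\<tau> \<longlongrightarrow> 0) (nhds 0)"
  proof (rule order_tendstoI)
    fix e :: ennreal assume "0 < e"
    then obtain z where z: "0 < z" "z < e" using dense by blast
    then obtain r where r: "r > 0" "ennreal r < e" by (cases z) auto
    obtain d where d: "d > 0" "\<And>h. \<bar>h\<bar> < d \<Longrightarrow> \<tau> h \<le> ennreal r"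
      using translation_continuous_L1[OF f r(1)] unfolding \<tau>_def by blast
    show "\<forall>\<^sub>F h in nhds 0. \<tau> h < e"
      unfolding eventually_nhds_metric using d r(2) by (intro exI[of _ d]) (auto simp: dist_real_def intro: le_less_trans)
  qed simp
  have bound: "L1norm (\<lambda>t. conv (\<lambda>v. K (v / \<epsilon>) / \<epsilon>) f t - f t)
      \<le> (\<integral>\<^sup>+s. ennreal \<bar>K s\<bar> * \<tau> (\<epsilon> * s) \<partial>lborel)" if \<epsilon>: "\<epsilon> > 0" for \<epsilon>
  proof -
    have Ki: "integrable lborel (\<lambda>v. K (v / \<epsilon>) / \<epsilon>)"
      using lborel_integrable_real_affine[OF K(1), of "1/\<epsilon>" 0] \<epsilon> by simp
    have "AE t in lborel. ennreal \<bar>conv (\<lambda>v. K (v / \<epsilon>) / \<epsilon>) f t - f t\<bar>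
        \<le> L1norm (\<lambda>s. K s * (f (t - \<epsilon> * s) - f t))"
      using conv_AE_integrable[OF Ki f]
    proof eventually_elim
      case (elim t)
      have i1: "integrable lborel (\<lambda>s. K s * f (t - \<epsilon> * s))"
        using integrable_mult_right[OF lborel_integrable_real_affine[OF elim, of \<epsilon> 0], of \<epsilon>] \<epsilon> by simp
      have "conv (\<lambda>v. K (v / \<epsilon>) / \<epsilon>) f t = (LBINT s. K s * f (t - \<epsilon> * s))"
        unfolding conv_def using lborel_integral_real_affine[of \<epsilon> "\<lambda>u. K (u / \<epsilon>) / \<epsilon> * f (t - u)" 0] \<epsilon>
        by simp
      moreover have "f t = (LBINT s. K s * f t)"
        using K by simp
      ultimately have "conv (\<lambda>v. K (v / \<epsilon>) / \<epsilon>) f t - f t = (LBINT s. K s * (f (t - \<epsilon> * s) - f t))"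
        using i1 K by (simp add: right_diff_distrib)
      then show ?case by (simp add: ennreal_abs_integral_le)
    qed
    then have "L1norm (\<lambda>t. conv (\<lambda>v. K (v / \<epsilon>) / \<epsilon>) f t - f t)
      \<le> (\<integral>\<^sup>+t. \<integral>\<^sup>+s. ennreal \<bar>K s * (f (t - \<epsilon> * s) - f t)\<bar> \<partial>lborel \<partial>lborel)"
      by (rule nn_integral_mono_AE)
    also have "\<dots> = (\<integral>\<^sup>+s. \<integral>\<^sup>+t. ennreal \<bar>K s * (f (t - \<epsilon> * s) - f t)\<bar> \<partial>lborel \<partial>lborel)"
      by (rule lborel_pair.Fubini'[symmetric]) measurable
    also have "\<dots> = (\<integral>\<^sup>+s. ennreal \<bar>K s\<bar> * \<tau> (\<epsilon> * s) \<partial>lborel)"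
      unfolding \<tau>_def by (intro nn_integral_cong) (simp add: abs_mult ennreal_mult nn_integral_cmult)
    finally show ?thesis .
  qed
  have lim: "((\<lambda>\<epsilon>. \<integral>\<^sup>+s. ennreal \<bar>K s\<bar> * \<tau> (\<epsilon> * s) \<partial>lborel) \<longlongrightarrow> 0) (at_right 0)"
    unfolding tendsto_at_iff_sequentially
  proof (intro allI impI)
    fix X :: "nat \<Rightarrow> real" assume X: "X \<longlonglongrightarrow> 0"
    have "(\<lambda>i. \<integral>\<^sup>+s. ennreal \<bar>K s\<bar> * \<tau> (X i * s) \<partial>lborel) \<longlonglongrightarrow> (\<integral>\<^sup>+s. 0 \<partial>(lborel::real measure))"
    proof (rule nn_integral_dominated_convergence[where w="\<lambda>s. ennreal \<bar>K s\<bar> * (2 * N)"])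
      show "(\<integral>\<^sup>+s. ennreal \<bar>K s\<bar> * (2 * N) \<partial>lborel) < \<infinity>"
        using integrable_nn_finite[OF K(1)] N by (simp add: nn_integral_multc ennreal_mult_less_top)
      show "AE s in lborel. (\<lambda>i. ennreal \<bar>K s\<bar> * \<tau> (X i * s)) \<longlonglongrightarrow> 0"
      proof (rule AE_I2)
        fix s
        have "(\<lambda>i. X i * s) \<longlonglongrightarrow> 0" using tendsto_mult_right[OF X, of s] by simp
        from filterlim_compose[OF \<tau>_lim this]
        have "(\<lambda>i. ennreal \<bar>K s\<bar> * \<tau> (X i * s)) \<longlonglongrightarrow> ennreal \<bar>K s\<bar> * 0"
          by (intro ennreal_tendsto_cmult) auto
        then show "(\<lambda>i. ennreal \<bar>K s\<bar> * \<tau> (X i * s)) \<longlonglongrightarrow> 0" by simp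
      qed
    qed (auto intro!: AE_I2 mult_left_mono \<tau>_le)
    then show "((\<lambda>\<epsilon>. \<integral>\<^sup>+s. ennreal \<bar>K s\<bar> * \<tau> (\<epsilon> * s) \<partial>lborel) \<circ> X) \<longlonglongrightarrow> 0"
      by (simp add: comp_def)
  qed
  show ?thesis by (rule tendsto_zero_at_right_le[OF lim bound])
qed

section \<open>Kernels of fractional calculus\<close>

lemma nn_integral_powr_from_0:
  assumes "p > -1" "c \<ge> 0"
  shows "(\<integral>\<^sup>+u. ennreal (indicator {0..c} u * u powr p) \<partial>lborel) = ennreal (c powr (p + 1) / (p + 1))"
  by (rule nn_integral_has_integral_lebesgue[OF _ has_integral_powr_from_0]) (use assms in auto)

lemma nn_integral_powr_to_inf:
  assumes "p < -1" "c > 0"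
  shows "(\<integral>\<^sup>+u. ennreal (indicator {c..} u * u powr p) \<partial>lborel) = ennreal (- (c powr (p + 1)) / (p + 1))"
  by (rule nn_integral_has_integral_lebesgue[OF _ has_integral_powr_to_inf]) (use assms in auto)

text \<open>The kernel of the fractional integral of order \<open>\<alpha>\<close>, cut off at \<open>L\<close> to make it integrable on the
  line. On an interval of length \<open>L\<close> the cut-off has no effect.\<close>
definition riesz_kernel :: "real \<Rightarrow> real \<Rightarrow> real \<Rightarrow> real" where
  "riesz_kernel L \<alpha> u = (if 0 < u \<and> u \<le> L then u powr (\<alpha> - 1) / Gamma \<alpha> else 0)"

definition tail_kernel :: "real \<Rightarrow> real \<Rightarrow> real \<Rightarrow> real" where
  "tail_kernel \<alpha> \<epsilon> u = (if \<epsilon> \<le> u then u powr (- 1 - \<alpha>) else 0)"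

text \<open>The truncated derivative of order \<open>\<alpha>\<close> at scale \<open>1\<close> of a fractional integral of order \<open>\<alpha>\<close> is the
  convolution with this kernel.\<close>
definition marchaud_kernel :: "real \<Rightarrow> real \<Rightarrow> real" where
  "marchaud_kernel \<alpha> s = (if 0 < s then (s powr \<alpha> - (max 0 (s - 1)) powr \<alpha>) / s / (Gamma \<alpha> * Gamma (1 - \<alpha>)) else 0)"

lemma riesz_measurable [measurable]: "riesz_kernel L \<alpha> \<in> borel_measurable borel"
  unfolding riesz_kernel_def by measurable
lemma tail_kernel_measurable [measurable]: "tail_kernel \<alpha> \<epsilon> \<in> borel_measurable borel"
  unfolding tail_kernel_def by measurable
lemma marchaud_kernel_measurable [measurable]: "marchaud_kernel \<alpha> \<in> borel_measurable borel"
  unfolding marchaud_kernel_def by measurable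

lemma riesz_nonneg: "0 < \<alpha> \<Longrightarrow> 0 \<le> riesz_kernel L \<alpha> u"
  by (auto simp: riesz_kernel_def intro!: divide_nonneg_pos Gamma_real_pos)
lemma tail_kernel_nonneg: "0 \<le> tail_kernel \<alpha> \<epsilon> u"
  by (auto simp: tail_kernel_def)

lemma nn_integral_riesz:
  assumes "0 < \<alpha>" "0 \<le> L"
  shows "(\<integral>\<^sup>+u. ennreal (riesz_kernel L \<alpha> u) \<partial>lborel) = ennreal (L powr \<alpha> / (\<alpha> * Gamma \<alpha>))"
proof -
  have "(\<integral>\<^sup>+u. ennreal (riesz_kernel L \<alpha> u) \<partial>lborel)
     = (\<integral>\<^sup>+u. ennreal (1 / Gamma \<alpha>) * ennreal (indicator {0..L} u * u powr (\<alpha> - 1)) \<partial>lborel)"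
    using Gamma_real_pos[OF assms(1)]
    by (intro nn_integral_cong) (auto simp: riesz_kernel_def indicator_def simp flip: ennreal_mult)
  also have "\<dots> = ennreal (1 / Gamma \<alpha>) * ennreal (L powr \<alpha> / \<alpha>)"
    using nn_integral_powr_from_0[of "\<alpha> - 1" L] assms by (subst nn_integral_cmult) auto
  also have "\<dots> = ennreal (L powr \<alpha> / (\<alpha> * Gamma \<alpha>))"
    using assms Gamma_real_pos[OF assms(1)] by (simp add: field_simps flip: ennreal_mult)
  finally show ?thesis .
qed

lemma riesz_integrable:
  assumes "0 < \<alpha>" "0 \<le> L" shows "integrable lborel (riesz_kernel L \<alpha>)"
  using nn_integral_riesz[OF assms] riesz_nonneg[OF assms(1)]
  by (intro integrableI_bounded) auto

lemma nn_integral_tail: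
  assumes "0 < \<alpha>" "0 < \<epsilon>"
  shows "(\<integral>\<^sup>+u. ennreal (tail_kernel \<alpha> \<epsilon> u) \<partial>lborel) = ennreal (\<epsilon> powr (-\<alpha>) / \<alpha>)"
proof -
  have "(\<integral>\<^sup>+u. ennreal (tail_kernel \<alpha> \<epsilon> u) \<partial>lborel) = (\<integral>\<^sup>+u. ennreal (indicator {\<epsilon>..} u * u powr (- 1 - \<alpha>)) \<partial>lborel)"
    by (intro nn_integral_cong) (auto simp: tail_kernel_def indicator_def)
  then show ?thesis using nn_integral_powr_to_inf[of "- 1 - \<alpha>" \<epsilon>] assms by simp
qed

lemma tail_kernel_integrable:
  assumes "0 < \<alpha>" "0 < \<epsilon>" shows "integrable lborel (tail_kernel \<alpha> \<epsilon>)" 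
  using nn_integral_tail[OF assms] tail_kernel_nonneg by (intro integrableI_bounded) auto

lemma tail_kernel_integral:
  assumes "0 < \<alpha>" "0 < \<epsilon>" shows "(LBINT u. tail_kernel \<alpha> \<epsilon> u) = \<epsilon> powr (-\<alpha>) / \<alpha>"
  using assms by (subst integral_eq_nn_integral) (auto simp: tail_kernel_nonneg nn_integral_tail)

text \<open>In the variable \<open>(v - u) / u\<close> the integrand becomes a pure power, whence the closed form.\<close>
lemma conv_tail_riesz:
  assumes "0 < \<alpha>" "\<alpha> < 1" "0 < \<epsilon>" "v \<le> L"
  shows "conv (tail_kernel \<alpha> \<epsilon>) (riesz_kernel L \<alpha>) v
    = (if \<epsilon> < v then ((v - \<epsilon>) / \<epsilon>) powr \<alpha> / (\<alpha> * v) / Gamma \<alpha> else 0)"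
proof (cases "\<epsilon> < v")
  case False
  then have *: "tail_kernel \<alpha> \<epsilon> u * riesz_kernel L \<alpha> (v - u) = 0" for u by (auto simp: tail_kernel_def riesz_kernel_def)
  show ?thesis unfolding conv_def * using False by simp
next
  case True
  let ?F = "\<lambda>u. - (((v - u) / u) powr \<alpha> / (\<alpha> * v))"
  let ?f = "\<lambda>u. u powr (- 1 - \<alpha>) * (v - u) powr (\<alpha> - 1)"
  have "(?f has_integral (?F v - ?F \<epsilon>)) {\<epsilon>..v}"
  proof (rule fundamental_theorem_of_calculus_interior)
    show "continuous_on {\<epsilon>..v} ?F"
      using assms True by (intro continuous_intros continuous_on_powr') auto
    fix u assume u: "u \<in> {\<epsilon><..<v}"
    then have u': "0 < u" "u < v" using assms by auto
    have "(?F has_real_derivative - (\<alpha> * ((v - u) / u) powr (\<alpha> - 1) * (((- 1) * u - (v - u) * 1) / (u * u)) / (\<alpha> * v))) (at u)"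
      using u' assms by (auto intro!: derivative_eq_intros)
    also have "- (\<alpha> * ((v - u) / u) powr (\<alpha> - 1) * (((- 1) * u - (v - u) * 1) / (u * u)) / (\<alpha> * v)) = ?f u"
    proof -
      have "- (\<alpha> * ((v - u) / u) powr (\<alpha> - 1) * (((- 1) * u - (v - u) * 1) / (u * u)) / (\<alpha> * v)) 
         = ((v - u) / u) powr (\<alpha> - 1) / (u * u)"
        using u' assms by (simp add: field_simps)
      also have "\<dots> = (v - u) powr (\<alpha> - 1) * (u powr (1 - \<alpha>) * u powr (- 2))"
        using u' powr_minus_divide[of u "\<alpha> - 1"] powr_minus_divide[of u 2]
        by (simp add: powr_divide powr_numeral power2_eq_square)
      also have "u powr (1 - \<alpha>) * u powr (- 2) = u powr (- 1 - \<alpha>)"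
        by (simp flip: powr_add)
      finally show ?thesis by simp
    qed
    finally show "(?F has_vector_derivative ?f u) (at u)"
      by (simp add: has_real_derivative_iff_has_vector_derivative)
  qed (use True in auto)
  then have "(\<integral>\<^sup>+u. ennreal (indicator {\<epsilon>..v} u * ?f u) \<partial>lborel) = ennreal (((v - \<epsilon>) / \<epsilon>) powr \<alpha> / (\<alpha> * v))"
    by (subst nn_integral_has_integral_lebesgue) auto
  then have I: "(LBINT u. indicator {\<epsilon>..v} u * ?f u) = ((v - \<epsilon>) / \<epsilon>) powr \<alpha> / (\<alpha> * v)"
    using assms True by (subst integral_eq_nn_integral) auto
  have "conv (tail_kernel \<alpha> \<epsilon>) (riesz_kernel L \<alpha>) v = (LBINT u. indicator {\<epsilon>..v} u * ?f u * (1 / Gamma \<alpha>))"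
    unfolding conv_def using assms by (intro Bochner_Integration.integral_cong) (auto simp: tail_kernel_def riesz_kernel_def indicator_def)
  also have "\<dots> = (LBINT u. indicator {\<epsilon>..v} u * ?f u) * (1 / Gamma \<alpha>)"
    by (rule integral_mult_left_zero)
  finally show ?thesis using I True by simp
qed

text \<open>The kernels at different \<open>\<epsilon>\<close> are dilations of a single function; this makes
  \<open>approximate_identity_L1\<close> applicable.\<close>
lemma truncated_kernel_eq:
  assumes "0 < \<alpha>" "\<alpha> < 1" "0 < \<epsilon>" "v \<le> L"
  shows "\<epsilon> powr (-\<alpha>) * riesz_kernel L \<alpha> v - \<alpha> * conv (tail_kernel \<alpha> \<epsilon>) (riesz_kernel L \<alpha>) v = Gamma (1 - \<alpha>) * (marchaud_kernel \<alpha> (v / \<epsilon>) / \<epsilon>)"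
proof -
  have G: "Gamma \<alpha> \<noteq> 0" "Gamma (1 - \<alpha>) \<noteq> 0"
    using less_imp_neq[OF Gamma_real_pos[of \<alpha>]] less_imp_neq[OF Gamma_real_pos[of "1 - \<alpha>"]] assms by auto
  consider "v \<le> 0" | "0 < v" "v \<le> \<epsilon>" | "\<epsilon> < v" by linarith
  then show ?thesis
  proof cases
    case 1
    then show ?thesis using assms by (simp add: conv_tail_riesz riesz_kernel_def marchaud_kernel_def zero_less_divide_iff)
  next
    case 2
    have "max 0 (v / \<epsilon> - 1) = 0" using 2 assms by (simp add: field_simps)
    then show ?thesis using 2 assms G
      by (simp add: conv_tail_riesz riesz_kernel_def marchaud_kernel_def powr_diff powr_divide powr_minus field_simps)
  next
    case 3
    have "max 0 (v / \<epsilon> - 1) = (v - \<epsilon>) / \<epsilon>" using 3 assms by (simp add: field_simps)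
    then show ?thesis using 3 assms G
      by (simp add: conv_tail_riesz riesz_kernel_def marchaud_kernel_def powr_diff powr_divide powr_minus field_simps)
  qed
qed

lemma nn_integral_exp_powr:
  assumes "s > 0" "c > 0"
  shows "(\<integral>\<^sup>+t. ennreal (indicator {0<..} t * t powr (s - 1) * exp (- (c * t))) \<partial>lborel) = ennreal (Gamma s * c powr (- s))"
proof -
  have "ennreal (Gamma s) = (\<integral>\<^sup>+t. ennreal (indicator {0..} t * t powr (s - 1) / exp t) \<partial>lborel)"
    by (rule Gamma_conv_nn_integral_real[OF assms(1)])
  also have "\<dots> = ennreal c * (\<integral>\<^sup>+t. ennreal (indicator {0..} (c * t) * (c * t) powr (s - 1) / exp (c * t)) \<partial>lborel)"
    using nn_integral_real_affine[of "\<lambda>t. ennreal (indicator {0..} t * t powr (s - 1) / exp t)" c 0] assms by simp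
  also have "\<dots> = ennreal c * (\<integral>\<^sup>+t. ennreal (c powr (s - 1)) * ennreal (indicator {0<..} t * t powr (s - 1) * exp (- (c * t))) \<partial>lborel)"
    using assms by (intro arg_cong2[where f="(*)"] nn_integral_cong refl)
      (auto simp: indicator_def powr_mult exp_minus field_simps zero_le_mult_iff simp flip: ennreal_mult)
  also have "\<dots> = ennreal (c powr s) * (\<integral>\<^sup>+t. ennreal (indicator {0<..} t * t powr (s - 1) * exp (- (c * t))) \<partial>lborel)"
    using assms by (subst nn_integral_cmult) (auto simp: powr_diff mult.assoc[symmetric] simp flip: ennreal_mult)
  finally have "ennreal (c powr (- s)) * ennreal (Gamma s) = ennreal (c powr (- s)) * (ennreal (c powr s) * (\<integral>\<^sup>+t. ennreal (indicator {0<..} t * t powr (s - 1) * exp (- (c * t))) \<partial>lborel))"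
    by simp
  also have "\<dots> = (\<integral>\<^sup>+t. ennreal (indicator {0<..} t * t powr (s - 1) * exp (- (c * t))) \<partial>lborel)"
    using assms by (simp add: mult.assoc[symmetric] powr_minus flip: ennreal_mult)
  finally show ?thesis using assms Gamma_real_pos[OF assms(1)] by (simp add: mult.commute ennreal_mult)
qed

text \<open>Write \<open>1 / (x + v)\<close> as the Laplace integral of \<open>exp (- (x + v) * l)\<close> and integrate in \<open>v\<close> first.\<close>
lemma nn_integral_Beta_half_line:
  assumes "0 < \<alpha>" "\<alpha> < 1" "x > 0"
  shows "(\<integral>\<^sup>+v. ennreal (indicator {0<..} v * v powr (\<alpha> - 1) / (x + v)) \<partial>lborel)
    = ennreal (Gamma \<alpha> * Gamma (1 - \<alpha>) * x powr (\<alpha> - 1))"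
proof -
  have e: "ennreal (1 / (x + v)) = (\<integral>\<^sup>+l. ennreal (indicator {0<..} l * exp (- ((x + v) * l))) \<partial>lborel)" if "v > 0" for v
  proof -
    have "(\<integral>\<^sup>+l. ennreal (indicator {0<..} l * exp (- ((x + v) * l))) \<partial>lborel)
      = (\<integral>\<^sup>+l. ennreal (indicator {0<..} l * l powr (1 - 1) * exp (- ((x + v) * l))) \<partial>lborel)"
      by (intro nn_integral_cong) (auto simp: indicator_def)
    then show ?thesis
    using nn_integral_exp_powr[of 1 "x + v"] that assms by (simp add: powr_minus field_simps)
  qed
  have "(\<integral>\<^sup>+v. ennreal (indicator {0<..} v * v powr (\<alpha> - 1) / (x + v)) \<partial>lborel)
    = (\<integral>\<^sup>+v. \<integral>\<^sup>+l. ennreal (indicator {0<..} v * v powr (\<alpha> - 1)) * ennreal (indicator {0<..} l * exp (- ((x + v) * l))) \<partial>lborel \<partial>lborel)"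
  proof (intro nn_integral_cong)
    fix v :: real
    show "ennreal (indicator {0<..} v * v powr (\<alpha> - 1) / (x + v))
      = (\<integral>\<^sup>+l. ennreal (indicator {0<..} v * v powr (\<alpha> - 1)) * ennreal (indicator {0<..} l * exp (- ((x + v) * l))) \<partial>lborel)"
    proof (cases "v > 0")
      case True
      have "(\<integral>\<^sup>+l. ennreal (indicator {0<..} v * v powr (\<alpha> - 1)) * ennreal (indicator {0<..} l * exp (- ((x + v) * l))) \<partial>lborel)
        = ennreal (v powr (\<alpha> - 1)) * ennreal (1 / (x + v))"
        unfolding e[OF True] using True by (subst nn_integral_cmult) auto
      then show ?thesis using True assms by (simp flip: ennreal_mult)
    qed simp
  qed
  also have "\<dots> = (\<integral>\<^sup>+l. \<integral>\<^sup>+v. ennreal (indicator {0<..} v * v powr (\<alpha> - 1)) * ennreal (indicator {0<..} l * exp (- ((x + v) * l))) \<partial>lborel \<partial>lborel)"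
    by (rule lborel_pair.Fubini'[symmetric]) measurable
  also have "\<dots> = (\<integral>\<^sup>+l. ennreal (Gamma \<alpha>) * ennreal (indicator {0<..} l * l powr ((1 - \<alpha>) - 1) * exp (- (x * l))) \<partial>lborel)"
  proof (intro nn_integral_cong)
    fix l :: real
    show "(\<integral>\<^sup>+v. ennreal (indicator {0<..} v * v powr (\<alpha> - 1)) * ennreal (indicator {0<..} l * exp (- ((x + v) * l))) \<partial>lborel)
      = ennreal (Gamma \<alpha>) * ennreal (indicator {0<..} l * l powr ((1 - \<alpha>) - 1) * exp (- (x * l)))"
    proof (cases "l > 0")
      case True
      have "(\<integral>\<^sup>+v. ennreal (indicator {0<..} v * v powr (\<alpha> - 1)) * ennreal (indicator {0<..} l * exp (- ((x + v) * l))) \<partial>lborel)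
        = (\<integral>\<^sup>+v. ennreal (exp (- (x * l))) * ennreal (indicator {0<..} v * v powr (\<alpha> - 1) * exp (- (l * v))) \<partial>lborel)"
        using True by (intro nn_integral_cong) (auto simp: indicator_def ring_distribs exp_add exp_minus exp_diff field_simps simp flip: ennreal_mult)
      also have "\<dots> = ennreal (exp (- (x * l))) * ennreal (Gamma \<alpha> * l powr (- \<alpha>))"
        using nn_integral_exp_powr[OF assms(1) True] by (subst nn_integral_cmult) auto
      finally show ?thesis using True Gamma_real_pos[OF assms(1)]
        by (simp flip: ennreal_mult add: mult_ac)
    qed simp
  qed
  also have "\<dots> = ennreal (Gamma \<alpha>) * ennreal (Gamma (1 - \<alpha>) * x powr (- (1 - \<alpha>)))"
    using nn_integral_exp_powr[of "1 - \<alpha>" x] assms by (subst nn_integral_cmult) auto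
  finally show ?thesis using Gamma_real_pos[of \<alpha>] Gamma_real_pos[of "1 - \<alpha>"] assms
    by (simp flip: ennreal_mult add: mult.assoc)
qed

lemma marchaud_kernel_nonneg: assumes "0 < \<alpha>" "\<alpha> < 1" shows "0 \<le> marchaud_kernel \<alpha> s"
  using assms Gamma_real_pos[of \<alpha>] Gamma_real_pos[of "1 - \<alpha>"]
  by (auto simp: marchaud_kernel_def intro!: divide_nonneg_pos powr_mono2)

text \<open>For \<open>s > 0\<close> the numerator \<open>s powr \<alpha> - (max 0 (s - 1)) powr \<alpha>\<close> is \<open>\<alpha>\<close> times the integral of
  \<open>(s - x) powr (\<alpha> - 1)\<close> over \<open>0 \<le> x \<le> min 1 s\<close>. Exchanging the integrations over \<open>s\<close> and \<open>x\<close>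
  reduces the claim to the preceding Beta integral.\<close>
lemma nn_integral_marchaud_kernel:
  assumes "0 < \<alpha>" "\<alpha> < 1"
  shows "(\<integral>\<^sup>+s. ennreal (marchaud_kernel \<alpha> s) \<partial>lborel) = 1"
proof -
  define C where "C = Gamma \<alpha> * Gamma (1 - \<alpha>)"
  have C: "C > 0" using assms Gamma_real_pos[of \<alpha>] Gamma_real_pos[of "1 - \<alpha>"] by (simp add: C_def)
  let ?h = "\<lambda>x v. ennreal (indicator {0..1} x * (\<alpha> / C)) * ennreal (indicator {0<..} v * v powr (\<alpha> - 1) / (x + v))"
  have inner: "ennreal (marchaud_kernel \<alpha> s) = (\<integral>\<^sup>+x. ?h x (s - x) \<partial>lborel)" for s
  proof (cases "s > 0")
    case False
    have "(\<integral>\<^sup>+x. ?h x (s - x) \<partial>lborel) = (\<integral>\<^sup>+x. 0 \<partial>(lborel::real measure))"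
      by (intro nn_integral_cong) (use False in \<open>auto simp: indicator_def\<close>)
    then show ?thesis using False by (simp add: marchaud_kernel_def)
  next
    case True
    let ?F = "\<lambda>x. - ((s - x) powr \<alpha>) / \<alpha>"
    let ?m = "min 1 s"
    have "((\<lambda>x. (s - x) powr (\<alpha> - 1)) has_integral (?F ?m - ?F 0)) {0..?m}"
    proof (rule fundamental_theorem_of_calculus_interior)
      show "continuous_on {0..?m} ?F"
        using assms True by (intro continuous_intros continuous_on_powr') auto
      fix x assume x: "x \<in> {0<..<?m}"
      show "(?F has_vector_derivative (s - x) powr (\<alpha> - 1)) (at x)"
        unfolding has_real_derivative_iff_has_vector_derivative[symmetric]
        using x assms by (auto intro!: derivative_eq_intros)
    qed (use True in auto)
    then have I: "(\<integral>\<^sup>+x. ennreal (indicator {0..?m} x * (s - x) powr (\<alpha> - 1)) \<partial>lborel) = ennreal (?F ?m - ?F 0)"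
      by (subst nn_integral_has_integral_lebesgue) auto
    have "(\<integral>\<^sup>+x. ?h x (s - x) \<partial>lborel) = (\<integral>\<^sup>+x. ennreal (\<alpha> / C / s) * ennreal (indicator {0..?m} x * (s - x) powr (\<alpha> - 1)) \<partial>lborel)"
    proof (rule nn_integral_cong_AE)
      have "AE x in lborel. x \<noteq> s" using AE_lborel_singleton by auto
      then show "AE x in lborel. ?h x (s - x) = ennreal (\<alpha> / C / s) * ennreal (indicator {0..?m} x * (s - x) powr (\<alpha> - 1))"
        by eventually_elim (use True assms C in \<open>auto simp: indicator_def simp flip: ennreal_mult\<close>)
    qed
    also have "\<dots> = ennreal (\<alpha> / C / s) * ennreal (?F ?m - ?F 0)"
      using I by (subst nn_integral_cmult) auto
    also have "\<dots> = ennreal ((\<alpha> / C / s) * (?F ?m - ?F 0))"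
      using True assms C by (intro ennreal_mult[symmetric]) (auto simp: field_simps intro!: powr_mono2)
    also have "(\<alpha> / C / s) * (?F ?m - ?F 0) = marchaud_kernel \<alpha> s"
    proof -
      have "(s - ?m) powr \<alpha> = max 0 (s - 1) powr \<alpha>" by (rule arg_cong[where f="\<lambda>z. z powr \<alpha>"]) auto
      then show ?thesis using True assms C by (simp add: marchaud_kernel_def C_def[symmetric] field_simps)
    qed
    finally show ?thesis ..
  qed
  have "(\<integral>\<^sup>+s. ennreal (marchaud_kernel \<alpha> s) \<partial>lborel) = (\<integral>\<^sup>+s. \<integral>\<^sup>+x. ?h x (s - x) \<partial>lborel \<partial>lborel)"
    by (intro nn_integral_cong inner)
  also have "\<dots> = (\<integral>\<^sup>+x. \<integral>\<^sup>+s. ?h x (s - x) \<partial>lborel \<partial>lborel)"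
    by (rule lborel_pair.Fubini'[symmetric]) measurable
  also have "\<dots> = (\<integral>\<^sup>+x. \<integral>\<^sup>+v. ?h x v \<partial>lborel \<partial>lborel)"
    by (intro nn_integral_cong nn_integral_shift) measurable
  also have "\<dots> = (\<integral>\<^sup>+x. ennreal \<alpha> * ennreal (indicator {0..1} x * x powr (\<alpha> - 1)) \<partial>lborel)"
  proof (rule nn_integral_cong_AE)
    have "AE x in lborel. x \<noteq> (0::real)" using AE_lborel_singleton by auto
    then show "AE x in lborel. (\<integral>\<^sup>+v. ?h x v \<partial>lborel) = ennreal \<alpha> * ennreal (indicator {0..1} x * x powr (\<alpha> - 1))"
    proof eventually_elim
      case (elim x)
      show ?case
      proof (cases "x \<in> {0..1}")
        case True
        then have x: "x > 0" using elim by auto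
        have "(\<integral>\<^sup>+v. ?h x v \<partial>lborel) = ennreal (\<alpha> / C) * (\<integral>\<^sup>+v. ennreal (indicator {0<..} v * v powr (\<alpha> - 1) / (x + v)) \<partial>lborel)"
          using True by (subst nn_integral_cmult) auto
        also have "\<dots> = ennreal (\<alpha> / C) * ennreal (C * x powr (\<alpha> - 1))"
          using nn_integral_Beta_half_line[OF assms x] by (simp add: C_def)
        finally show ?thesis using True C assms by (simp flip: ennreal_mult)
      qed simp
    qed
  qed
  also have "\<dots> = ennreal \<alpha> * ennreal (1 / \<alpha>)"
    using nn_integral_powr_from_0[of "\<alpha> - 1" 1] assms by (subst nn_integral_cmult) auto
  also have "\<dots> = 1" using assms by (simp flip: ennreal_mult)
  finally show ?thesis .
qed

lemma marchaud_kernel_integrable: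
  assumes "0 < \<alpha>" "\<alpha> < 1" shows "integrable lborel (marchaud_kernel \<alpha>)"
  using nn_integral_marchaud_kernel[OF assms] marchaud_kernel_nonneg[OF assms] by (intro integrableI_bounded) auto

lemma marchaud_kernel_integral:
  assumes "0 < \<alpha>" "\<alpha> < 1" shows "(LBINT s. marchaud_kernel \<alpha> s) = 1"
  using nn_integral_marchaud_kernel[OF assms] marchaud_kernel_nonneg[OF assms] by (subst integral_eq_nn_integral) auto

section \<open>Truncated derivatives of fractional integrals\<close>

text \<open>The truncated derivative of a function on the whole line. Since the function is extended by \<open>0\<close>, the
  boundary term and the oriented integral of the definition on an interval combine into the single
  term with the factor \<open>\<epsilon> powr (-\<alpha>)\<close>, both for \<open>t - \<epsilon>\<close> inside the interval and before it.\<close>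
definition marchaud_trunc :: "real \<Rightarrow> real \<Rightarrow> (real \<Rightarrow> real) \<Rightarrow> real \<Rightarrow> real" where
  "marchaud_trunc \<alpha> \<epsilon> f t = (\<epsilon> powr (-\<alpha>) * f t - \<alpha> * conv (tail_kernel \<alpha> \<epsilon>) f t) / Gamma (1 - \<alpha>)"

lemma marchaud_trunc_measurable [measurable]:
  assumes [measurable]: "f \<in> borel_measurable borel"
  shows "marchaud_trunc \<alpha> \<epsilon> f \<in> borel_measurable borel"
  unfolding marchaud_trunc_def by measurable

lemma marchaud_trunc_integrable:
  assumes "0 < \<alpha>" "0 < \<epsilon>" "integrable lborel f"
  shows "integrable lborel (marchaud_trunc \<alpha> \<epsilon> f)"
  unfolding marchaud_trunc_def using assms conv_integrable[OF tail_kernel_integrable[OF assms(1,2)] assms(3)] by simp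

lemma zero_ext_integrable_iff: "integrable lborel (zero_ext a b f) \<longleftrightarrow> set_integrable lborel {a..b} f"
  unfolding set_integrable_def by (intro Bochner_Integration.integrable_cong) (auto simp: zero_ext_def indicator_def)

lemma frac_int_left_eq_conv:
  assumes "t \<in> {a..b}"
  shows "frac_int_left \<alpha> a \<phi> t = conv (riesz_kernel (b - a) \<alpha>) (zero_ext a b \<phi>) t"
proof -
  have "conv (riesz_kernel (b - a) \<alpha>) (zero_ext a b \<phi>) t = (LBINT r. riesz_kernel (b - a) \<alpha> (t - r) * zero_ext a b \<phi> r)"
    unfolding conv_def using integral_reflect_shift[of "\<lambda>u. riesz_kernel (b - a) \<alpha> u * zero_ext a b \<phi> (t - u)" t] by simp
  also have "\<dots> = (LBINT r. (1 / Gamma \<alpha>) * (indicator {a..t} r *\<^sub>R ((t - r) powr (\<alpha> - 1) * \<phi> r)))"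
    using assms by (intro Bochner_Integration.integral_cong) (auto simp: riesz_kernel_def zero_ext_def indicator_def)
  also have "\<dots> = frac_int_left \<alpha> a \<phi> t"
    unfolding frac_int_left_def set_lebesgue_integral_def by (rule integral_mult_right_zero)
  finally show ?thesis ..
qed

lemma tail_kernel_reflect_integrable:
  assumes "0 < \<alpha>" "0 < \<epsilon>" shows "integrable lborel (\<lambda>r. tail_kernel \<alpha> \<epsilon> (t - r))"
  using tail_kernel_integrable[OF assms] by (simp add: integrable_reflect_shift)

lemma tail_kernel_le: "0 < \<alpha> \<Longrightarrow> 0 < \<epsilon> \<Longrightarrow> tail_kernel \<alpha> \<epsilon> u \<le> \<epsilon> powr (- 1 - \<alpha>)"
  by (auto simp: tail_kernel_def intro!: powr_mono2')

lemma tail_kernel_mult_integrable: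
  assumes "0 < \<alpha>" "0 < \<epsilon>" "integrable lborel f"
  shows "integrable lborel (\<lambda>r. tail_kernel \<alpha> \<epsilon> (t - r) * f r)"
proof (rule Bochner_Integration.integrable_bound[of _ "\<lambda>r. \<epsilon> powr (- 1 - \<alpha>) * f r"])
  note [measurable] = integrable_borel[OF assms(3)]
  show "(\<lambda>r. tail_kernel \<alpha> \<epsilon> (t - r) * f r) \<in> borel_measurable lborel" by measurable
  show "AE r in lborel. norm (tail_kernel \<alpha> \<epsilon> (t - r) * f r) \<le> norm (\<epsilon> powr (- 1 - \<alpha>) * f r)"
    using tail_kernel_le[OF assms(1,2)] by (intro AE_I2) (auto simp: abs_mult tail_kernel_nonneg intro!: mult_right_mono)
qed (use assms in auto)

lemma conv_eq_integral_reflect: "conv k f t = (LBINT r. k (t - r) * f r)"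
  unfolding conv_def using integral_reflect_shift[of "\<lambda>u. k u * f (t - u)" t] by simp

text \<open>The difference of two tail kernels is the kernel restricted to lags between \<open>\<epsilon>\<close> and \<open>t - a\<close>, with
  the sign of the oriented integral, so that both positions of \<open>t - \<epsilon>\<close> relative to \<open>a\<close> lead to the
  same expression \<open>?H\<close>. At \<open>t = a\<close> the identity may fail, because there \<open>(t - a) powr \<alpha> = 0\<close>.\<close>
lemma frac_deriv_left_trunc_eq:
  assumes "0 < \<alpha>" "0 < \<epsilon>" "t \<in> {a<..b}" and f: "integrable lborel (zero_ext a b f)"
  shows "frac_deriv_left_trunc \<alpha> a b f \<epsilon> t = marchaud_trunc \<alpha> \<epsilon> (zero_ext a b f) t"
proof -
  let ?f = "zero_ext a b f"
  have t: "a < t" "t \<le> b" using assms by auto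
  let ?H = "\<lambda>r. ?f t * (tail_kernel \<alpha> \<epsilon> (t - r) - tail_kernel \<alpha> (t - a) (t - r)) - tail_kernel \<alpha> \<epsilon> (t - r) * ?f r"
  note [measurable] = integrable_borel[OF f]
  have i: "integrable lborel (\<lambda>r. tail_kernel \<alpha> \<epsilon> (t - r))" "integrable lborel (\<lambda>r. tail_kernel \<alpha> (t - a) (t - r))"
    "integrable lborel (\<lambda>r. tail_kernel \<alpha> \<epsilon> (t - r) * ?f r)"
    using tail_kernel_reflect_integrable tail_kernel_mult_integrable assms t by auto
  have "(LBINT r. ?H r) = ?f t * ((LBINT r. tail_kernel \<alpha> \<epsilon> (t - r)) - (LBINT r. tail_kernel \<alpha> (t - a) (t - r)))
     - (LBINT r. tail_kernel \<alpha> \<epsilon> (t - r) * ?f r)"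
    using i by simp
  also have "\<dots> = ?f t * (\<epsilon> powr (-\<alpha>) / \<alpha> - (t - a) powr (-\<alpha>) / \<alpha>) - conv (tail_kernel \<alpha> \<epsilon>) ?f t"
    using assms t by (simp add: integral_reflect_shift tail_kernel_integral conv_eq_integral_reflect)
  finally have H: "(LBINT r. ?H r) = \<dots>" .
  have "(LBINT r=ereal a..ereal (t - \<epsilon>). (?f t - ?f r) / (t - r) powr (1 + \<alpha>)) = (LBINT r. ?H r)"
  proof (cases "a \<le> t - \<epsilon>")
    case True
    have "(LBINT r=ereal a..ereal (t - \<epsilon>). (?f t - ?f r) / (t - r) powr (1 + \<alpha>))
      = (LBINT r. indicator {a<..<t - \<epsilon>} r *\<^sub>R ((?f t - ?f r) / (t - r) powr (1 + \<alpha>)))"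
      using True by (simp add: interval_integral_Ioo set_lebesgue_integral_def)
    also have "\<dots> = (LBINT r. ?H r)"
    proof (rule integral_cong_AE)
      have "AE r in lborel. r \<noteq> a \<and> r \<noteq> t - \<epsilon>" by (intro AE_conjI AE_lborel_singleton)
      then show "AE r in lborel. indicator {a<..<t - \<epsilon>} r *\<^sub>R ((?f t - ?f r) / (t - r) powr (1 + \<alpha>)) = ?H r"
      proof eventually_elim
        case (elim r)
        have "(t - r) powr (- 1 - \<alpha>) = 1 / (t - r) powr (1 + \<alpha>)"
          using powr_minus_divide[of "t - r" "1 + \<alpha>"] by simp
        then show ?case using elim t assms True
          by (auto simp: tail_kernel_def indicator_def zero_ext_def field_simps)
      qed
    qed measurable
    finally show ?thesis .
  next
    case False
    have "(LBINT r=ereal a..ereal (t - \<epsilon>). (?f t - ?f r) / (t - r) powr (1 + \<alpha>))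
      = - (LBINT r=ereal (t - \<epsilon>)..ereal a. (?f t - ?f r) / (t - r) powr (1 + \<alpha>))"
      by (rule interval_integral_endpoints_reverse)
    also have "\<dots> = (LBINT r. - (indicator {t - \<epsilon><..<a} r *\<^sub>R ((?f t - ?f r) / (t - r) powr (1 + \<alpha>))))"
      using False by (simp add: interval_integral_Ioo set_lebesgue_integral_def)
    also have "\<dots> = (LBINT r. ?H r)"
    proof (rule integral_cong_AE)
      have "AE r in lborel. r \<noteq> a \<and> r \<noteq> t - \<epsilon>" by (intro AE_conjI AE_lborel_singleton)
      then show "AE r in lborel. - (indicator {t - \<epsilon><..<a} r *\<^sub>R ((?f t - ?f r) / (t - r) powr (1 + \<alpha>))) = ?H r"
      proof eventually_elim
        case (elim r)
        have "(t - r) powr (- 1 - \<alpha>) = 1 / (t - r) powr (1 + \<alpha>)"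
          using powr_minus_divide[of "t - r" "1 + \<alpha>"] by simp
        then show ?case using elim t assms False
          by (auto simp: tail_kernel_def indicator_def zero_ext_def field_simps)
      qed
    qed measurable
    finally show ?thesis .
  qed
  then have L: "(LBINT r=ereal a..ereal (t - \<epsilon>). (?f t - ?f r) / (t - r) powr (1 + \<alpha>))
    = ?f t * (\<epsilon> powr (-\<alpha>) / \<alpha> - (t - a) powr (-\<alpha>) / \<alpha>) - conv (tail_kernel \<alpha> \<epsilon>) ?f t"
    unfolding H .
  have "\<alpha> * (?f t * (\<epsilon> powr (-\<alpha>) / \<alpha> - (t - a) powr (-\<alpha>) / \<alpha>) - conv (tail_kernel \<alpha> \<epsilon>) ?f t)
    = ?f t * \<epsilon> powr (-\<alpha>) - ?f t * (t - a) powr (-\<alpha>) - \<alpha> * conv (tail_kernel \<alpha> \<epsilon>) ?f t"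
    using assms(1) by (simp add: right_diff_distrib)
  then show ?thesis
    unfolding frac_deriv_left_trunc_def marchaud_trunc_def L using powr_minus_divide[of "t - a" \<alpha>]
    by (simp add: mult.commute)
qed

lemma marchaud_trunc_riesz:
  assumes "0 < \<alpha>" "\<alpha> < 1" "0 < \<epsilon>" "a \<le> b" and \<phi>: "integrable lborel \<phi>" "\<And>r. r < a \<Longrightarrow> \<phi> r = 0"
  shows "AE t in lborel. t \<le> b \<longrightarrow> marchaud_trunc \<alpha> \<epsilon> (conv (riesz_kernel (b - a) \<alpha>) \<phi>) t = conv (\<lambda>v. marchaud_kernel \<alpha> (v / \<epsilon>) / \<epsilon>) \<phi> t"
proof -
  let ?r = "riesz_kernel (b - a) \<alpha>" and ?t = "tail_kernel \<alpha> \<epsilon>"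
  have ri: "integrable lborel ?r" and ti: "integrable lborel ?t"
    using riesz_integrable tail_kernel_integrable assms by auto
  have ci: "integrable lborel (conv ?t ?r)" by (rule conv_integrable[OF ti ri])
  have G: "Gamma (1 - \<alpha>) > 0" using assms by (intro Gamma_real_pos) auto
  show ?thesis
    using conv_assoc_AE[OF ti ri \<phi>(1)] conv_AE_integrable[OF ri \<phi>(1)] conv_AE_integrable[OF ci \<phi>(1)]
  proof eventually_elim
    case (elim t)
    show ?case
    proof
      assume t: "t \<le> b"
      have "marchaud_trunc \<alpha> \<epsilon> (conv ?r \<phi>) t = (\<epsilon> powr (-\<alpha>) * conv ?r \<phi> t - \<alpha> * conv (conv ?t ?r) \<phi> t) / Gamma (1 - \<alpha>)"
        unfolding marchaud_trunc_def elim(1) ..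
      also have "\<dots> = conv (\<lambda>v. (\<epsilon> powr (-\<alpha>) * ?r v - \<alpha> * conv ?t ?r v) / Gamma (1 - \<alpha>)) \<phi> t"
      proof -
        have "conv (\<lambda>v. (\<epsilon> powr (-\<alpha>) * ?r v - \<alpha> * conv ?t ?r v) / Gamma (1 - \<alpha>)) \<phi> t
          = (LBINT u. \<epsilon> powr (-\<alpha>) / Gamma (1 - \<alpha>) * (?r u * \<phi> (t - u)) - \<alpha> / Gamma (1 - \<alpha>) * (conv ?t ?r u * \<phi> (t - u)))"
          unfolding conv_def[of "\<lambda>v. (\<epsilon> powr (-\<alpha>) * ?r v - \<alpha> * conv ?t ?r v) / Gamma (1 - \<alpha>)"]
          by (intro Bochner_Integration.integral_cong refl) (simp add: algebra_simps diff_divide_distrib)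
        also have "\<dots> = \<epsilon> powr (-\<alpha>) / Gamma (1 - \<alpha>) * conv ?r \<phi> t - \<alpha> / Gamma (1 - \<alpha>) * conv (conv ?t ?r) \<phi> t"
          using elim(2,3) unfolding conv_def[of ?r] conv_def[of "conv ?t ?r"] by simp
        finally show ?thesis by (simp add: diff_divide_distrib)
      qed
      also have "\<dots> = conv (\<lambda>v. marchaud_kernel \<alpha> (v / \<epsilon>) / \<epsilon>) \<phi> t"
      proof (rule conv_cong_kernel[OF \<phi>(2)])
        fix u assume "u \<le> t - a"
        then have "u \<le> b - a" using t by simp
        from truncated_kernel_eq[OF assms(1-3) this]
        show "(\<epsilon> powr (-\<alpha>) * ?r u - \<alpha> * conv ?t ?r u) / Gamma (1 - \<alpha>) = marchaud_kernel \<alpha> (u / \<epsilon>) / \<epsilon>"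
          using G by simp
      qed
      finally show "marchaud_trunc \<alpha> \<epsilon> (conv ?r \<phi>) t = conv (\<lambda>v. marchaud_kernel \<alpha> (v / \<epsilon>) / \<epsilon>) \<phi> t" .
    qed
  qed
qed

lemma marchaud_trunc_riesz_tendsto:
  assumes "0 < \<alpha>" "\<alpha> < 1" "a \<le> b" and \<phi>: "integrable lborel \<phi>" "\<And>r. r < a \<Longrightarrow> \<phi> r = 0"
  shows "((\<lambda>\<epsilon>. L1norm_on {..b} (\<lambda>t. marchaud_trunc \<alpha> \<epsilon> (conv (riesz_kernel (b - a) \<alpha>) \<phi>) t - \<phi> t)) \<longlongrightarrow> 0) (at_right 0)"
proof (rule tendsto_zero_at_right_le[OF approximate_identity_L1[OF marchaud_kernel_integrable[OF assms(1,2)] marchaud_kernel_integral[OF assms(1,2)] \<phi>(1)]])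
  fix \<epsilon> :: real assume \<epsilon>: "0 < \<epsilon>"
  have "AE t in lborel. t \<le> b \<longrightarrow> marchaud_trunc \<alpha> \<epsilon> (conv (riesz_kernel (b - a) \<alpha>) \<phi>) t = conv (\<lambda>v. marchaud_kernel \<alpha> (v / \<epsilon>) / \<epsilon>) \<phi> t"
    by (rule marchaud_trunc_riesz) (use assms \<epsilon> in auto)
  then have "AE t in lborel. ennreal \<bar>marchaud_trunc \<alpha> \<epsilon> (conv (riesz_kernel (b - a) \<alpha>) \<phi>) t - \<phi> t\<bar> * indicator {..b} t
      \<le> ennreal \<bar>conv (\<lambda>v. marchaud_kernel \<alpha> (v / \<epsilon>) / \<epsilon>) \<phi> t - \<phi> t\<bar>"
    by eventually_elim (auto simp: indicator_def)
  then show "L1norm_on {..b} (\<lambda>t. marchaud_trunc \<alpha> \<epsilon> (conv (riesz_kernel (b - a) \<alpha>) \<phi>) t - \<phi> t)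
      \<le> L1norm (\<lambda>t. conv (\<lambda>v. marchaud_kernel \<alpha> (v / \<epsilon>) / \<epsilon>) \<phi> t - \<phi> t)"
    by (rule nn_integral_mono_AE)
qed

lemma L1_limitI:
  assumes h: "set_integrable lborel {a..b} h"
    and F: "\<And>\<epsilon>. \<epsilon> > 0 \<Longrightarrow> set_integrable lborel {a..b} (F \<epsilon>)"
    and lim: "((\<lambda>\<epsilon>. L1norm_on {a..b} (\<lambda>t. F \<epsilon> t - h t)) \<longlongrightarrow> 0) (at_right 0)"
  shows "L1_limit a b F h"
  unfolding L1_limit_def
proof (intro conjI h)
  show "\<forall>\<^sub>F \<epsilon> in at_right 0. set_integrable lborel {a..b} (F \<epsilon>)"
    using F by (intro eventually_at_rightI[of 0 1]) auto
  have "((\<lambda>\<epsilon>. ennreal (LINT t:{a..b}|lborel. \<bar>F \<epsilon> t - h t\<bar>)) \<longlongrightarrow> ennreal 0) (at_right 0)"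
  proof (subst tendsto_cong)
    show "\<forall>\<^sub>F \<epsilon> in at_right 0. ennreal (LINT t:{a..b}|lborel. \<bar>F \<epsilon> t - h t\<bar>) = L1norm_on {a..b} (\<lambda>t. F \<epsilon> t - h t)"
    proof (rule eventually_at_rightI[of 0 1])
      fix \<epsilon> :: real assume "\<epsilon> \<in> {0<..<1}"
      then have "set_integrable lborel {a..b} (\<lambda>t. F \<epsilon> t - h t)"
        using F h by (intro set_integral_diff) auto
      then have "integrable lborel (\<lambda>t. \<bar>indicator {a..b} t *\<^sub>R (F \<epsilon> t - h t)\<bar>)"
        unfolding set_integrable_def by (rule integrable_abs)
      then have "L1norm (\<lambda>t. indicator {a..b} t *\<^sub>R (F \<epsilon> t - h t)) = ennreal (LBINT t. \<bar>indicator {a..b} t *\<^sub>R (F \<epsilon> t - h t)\<bar>)"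
        by (rule nn_integral_eq_integral) simp
      also have "(LBINT t. \<bar>indicator {a..b} t *\<^sub>R (F \<epsilon> t - h t)\<bar>) = (LINT t:{a..b}|lborel. \<bar>F \<epsilon> t - h t\<bar>)"
        unfolding set_lebesgue_integral_def by (intro Bochner_Integration.integral_cong) (auto simp: indicator_def)
      also have "L1norm (\<lambda>t. indicator {a..b} t *\<^sub>R (F \<epsilon> t - h t)) = L1norm_on {a..b} (\<lambda>t. F \<epsilon> t - h t)"
        by (intro nn_integral_cong) (auto simp: indicator_def)
      finally show "ennreal (LINT t:{a..b}|lborel. \<bar>F \<epsilon> t - h t\<bar>) = L1norm_on {a..b} (\<lambda>t. F \<epsilon> t - h t)" ..
    qed simp
    show "((\<lambda>\<epsilon>. L1norm_on {a..b} (\<lambda>t. F \<epsilon> t - h t)) \<longlongrightarrow> ennreal 0) (at_right 0)"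
      using lim by simp
  qed
  then show "((\<lambda>\<epsilon>. LINT t:{a..b}|lborel. \<bar>F \<epsilon> t - h t\<bar>) \<longlongrightarrow> 0) (at_right 0)"
    by (rule tendsto_ennrealD) (auto intro!: always_eventually simp: set_lebesgue_integral_def)
qed

lemma L1_limit_unique:
  assumes "L1_limit a b F h" "L1_limit a b F k"
  shows "AE t in lborel. t \<in> {a..b} \<longrightarrow> h t = k t"
proof -
  have hk: "set_integrable lborel {a..b} h" "set_integrable lborel {a..b} k"
    and F: "\<forall>\<^sub>F \<epsilon> in at_right 0. set_integrable lborel {a..b} (F \<epsilon>)"
    and l: "((\<lambda>\<epsilon>. LINT t:{a..b}|lborel. \<bar>F \<epsilon> t - h t\<bar>) \<longlongrightarrow> 0) (at_right 0)"
       "((\<lambda>\<epsilon>. LINT t:{a..b}|lborel. \<bar>F \<epsilon> t - k t\<bar>) \<longlongrightarrow> 0) (at_right 0)"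
    using assms unfolding L1_limit_def by auto
  let ?I = "LINT t:{a..b}|lborel. \<bar>h t - k t\<bar>"
  have ihk: "set_integrable lborel {a..b} (\<lambda>t. \<bar>h t - k t\<bar>)"
    using hk by (intro set_integrable_abs set_integral_diff)
  have "?I \<le> 0"
  proof (rule tendsto_lowerbound)
    show "((\<lambda>\<epsilon>. (LINT t:{a..b}|lborel. \<bar>F \<epsilon> t - h t\<bar>) + (LINT t:{a..b}|lborel. \<bar>F \<epsilon> t - k t\<bar>)) \<longlongrightarrow> 0) (at_right 0)"
      using tendsto_add[OF l] by simp
    show "\<forall>\<^sub>F \<epsilon> in at_right 0. ?I \<le> (LINT t:{a..b}|lborel. \<bar>F \<epsilon> t - h t\<bar>) + (LINT t:{a..b}|lborel. \<bar>F \<epsilon> t - k t\<bar>)"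
      using F
    proof eventually_elim
      case (elim \<epsilon>)
      have i: "set_integrable lborel {a..b} (\<lambda>t. \<bar>F \<epsilon> t - h t\<bar>)" "set_integrable lborel {a..b} (\<lambda>t. \<bar>F \<epsilon> t - k t\<bar>)"
        using hk elim by (auto intro!: set_integrable_abs set_integral_diff)
      have "?I \<le> (LINT t:{a..b}|lborel. \<bar>F \<epsilon> t - h t\<bar> + \<bar>F \<epsilon> t - k t\<bar>)"
        using i ihk by (intro set_integral_mono) auto
      also have "\<dots> = (LINT t:{a..b}|lborel. \<bar>F \<epsilon> t - h t\<bar>) + (LINT t:{a..b}|lborel. \<bar>F \<epsilon> t - k t\<bar>)"
        using i by (rule set_integral_add)
      finally show ?case .
    qed
  qed simp
  moreover have "?I \<ge> 0" unfolding set_lebesgue_integral_def by (intro Bochner_Integration.integral_nonneg) auto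
  ultimately have "?I = 0" by (rule order.antisym)
  then have "(LBINT t. indicator {a..b} t *\<^sub>R \<bar>h t - k t\<bar>) = 0" unfolding set_lebesgue_integral_def .
  then have "AE t in lborel. indicator {a..b} t *\<^sub>R \<bar>h t - k t\<bar> = 0"
    using ihk unfolding set_integrable_def by (subst (asm) integral_nonneg_eq_0_iff_AE) auto
  then show ?thesis by eventually_elim (auto simp: indicator_def)
qed

text \<open>Measurability survives the change of a value at one point; needed because the formula for the
  truncated derivatives excludes the left end point.\<close>
lemma set_integrable_change_point:
  fixes f g :: "real \<Rightarrow> real"
  assumes "set_integrable lborel {a..b} g" "\<And>t. t \<in> {a<..b} \<Longrightarrow> f t = g t"
  shows "set_integrable lborel {a..b} f"
  unfolding set_integrable_def
proof (rule integrable_cong_AE_imp[of _ "\<lambda>t. indicator {a..b} t *\<^sub>R g t"])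
  show i: "integrable lborel (\<lambda>t. indicator {a..b} t *\<^sub>R g t)" using assms(1) unfolding set_integrable_def .
  note [measurable] = integrable_borel[OF i]
  have "(\<lambda>t. indicator {a..b} t *\<^sub>R f t) = (\<lambda>t. if t = a then indicator {a..b} a *\<^sub>R f a else indicator {a..b} t *\<^sub>R g t)"
    using assms(2) by (auto simp: fun_eq_iff indicator_def)
  then show "(\<lambda>t. indicator {a..b} t *\<^sub>R f t) \<in> borel_measurable lborel" by simp
  have "AE t in lborel. t \<noteq> a" by (rule AE_lborel_singleton)
  then show "AE t in lborel. indicator {a..b} t *\<^sub>R g t = indicator {a..b} t *\<^sub>R f t"
    by eventually_elim (use assms(2) in \<open>auto simp: indicator_def\<close>)
qed

lemma L1_limit_of_marchaud_trunc:
  assumes "0 < \<alpha>" and f: "integrable lborel (zero_ext a b f)" and h: "set_integrable lborel {a..b} h"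
    and lim: "((\<lambda>\<epsilon>. L1norm_on {a..b} (\<lambda>t. marchaud_trunc \<alpha> \<epsilon> (zero_ext a b f) t - h t)) \<longlongrightarrow> 0) (at_right 0)"
  shows "L1_limit a b (frac_deriv_left_trunc \<alpha> a b f) h"
proof (rule L1_limitI[OF h])
  fix \<epsilon> :: real assume \<epsilon>: "\<epsilon> > 0"
  have "set_integrable lborel {a..b} (marchaud_trunc \<alpha> \<epsilon> (zero_ext a b f))"
    unfolding set_integrable_def using marchaud_trunc_integrable[OF assms(1) \<epsilon> f] by (rule integrable_mult_indicator[rotated]) simp
  then show "set_integrable lborel {a..b} (frac_deriv_left_trunc \<alpha> a b f \<epsilon>)"
    by (rule set_integrable_change_point) (rule frac_deriv_left_trunc_eq[OF assms(1) \<epsilon> _ f])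
next
  show "((\<lambda>\<epsilon>. L1norm_on {a..b} (\<lambda>t. frac_deriv_left_trunc \<alpha> a b f \<epsilon> t - h t)) \<longlongrightarrow> 0) (at_right 0)"
  proof (rule tendsto_zero_at_right_le[OF lim])
    fix \<epsilon> :: real assume \<epsilon>: "0 < \<epsilon>"
    have "AE t in lborel. t \<noteq> a" by (rule AE_lborel_singleton)
    then have "AE t in lborel. ennreal \<bar>frac_deriv_left_trunc \<alpha> a b f \<epsilon> t - h t\<bar> * indicator {a..b} t
        \<le> ennreal \<bar>marchaud_trunc \<alpha> \<epsilon> (zero_ext a b f) t - h t\<bar> * indicator {a..b} t"
      by eventually_elim (use frac_deriv_left_trunc_eq[OF assms(1) \<epsilon> _ f] in \<open>auto simp: indicator_def\<close>)
    then show "L1norm_on {a..b} (\<lambda>t. frac_deriv_left_trunc \<alpha> a b f \<epsilon> t - h t)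
        \<le> L1norm_on {a..b} (\<lambda>t. marchaud_trunc \<alpha> \<epsilon> (zero_ext a b f) t - h t)"
      by (rule nn_integral_mono_AE)
  qed
qed

text \<open>The truncated derivatives of \<open>f\<close> use its values on \<open>[a, t]\<close> only, where \<open>f\<close> agrees almost everywhere
  with the convolution of \<open>\<phi>\<close> and the Riesz kernel.\<close>
theorem frac_image_left_L1_limit:
  assumes "0 < \<alpha>" "\<alpha> < 1" "a < b" and [measurable]: "zero_ext a b f \<in> borel_measurable borel"
    and \<phi>: "set_integrable lborel {a..b} \<phi>"
    and f: "AE t in lborel. t \<in> {a..b} \<longrightarrow> f t = frac_int_left \<alpha> a \<phi> t"
  shows "integrable lborel (zero_ext a b f)"
    and "L1_limit a b (frac_deriv_left_trunc \<alpha> a b f) \<phi>"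
proof -
  let ?\<phi> = "zero_ext a b \<phi>" and ?f = "zero_ext a b f" and ?r = "riesz_kernel (b - a) \<alpha>"
  have \<phi>i: "integrable lborel ?\<phi>" using \<phi> by (simp add: zero_ext_integrable_iff)
  note [measurable] = integrable_borel[OF \<phi>i]
  have ri: "integrable lborel ?r" using assms by (intro riesz_integrable) auto
  have past: "conv ?r ?\<phi> t = 0" if "t < a" for t
  proof -
    have "(\<lambda>u. ?r u * ?\<phi> (t - u)) = (\<lambda>u. 0)" using that by (auto simp: riesz_kernel_def zero_ext_def)
    then show ?thesis unfolding conv_def by simp
  qed
  have eq: "AE t in lborel. t \<le> b \<longrightarrow> ?f t = conv ?r ?\<phi> t"
    using f
  proof eventually_elim
    case (elim t)
    then show ?case using frac_int_left_eq_conv[of t a b \<alpha> \<phi>] past[of t] by (cases "t < a") (auto simp: zero_ext_def)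
  qed
  have eq': "AE t in lborel. zero_ext a b (conv ?r ?\<phi>) t = ?f t"
    using eq by eventually_elim (auto simp: zero_ext_def)
  have "integrable lborel (conv ?r ?\<phi>)" by (rule conv_integrable[OF ri \<phi>i])
  then have "integrable lborel (zero_ext a b (conv ?r ?\<phi>))"
    unfolding zero_ext_integrable_iff set_integrable_def by (rule integrable_mult_indicator[rotated]) simp
  then show fi: "integrable lborel ?f"
    by (rule integrable_cong_AE_imp) (use eq' in auto)
  show "L1_limit a b (frac_deriv_left_trunc \<alpha> a b f) \<phi>"
  proof (rule L1_limit_of_marchaud_trunc[OF assms(1) fi \<phi>])
    have lim: "((\<lambda>\<epsilon>. L1norm_on {..b} (\<lambda>t. marchaud_trunc \<alpha> \<epsilon> (conv ?r ?\<phi>) t - ?\<phi> t)) \<longlongrightarrow> 0) (at_right 0)"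
      using assms \<phi>i by (intro marchaud_trunc_riesz_tendsto) (auto simp: zero_ext_def)
    show "((\<lambda>\<epsilon>. L1norm_on {a..b} (\<lambda>t. marchaud_trunc \<alpha> \<epsilon> ?f t - \<phi> t)) \<longlongrightarrow> 0) (at_right 0)"
    proof (rule tendsto_zero_at_right_le[OF lim])
      fix \<epsilon> :: real assume \<epsilon>: "0 < \<epsilon>"
      have "AE t in lborel. ennreal \<bar>marchaud_trunc \<alpha> \<epsilon> ?f t - \<phi> t\<bar> * indicator {a..b} t
          \<le> ennreal \<bar>marchaud_trunc \<alpha> \<epsilon> (conv ?r ?\<phi>) t - ?\<phi> t\<bar> * indicator {..b} t"
        using eq
      proof eventually_elim
        case (elim t)
        have "conv (tail_kernel \<alpha> \<epsilon>) ?f t = conv (tail_kernel \<alpha> \<epsilon>) (conv ?r ?\<phi>) t" if "t \<le> b"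
          by (rule conv_cong_past[OF _ _ _ _ eq that]) (use \<epsilon> in \<open>auto simp: tail_kernel_def\<close>)
        then show ?case using elim by (auto simp: marchaud_trunc_def indicator_def zero_ext_def)
      qed
      then show "L1norm_on {a..b} (\<lambda>t. marchaud_trunc \<alpha> \<epsilon> ?f t - \<phi> t)
          \<le> L1norm_on {..b} (\<lambda>t. marchaud_trunc \<alpha> \<epsilon> (conv ?r ?\<phi>) t - ?\<phi> t)"
        by (rule nn_integral_mono_AE)
    qed
  qed
qed

text \<open>The choice of a representative in the definition of the derivative is justified here: an \<open>L\<^sup>1\<close> limit
  exists, and any two agree almost everywhere.\<close>
corollary frac_deriv_left_AE:
  assumes "0 < \<alpha>" "\<alpha> < 1" "a < b" and "zero_ext a b f \<in> borel_measurable borel"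
    and "set_integrable lborel {a..b} \<phi>"
    and "AE t in lborel. t \<in> {a..b} \<longrightarrow> f t = frac_int_left \<alpha> a \<phi> t"
  shows "set_integrable lborel {a..b} (frac_deriv_left \<alpha> a b f)"
    and "AE t in lborel. t \<in> {a..b} \<longrightarrow> frac_deriv_left \<alpha> a b f t = \<phi> t"
proof -
  have l: "L1_limit a b (frac_deriv_left_trunc \<alpha> a b f) \<phi>"
    by (rule frac_image_left_L1_limit[OF assms])
  then have l': "L1_limit a b (frac_deriv_left_trunc \<alpha> a b f) (frac_deriv_left \<alpha> a b f)"
    unfolding frac_deriv_left_def by (rule someI[of "\<lambda>h. L1_limit a b (frac_deriv_left_trunc \<alpha> a b f) h"])
  show "set_integrable lborel {a..b} (frac_deriv_left \<alpha> a b f)" using l' by (simp add: L1_limit_def)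
  show "AE t in lborel. t \<in> {a..b} \<longrightarrow> frac_deriv_left \<alpha> a b f t = \<phi> t" by (rule L1_limit_unique[OF l' l])
qed

section \<open>Functions with a power bound on the L1 modulus of continuity\<close>

definition L1_modulus :: "real \<Rightarrow> real \<Rightarrow> (real \<Rightarrow> real) \<Rightarrow> real \<Rightarrow> ennreal" where
  "L1_modulus a b f u = L1norm_on {a..b} (\<lambda>t. f t - f (t - u))"

text \<open>The kernel \<open>tail_kernel\<close> without truncation.\<close>
definition singular_kernel :: "real \<Rightarrow> real \<Rightarrow> real" where
  "singular_kernel \<alpha> u = (if 0 < u then u powr (- 1 - \<alpha>) else 0)"

definition marchaud :: "real \<Rightarrow> (real \<Rightarrow> real) \<Rightarrow> real \<Rightarrow> real" where
  "marchaud \<alpha> f t = \<alpha> / Gamma (1 - \<alpha>) * (LBINT u. (f t - f (t - u)) * singular_kernel \<alpha> u)"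

lemma singular_kernel_measurable [measurable]: "singular_kernel \<alpha> \<in> borel_measurable borel"
  unfolding singular_kernel_def by measurable

lemma singular_kernel_nonneg: "0 \<le> singular_kernel \<alpha> u" by (simp add: singular_kernel_def)

lemma L1_modulus_measurable [measurable]:
  assumes [measurable]: "f \<in> borel_measurable borel"
  shows "L1_modulus a b f \<in> borel_measurable borel"
  unfolding L1_modulus_def by measurable

lemma marchaud_measurable [measurable]:
  assumes [measurable]: "f \<in> borel_measurable borel"
  shows "marchaud \<alpha> f \<in> borel_measurable borel"
  unfolding marchaud_def by measurable

lemma L1_modulus_cong_AE:
  assumes [measurable]: "f \<in> borel_measurable borel" "g \<in> borel_measurable borel"
    and "AE t in lborel. t \<le> b \<longrightarrow> f t = g t" "u \<ge> 0"
  shows "L1_modulus a b f u = L1_modulus a b g u"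
  unfolding L1_modulus_def
proof (rule nn_integral_cong_AE)
  have "AE t in lborel. t - u \<le> b \<longrightarrow> f (t - u) = g (t - u)"
    using AE_borel_affine[of 1 "\<lambda>t. t \<le> b \<longrightarrow> f t = g t" "-u"] assms(3) by simp
  with assms(3) show "AE t in lborel. ennreal \<bar>f t - f (t - u)\<bar> * indicator {a..b} t
    = ennreal \<bar>g t - g (t - u)\<bar> * indicator {a..b} t"
    by eventually_elim (use assms(4) in \<open>auto simp: indicator_def\<close>)
qed

lemma L1_modulus_le_norm:
  assumes [measurable]: "f \<in> borel_measurable borel"
  shows "L1_modulus a b f u \<le> 2 * L1norm f"
proof -
  have "L1_modulus a b f u \<le> (\<integral>\<^sup>+t. ennreal \<bar>f t\<bar> + ennreal \<bar>f (t - u)\<bar> \<partial>lborel)"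
    unfolding L1_modulus_def by (intro nn_integral_mono) (auto simp: indicator_def simp flip: ennreal_plus intro!: ennreal_leI)
  also have "\<dots> = 2 * L1norm f"
    by (subst nn_integral_add) (auto simp: nn_integral_shift[of "\<lambda>t. ennreal \<bar>f t\<bar>"] mult_2)
  finally show ?thesis .
qed

lemma L1_modulus_triangle:
  assumes [measurable]: "g \<in> borel_measurable borel" "h \<in> borel_measurable borel"
  shows "L1_modulus a b (\<lambda>t. g t - h t) u \<le> L1_modulus a b g u + L1_modulus a b h u"
proof -
  have "L1_modulus a b (\<lambda>t. g t - h t) u \<le> (\<integral>\<^sup>+t. ennreal \<bar>g t - g (t - u)\<bar> * indicator {a..b} t + ennreal \<bar>h t - h (t - u)\<bar> * indicator {a..b} t \<partial>lborel)"
    unfolding L1_modulus_def by (intro nn_integral_mono) (auto simp: indicator_def simp flip: ennreal_plus intro!: ennreal_leI)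
  also have "\<dots> = L1_modulus a b g u + L1_modulus a b h u"
    unfolding L1_modulus_def by (rule nn_integral_add) measurable
  finally show ?thesis .
qed

lemma singular_kernel_L1_modulus_near:
  assumes "\<alpha> < \<beta>" "0 \<le> M" "0 < \<rho>" and om: "\<And>u. u > 0 \<Longrightarrow> \<omega> u \<le> ennreal (M * u powr \<beta>)"
  shows "(\<integral>\<^sup>+u. ennreal (indicator {..<\<rho>} u * singular_kernel \<alpha> u) * \<omega> u \<partial>lborel) \<le> ennreal (M * \<rho> powr (\<beta> - \<alpha>) / (\<beta> - \<alpha>))"
proof -
  have "(\<integral>\<^sup>+u. ennreal (indicator {..<\<rho>} u * singular_kernel \<alpha> u) * \<omega> u \<partial>lborel)
    \<le> (\<integral>\<^sup>+u. ennreal M * ennreal (indicator {0..\<rho>} u * u powr (\<beta> - \<alpha> - 1)) \<partial>lborel)"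
  proof (rule nn_integral_mono)
    fix u :: real
    show "ennreal (indicator {..<\<rho>} u * singular_kernel \<alpha> u) * \<omega> u \<le> ennreal M * ennreal (indicator {0..\<rho>} u * u powr (\<beta> - \<alpha> - 1))"
    proof (cases "0 < u \<and> u < \<rho>")
      case True
      have "ennreal (indicator {..<\<rho>} u * singular_kernel \<alpha> u) * \<omega> u \<le> ennreal (u powr (- 1 - \<alpha>)) * ennreal (M * u powr \<beta>)"
        using True om[of u] by (intro mult_mono) (auto simp: singular_kernel_def)
      also have "\<dots> = ennreal M * ennreal (u powr (- 1 - \<alpha>) * u powr \<beta>)"
        using assms by (simp add: mult_ac flip: ennreal_mult)
      also have "u powr (- 1 - \<alpha>) * u powr \<beta> = u powr (\<beta> - \<alpha> - 1)"
        by (simp add: powr_add[symmetric] algebra_simps)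
      finally show ?thesis using True by simp
    qed (auto simp: singular_kernel_def indicator_def)
  qed
  also have "\<dots> = ennreal M * ennreal (\<rho> powr (\<beta> - \<alpha>) / (\<beta> - \<alpha>))"
    using nn_integral_powr_from_0[of "\<beta> - \<alpha> - 1" \<rho>] assms by (subst nn_integral_cmult) auto
  finally show ?thesis using assms by (simp flip: ennreal_mult)
qed

text \<open>Near \<open>0\<close> the power bound controls the integral, away from \<open>0\<close> the uniform bound does. The cut \<open>\<rho>\<close> is
  free, which later allows both terms to be made small.\<close>
lemma singular_kernel_L1_modulus_split:
  assumes "0 < \<alpha>" "\<alpha> < \<beta>" "0 \<le> M" "0 \<le> N" "0 < \<rho>" and om: "\<And>u. u > 0 \<Longrightarrow> \<omega> u \<le> ennreal (M * u powr \<beta>)"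
    and N: "\<And>u. \<omega> u \<le> ennreal N" and [measurable]: "\<omega> \<in> borel_measurable borel"
  shows "(\<integral>\<^sup>+u. ennreal (singular_kernel \<alpha> u) * \<omega> u \<partial>lborel)
    \<le> ennreal (M * \<rho> powr (\<beta> - \<alpha>) / (\<beta> - \<alpha>) + N * \<rho> powr (-\<alpha>) / \<alpha>)"
proof -
  have "(\<integral>\<^sup>+u. ennreal (singular_kernel \<alpha> u) * \<omega> u \<partial>lborel)
    \<le> (\<integral>\<^sup>+u. ennreal (indicator {..<\<rho>} u * singular_kernel \<alpha> u) * \<omega> u + ennreal (tail_kernel \<alpha> \<rho> u) * ennreal N \<partial>lborel)"
    using assms by (intro nn_integral_mono) (auto simp: tail_kernel_def singular_kernel_def indicator_def intro!: mult_left_mono N)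
  also have "\<dots> = (\<integral>\<^sup>+u. ennreal (indicator {..<\<rho>} u * singular_kernel \<alpha> u) * \<omega> u \<partial>lborel) + ennreal (\<rho> powr (-\<alpha>) / \<alpha>) * ennreal N"
    using assms by (subst nn_integral_add) (auto simp: nn_integral_multc nn_integral_tail)
  also have "\<dots> \<le> ennreal (M * \<rho> powr (\<beta> - \<alpha>) / (\<beta> - \<alpha>)) + ennreal (\<rho> powr (-\<alpha>) / \<alpha>) * ennreal N"
    by (intro add_mono singular_kernel_L1_modulus_near assms order.refl) auto
  also have "\<dots> = ennreal (M * \<rho> powr (\<beta> - \<alpha>) / (\<beta> - \<alpha>) + N * \<rho> powr (-\<alpha>) / \<alpha>)"
    using assms by (simp flip: ennreal_mult ennreal_plus add: mult.commute)
  finally show ?thesis .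
qed

text \<open>Choose the cut \<open>\<rho>\<close> so small that the part near \<open>0\<close> is at most \<open>r / 2\<close> for every \<open>n\<close>; the remaining part
  is a multiple of the \<open>L\<^sup>1\<close> norm of \<open>e n\<close>, which is eventually small.\<close>
lemma singular_kernel_L1_modulus_tendsto_0:
  assumes \<alpha>: "0 < \<alpha>" "\<alpha> < \<beta>" and M: "0 \<le> M" and [measurable]: "\<And>n. e n \<in> borel_measurable borel"
    and mod: "\<And>n u. u > 0 \<Longrightarrow> L1_modulus a b (e n) u \<le> ennreal (M * u powr \<beta>)"
    and lim: "(\<lambda>n. L1norm (\<lambda>t. e n t)) \<longlonglongrightarrow> 0"
  shows "(\<lambda>n. \<integral>\<^sup>+u. ennreal (singular_kernel \<alpha> u) * L1_modulus a b (e n) u \<partial>lborel) \<longlonglongrightarrow> 0"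
proof (rule order_tendstoI)
  fix z :: ennreal assume "0 < z"
  then obtain z' where z: "0 < z'" "z' < z" using dense by blast
  then obtain r where r: "r > 0" "ennreal r < z" by (cases z') auto
  \<comment> \<open>The denominator has \<open>M + 1\<close> because \<open>M\<close> may be \<open>0\<close>.\<close>
  define q where "q = r * (\<beta> - \<alpha>) / (2 * (M + 1))"
  define \<rho> where "\<rho> = q powr (1 / (\<beta> - \<alpha>))"
  have "q > 0" using r \<alpha> M by (simp add: q_def)
  then have \<rho>: "\<rho> > 0" and "\<rho> powr (\<beta> - \<alpha>) = q"
    using \<alpha> by (simp_all add: \<rho>_def powr_powr)
  then have \<rho>p: "\<rho> powr (\<beta> - \<alpha>) = r * (\<beta> - \<alpha>) / (2 * (M + 1))" by (simp add: q_def)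
  have "M * \<rho> powr (\<beta> - \<alpha>) / (\<beta> - \<alpha>) = M / (M + 1) * (r / 2)"
  proof -
    have "M * (r * c / (2 * d)) / c = M / d * (r / 2)" if "c > 0" "d > 0" for c d :: real
      using that by (simp add: field_simps)
    from this[of "\<beta> - \<alpha>" "M + 1"] show ?thesis unfolding \<rho>p using \<alpha> M by simp
  qed
  also have "\<dots> \<le> 1 * (r / 2)" using M r by (intro mult_right_mono) auto
  finally have near: "M * \<rho> powr (\<beta> - \<alpha>) / (\<beta> - \<alpha>) \<le> r / 2" by simp
  define \<eta> where "\<eta> = r * \<alpha> * \<rho> powr \<alpha> / 4"
  have \<eta>: "\<eta> > 0" using r \<alpha> \<rho> by (simp add: \<eta>_def)
  have far: "2 * \<eta> * \<rho> powr (-\<alpha>) / \<alpha> = r / 2"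
    using \<alpha> \<rho> by (simp add: \<eta>_def powr_minus field_simps)
  have "\<forall>\<^sub>F n in sequentially. L1norm (\<lambda>t. e n t) < ennreal \<eta>"
    using order_tendstoD(2)[OF lim] \<eta> by simp
  then show "\<forall>\<^sub>F n in sequentially. (\<integral>\<^sup>+u. ennreal (singular_kernel \<alpha> u) * L1_modulus a b (e n) u \<partial>lborel) < z"
  proof eventually_elim
    case (elim n)
    have "(\<integral>\<^sup>+u. ennreal (singular_kernel \<alpha> u) * L1_modulus a b (e n) u \<partial>lborel)
      \<le> ennreal (M * \<rho> powr (\<beta> - \<alpha>) / (\<beta> - \<alpha>) + (2 * \<eta>) * \<rho> powr (-\<alpha>) / \<alpha>)"
    proof (rule singular_kernel_L1_modulus_split)
      fix u
      have "L1_modulus a b (e n) u \<le> 2 * L1norm (\<lambda>t. e n t)" by (rule L1_modulus_le_norm) measurable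
      also have "\<dots> \<le> 2 * ennreal \<eta>" using elim by (intro mult_left_mono) (auto intro: less_imp_le)
      also have "\<dots> = ennreal (2 * \<eta>)" using \<eta> by (simp add: ennreal_mult)
      finally show "L1_modulus a b (e n) u \<le> ennreal (2 * \<eta>)" .
    qed (use assms \<rho> \<eta> in auto)
    also have "\<dots> \<le> ennreal r" using near far by (intro ennreal_leI) linarith
    finally show ?case using r(2) by (rule le_less_trans)
  qed
qed simp

lemma nn_integral_singular_kernel_swap:
  assumes [measurable]: "f \<in> borel_measurable borel" "k \<in> borel_measurable borel" and k: "\<And>u. 0 \<le> k u"
  shows "(\<integral>\<^sup>+t\<in>{a..b}. L1norm (\<lambda>u. (f t - f (t - u)) * k u) \<partial>lborel)
    = (\<integral>\<^sup>+u. ennreal (k u) * L1_modulus a b f u \<partial>lborel)"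
proof -
  have "(\<integral>\<^sup>+t\<in>{a..b}. L1norm (\<lambda>u. (f t - f (t - u)) * k u) \<partial>lborel)
    = (\<integral>\<^sup>+t. \<integral>\<^sup>+u. ennreal (k u) * (ennreal \<bar>f t - f (t - u)\<bar> * indicator {a..b} t) \<partial>lborel \<partial>lborel)"
    using k by (intro nn_integral_cong, subst nn_integral_multc[symmetric])
      (auto simp: abs_mult ennreal_mult mult_ac intro!: nn_integral_cong)
  also have "\<dots> = (\<integral>\<^sup>+u. \<integral>\<^sup>+t. ennreal (k u) * (ennreal \<bar>f t - f (t - u)\<bar> * indicator {a..b} t) \<partial>lborel \<partial>lborel)"
    by (rule lborel_pair.Fubini'[symmetric]) measurable
  also have "\<dots> = (\<integral>\<^sup>+u. ennreal (k u) * L1_modulus a b f u \<partial>lborel)"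
    unfolding L1_modulus_def by (intro nn_integral_cong nn_integral_cmult) measurable
  finally show ?thesis .
qed

lemma marchaud_nn_le:
  assumes [measurable]: "f \<in> borel_measurable borel" and "0 < \<alpha>" "\<alpha> < 1"
  shows "L1norm_on {a..b} (\<lambda>t. marchaud \<alpha> f t)
    \<le> ennreal (\<alpha> / Gamma (1 - \<alpha>)) * (\<integral>\<^sup>+u. ennreal (singular_kernel \<alpha> u) * L1_modulus a b f u \<partial>lborel)"
proof -
  have G: "Gamma (1 - \<alpha>) > 0" using assms by (intro Gamma_real_pos) auto
  have "L1norm_on {a..b} (\<lambda>t. marchaud \<alpha> f t)
    \<le> (\<integral>\<^sup>+t. ennreal (\<alpha> / Gamma (1 - \<alpha>)) * (L1norm (\<lambda>u. (f t - f (t - u)) * singular_kernel \<alpha> u) * indicator {a..b} t) \<partial>lborel)"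
  proof (rule nn_integral_mono)
    fix t :: real
    have "ennreal \<bar>marchaud \<alpha> f t\<bar> = ennreal (\<alpha> / Gamma (1 - \<alpha>)) * ennreal \<bar>LBINT u. (f t - f (t - u)) * singular_kernel \<alpha> u\<bar>"
      using G assms by (simp add: marchaud_def abs_mult flip: ennreal_mult)
    also have "\<dots> \<le> ennreal (\<alpha> / Gamma (1 - \<alpha>)) * L1norm (\<lambda>u. (f t - f (t - u)) * singular_kernel \<alpha> u)"
      by (intro mult_left_mono ennreal_abs_integral_le) auto
    finally show "ennreal \<bar>marchaud \<alpha> f t\<bar> * indicator {a..b} t
      \<le> ennreal (\<alpha> / Gamma (1 - \<alpha>)) * (L1norm (\<lambda>u. (f t - f (t - u)) * singular_kernel \<alpha> u) * indicator {a..b} t)"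
      by (auto simp: indicator_def)
  qed
  also have "\<dots> = ennreal (\<alpha> / Gamma (1 - \<alpha>)) * (\<integral>\<^sup>+u. ennreal (singular_kernel \<alpha> u) * L1_modulus a b f u \<partial>lborel)"
    by (subst nn_integral_cmult) (auto simp: nn_integral_singular_kernel_swap singular_kernel_nonneg)
  finally show ?thesis .
qed

lemma marchaud_trunc_eq_integral:
  assumes "0 < \<alpha>" "0 < \<epsilon>" "integrable lborel f"
  shows "integrable lborel (\<lambda>u. (f t - f (t - u)) * tail_kernel \<alpha> \<epsilon> u)"
    and "marchaud_trunc \<alpha> \<epsilon> f t = \<alpha> / Gamma (1 - \<alpha>) * (LBINT u. (f t - f (t - u)) * tail_kernel \<alpha> \<epsilon> u)"
proof -
  have i1: "integrable lborel (\<lambda>u. tail_kernel \<alpha> \<epsilon> u * f (t - u))"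
    using tail_kernel_mult_integrable[OF assms, of t] integrable_reflect_shift[of "\<lambda>u. tail_kernel \<alpha> \<epsilon> u * f (t - u)" t] by simp
  have i2: "integrable lborel (\<lambda>u. f t * tail_kernel \<alpha> \<epsilon> u)" using tail_kernel_integrable[OF assms(1,2)] by simp
  have eq: "(\<lambda>u. (f t - f (t - u)) * tail_kernel \<alpha> \<epsilon> u) = (\<lambda>u. f t * tail_kernel \<alpha> \<epsilon> u - tail_kernel \<alpha> \<epsilon> u * f (t - u))"
    by (simp add: fun_eq_iff algebra_simps)
  show "integrable lborel (\<lambda>u. (f t - f (t - u)) * tail_kernel \<alpha> \<epsilon> u)" unfolding eq using i1 i2 by simp
  have "(LBINT u. (f t - f (t - u)) * tail_kernel \<alpha> \<epsilon> u) = f t * (\<epsilon> powr (-\<alpha>) / \<alpha>) - conv (tail_kernel \<alpha> \<epsilon>) f t"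
    unfolding eq conv_def using i1 i2 assms by (simp add: tail_kernel_integral)
  then show "marchaud_trunc \<alpha> \<epsilon> f t = \<alpha> / Gamma (1 - \<alpha>) * (LBINT u. (f t - f (t - u)) * tail_kernel \<alpha> \<epsilon> u)"
    using assms(1) by (simp add: marchaud_trunc_def field_simps)
qed

lemma marchaud_AE_integrable:
  assumes [measurable]: "f \<in> borel_measurable borel"
    and fin: "(\<integral>\<^sup>+u. ennreal (singular_kernel \<alpha> u) * L1_modulus a b f u \<partial>lborel) < \<infinity>"
  shows "AE t in lborel. t \<in> {a..b} \<longrightarrow> integrable lborel (\<lambda>u. (f t - f (t - u)) * singular_kernel \<alpha> u)"
proof -
  have "(\<integral>\<^sup>+t\<in>{a..b}. L1norm (\<lambda>u. (f t - f (t - u)) * singular_kernel \<alpha> u) \<partial>lborel) \<noteq> \<infinity>"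
    using fin by (subst nn_integral_singular_kernel_swap) (auto simp: singular_kernel_nonneg)
  then have "AE t in lborel. L1norm (\<lambda>u. (f t - f (t - u)) * singular_kernel \<alpha> u) * indicator {a..b} t \<noteq> \<infinity>"
    by (intro nn_integral_PInf_AE) auto
  then show ?thesis
    by eventually_elim (auto simp: integrable_iff_bounded less_top indicator_def)
qed

lemma marchaud_diff_AE:
  assumes [measurable]: "f \<in> borel_measurable borel" "g \<in> borel_measurable borel"
    and "(\<integral>\<^sup>+u. ennreal (singular_kernel \<alpha> u) * L1_modulus a b f u \<partial>lborel) < \<infinity>"
      "(\<integral>\<^sup>+u. ennreal (singular_kernel \<alpha> u) * L1_modulus a b g u \<partial>lborel) < \<infinity>"
  shows "AE t in lborel. t \<in> {a..b} \<longrightarrow> marchaud \<alpha> (\<lambda>t. f t - g t) t = marchaud \<alpha> f t - marchaud \<alpha> g t"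
  using marchaud_AE_integrable[OF assms(1,3)] marchaud_AE_integrable[OF assms(2,4)]
proof eventually_elim
  case (elim t)
  show ?case
  proof
    assume "t \<in> {a..b}"
    then have i: "integrable lborel (\<lambda>u. (f t - f (t - u)) * singular_kernel \<alpha> u)" "integrable lborel (\<lambda>u. (g t - g (t - u)) * singular_kernel \<alpha> u)"
      using elim by auto
    have "(LBINT u. (f t - g t - (f (t - u) - g (t - u))) * singular_kernel \<alpha> u)
      = (LBINT u. (f t - f (t - u)) * singular_kernel \<alpha> u - (g t - g (t - u)) * singular_kernel \<alpha> u)"
      by (intro Bochner_Integration.integral_cong refl) (simp add: algebra_simps)
    then show "marchaud \<alpha> (\<lambda>t. f t - g t) t = marchaud \<alpha> f t - marchaud \<alpha> g t"
      unfolding marchaud_def using i by (simp add: right_diff_distrib)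
  qed
qed

lemma marchaud_trunc_marchaud_le:
  assumes "0 < \<alpha>" "\<alpha> < 1" "0 < \<epsilon>" and f: "integrable lborel f"
    and fin: "(\<integral>\<^sup>+u. ennreal (singular_kernel \<alpha> u) * L1_modulus a b f u \<partial>lborel) < \<infinity>"
  shows "L1norm_on {a..b} (\<lambda>t. marchaud_trunc \<alpha> \<epsilon> f t - marchaud \<alpha> f t)
    \<le> ennreal (\<alpha> / Gamma (1 - \<alpha>)) * (\<integral>\<^sup>+u. ennreal (indicator {..<\<epsilon>} u * singular_kernel \<alpha> u) * L1_modulus a b f u \<partial>lborel)"
proof -
  note [measurable] = integrable_borel[OF f]
  have G: "Gamma (1 - \<alpha>) > 0" using assms by (intro Gamma_real_pos) auto
  let ?k = "\<lambda>u. indicator {..<\<epsilon>} u * singular_kernel \<alpha> u"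
  have "L1norm_on {a..b} (\<lambda>t. marchaud_trunc \<alpha> \<epsilon> f t - marchaud \<alpha> f t)
    \<le> (\<integral>\<^sup>+t. ennreal (\<alpha> / Gamma (1 - \<alpha>)) * (L1norm (\<lambda>u. (f t - f (t - u)) * ?k u) * indicator {a..b} t) \<partial>lborel)"
  proof (rule nn_integral_mono_AE)
    show "AE t in lborel. ennreal \<bar>marchaud_trunc \<alpha> \<epsilon> f t - marchaud \<alpha> f t\<bar> * indicator {a..b} t
      \<le> ennreal (\<alpha> / Gamma (1 - \<alpha>)) * (L1norm (\<lambda>u. (f t - f (t - u)) * ?k u) * indicator {a..b} t)"
      using marchaud_AE_integrable[OF \<open>f \<in> borel_measurable borel\<close> fin]
    proof eventually_elim
      fix t assume i: "t \<in> {a..b} \<longrightarrow> integrable lborel (\<lambda>u. (f t - f (t - u)) * singular_kernel \<alpha> u)"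
      show "ennreal \<bar>marchaud_trunc \<alpha> \<epsilon> f t - marchaud \<alpha> f t\<bar> * indicator {a..b} t
      \<le> ennreal (\<alpha> / Gamma (1 - \<alpha>)) * (L1norm (\<lambda>u. (f t - f (t - u)) * ?k u) * indicator {a..b} t)"
      proof (cases "t \<in> {a..b}")
        case True
        have "marchaud \<alpha> f t - marchaud_trunc \<alpha> \<epsilon> f t = \<alpha> / Gamma (1 - \<alpha>) * 
            ((LBINT u. (f t - f (t - u)) * singular_kernel \<alpha> u) - (LBINT u. (f t - f (t - u)) * tail_kernel \<alpha> \<epsilon> u))"
          unfolding marchaud_def marchaud_trunc_eq_integral(2)[OF assms(1,3) f] by (simp add: right_diff_distrib)
        also have "(LBINT u. (f t - f (t - u)) * singular_kernel \<alpha> u) - (LBINT u. (f t - f (t - u)) * tail_kernel \<alpha> \<epsilon> u)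
          = (LBINT u. (f t - f (t - u)) * singular_kernel \<alpha> u - (f t - f (t - u)) * tail_kernel \<alpha> \<epsilon> u)"
          using i True marchaud_trunc_eq_integral(1)[OF assms(1,3) f] by (intro Bochner_Integration.integral_diff[symmetric]) auto
        also have "\<dots> = (LBINT u. (f t - f (t - u)) * ?k u)"
          using assms(3) by (intro Bochner_Integration.integral_cong) (auto simp: tail_kernel_def singular_kernel_def indicator_def)
        finally have "\<bar>marchaud_trunc \<alpha> \<epsilon> f t - marchaud \<alpha> f t\<bar> = \<alpha> / Gamma (1 - \<alpha>) * \<bar>LBINT u. (f t - f (t - u)) * ?k u\<bar>"
          using assms(1) G by (subst abs_minus_commute) (simp add: abs_mult)
        then have "ennreal \<bar>marchaud_trunc \<alpha> \<epsilon> f t - marchaud \<alpha> f t\<bar> = ennreal (\<alpha> / Gamma (1 - \<alpha>)) * ennreal \<bar>LBINT u. (f t - f (t - u)) * ?k u\<bar>"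
          by (simp only:) (rule ennreal_mult; use assms(1) G in simp)
        also have "\<dots> \<le> ennreal (\<alpha> / Gamma (1 - \<alpha>)) * L1norm (\<lambda>u. (f t - f (t - u)) * ?k u)"
          by (intro mult_left_mono ennreal_abs_integral_le) auto
        finally show ?thesis using True by simp
      qed simp
    qed
  qed
  also have "\<dots> = ennreal (\<alpha> / Gamma (1 - \<alpha>)) * (\<integral>\<^sup>+u. ennreal (?k u) * L1_modulus a b f u \<partial>lborel)"
    by (subst nn_integral_cmult, measurable, subst nn_integral_singular_kernel_swap, measurable)
       (simp_all add: singular_kernel_nonneg)
  finally show ?thesis .
qed

text \<open>Functions whose \<open>L\<^sup>1\<close> modulus of continuity on \<open>[a, b]\<close> is \<open>O(u powr \<beta>)\<close>, as in the Nikolskii class of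
  order \<open>\<beta>\<close>, together with an order \<open>\<alpha> < \<beta>\<close> of differentiation.\<close>
locale nikolskii =
  fixes a b \<alpha> \<beta> M :: real and f :: "real \<Rightarrow> real"
  assumes ab: "a < b" and \<alpha>: "0 < \<alpha>" "\<alpha> < 1" and \<beta>: "\<alpha> < \<beta>" and M: "0 \<le> M"
    and f_int: "integrable lborel f" and f_past: "\<And>r. r < a \<Longrightarrow> f r = 0"
    and mod: "\<And>u. u > 0 \<Longrightarrow> L1_modulus a b f u \<le> ennreal (M * u powr \<beta>)"
begin

lemma f_meas [measurable]: "f \<in> borel_measurable borel"
  using f_int by (auto dest: borel_measurable_integrable)

lemma singular_kernel_finite: "(\<integral>\<^sup>+u. ennreal (singular_kernel \<alpha> u) * L1_modulus a b f u \<partial>lborel) < \<infinity>"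
proof -
  obtain N where N: "0 \<le> N" "L1norm f = ennreal N"
    using integrable_nn_finite[OF f_int] by (cases "L1norm f") auto
  have "(\<integral>\<^sup>+u. ennreal (singular_kernel \<alpha> u) * L1_modulus a b f u \<partial>lborel)
    \<le> ennreal (M * 1 powr (\<beta> - \<alpha>) / (\<beta> - \<alpha>) + (2 * N) * 1 powr (-\<alpha>) / \<alpha>)"
  proof (rule singular_kernel_L1_modulus_split)
    fix u show "L1_modulus a b f u \<le> ennreal (2 * N)"
      using L1_modulus_le_norm[OF f_meas, of a b u] N by (simp add: ennreal_mult)
  qed (use \<alpha> \<beta> M N mod in auto)
  then show ?thesis by (rule le_less_trans) simp
qed

lemma marchaud_integrable: "set_integrable lborel {a..b} (marchaud \<alpha> f)"
proof -
  have "L1norm_on {a..b} (\<lambda>t. marchaud \<alpha> f t) < \<infinity>"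
    using marchaud_nn_le[OF f_meas \<alpha>, of a b] singular_kernel_finite
    by (intro le_less_trans[OF marchaud_nn_le[OF f_meas \<alpha>]]) (auto simp: ennreal_mult_less_top)
  also have "L1norm_on {a..b} (\<lambda>t. marchaud \<alpha> f t) = (\<integral>\<^sup>+t. ennreal (norm (indicator {a..b} t *\<^sub>R marchaud \<alpha> f t)) \<partial>lborel)"
    by (intro nn_integral_cong) (auto simp: indicator_def)
  finally show ?thesis unfolding set_integrable_def by (intro integrableI_bounded) auto
qed

lemma marchaud_trunc_tendsto_marchaud:
  "((\<lambda>\<epsilon>. L1norm_on {a..b} (\<lambda>t. marchaud_trunc \<alpha> \<epsilon> f t - marchaud \<alpha> f t)) \<longlongrightarrow> 0) (at_right 0)"
proof -
  have G: "Gamma (1 - \<alpha>) > 0" using \<alpha> by (intro Gamma_real_pos) auto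
  have "((\<lambda>\<epsilon>. \<epsilon> powr (\<beta> - \<alpha>)) \<longlongrightarrow> 0) (at_right 0)"
  proof -
    have "\<forall>\<^sub>F \<epsilon> in at_right 0. (0::real) \<le> \<epsilon>"
      by (rule eventually_mono[OF eventually_at_right_less]) simp
    then have "((\<lambda>\<epsilon>. \<epsilon> powr (\<beta> - \<alpha>)) \<longlongrightarrow> 0 powr (\<beta> - \<alpha>)) (at_right 0)"
      by (intro tendsto_powr' tendsto_ident_at tendsto_const) (use \<beta> in auto)
    then show ?thesis by simp
  qed
  then have "((\<lambda>\<epsilon>. \<alpha> / Gamma (1 - \<alpha>) * (M * \<epsilon> powr (\<beta> - \<alpha>) / (\<beta> - \<alpha>))) \<longlongrightarrow> \<alpha> / Gamma (1 - \<alpha>) * (M * 0 / (\<beta> - \<alpha>))) (at_right 0)"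
    using \<beta> by (intro tendsto_intros) auto
  then have lim: "((\<lambda>\<epsilon>. ennreal (\<alpha> / Gamma (1 - \<alpha>) * (M * \<epsilon> powr (\<beta> - \<alpha>) / (\<beta> - \<alpha>)))) \<longlongrightarrow> 0) (at_right 0)"
    using tendsto_ennrealI by fastforce
  show ?thesis
  proof (rule tendsto_zero_at_right_le[OF lim])
    fix \<epsilon> :: real assume \<epsilon>: "0 < \<epsilon>"
    have "L1norm_on {a..b} (\<lambda>t. marchaud_trunc \<alpha> \<epsilon> f t - marchaud \<alpha> f t)
      \<le> ennreal (\<alpha> / Gamma (1 - \<alpha>)) * (\<integral>\<^sup>+u. ennreal (indicator {..<\<epsilon>} u * singular_kernel \<alpha> u) * L1_modulus a b f u \<partial>lborel)"
      by (rule marchaud_trunc_marchaud_le[OF \<alpha> \<epsilon> f_int singular_kernel_finite])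
    also have "\<dots> \<le> ennreal (\<alpha> / Gamma (1 - \<alpha>)) * ennreal (M * \<epsilon> powr (\<beta> - \<alpha>) / (\<beta> - \<alpha>))"
      by (intro mult_left_mono singular_kernel_L1_modulus_near \<beta> M \<epsilon> mod) auto
    also have "\<dots> = ennreal (\<alpha> / Gamma (1 - \<alpha>) * (M * \<epsilon> powr (\<beta> - \<alpha>) / (\<beta> - \<alpha>)))"
      by (rule ennreal_mult[symmetric]) (use \<alpha> \<beta> M G in auto)
    finally show "L1norm_on {a..b} (\<lambda>t. marchaud_trunc \<alpha> \<epsilon> f t - marchaud \<alpha> f t)
      \<le> ennreal (\<alpha> / Gamma (1 - \<alpha>) * (M * \<epsilon> powr (\<beta> - \<alpha>) / (\<beta> - \<alpha>)))" .
  qed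
qed

text \<open>Convolutions commute: integrating the truncated derivative is the same as taking the truncated
  derivative of the integral, which has been computed in \<open>marchaud_trunc_riesz\<close>.\<close>
lemma riesz_marchaud_trunc_AE:
  assumes \<epsilon>: "0 < \<epsilon>"
  shows "AE t in lborel. t \<le> b \<longrightarrow> conv (riesz_kernel (b - a) \<alpha>) (zero_ext a b (marchaud_trunc \<alpha> \<epsilon> f)) t = conv (\<lambda>v. marchaud_kernel \<alpha> (v / \<epsilon>) / \<epsilon>) f t"
proof -
  let ?r = "riesz_kernel (b - a) \<alpha>" and ?t = "tail_kernel \<alpha> \<epsilon>"
  have ri: "integrable lborel ?r" and ti: "integrable lborel ?t"
    using riesz_integrable tail_kernel_integrable \<alpha> ab \<epsilon> by auto
  have tf: "integrable lborel (conv ?t f)" by (rule conv_integrable[OF ti f_int])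
  have comm: "conv ?r ?t = conv ?t ?r" using conv_commute by blast
  have D0: "marchaud_trunc \<alpha> \<epsilon> f t = 0" if "t < a" for t
  proof -
    have "(\<lambda>u. ?t u * f (t - u)) = (\<lambda>u. 0)" using f_past that \<epsilon> by (auto simp: tail_kernel_def)
    then show ?thesis using that by (simp add: marchaud_trunc_def conv_def f_past)
  qed
  have z: "conv ?r (zero_ext a b (marchaud_trunc \<alpha> \<epsilon> f)) t = conv ?r (marchaud_trunc \<alpha> \<epsilon> f) t" if "t \<le> b" for t
  proof (rule conv_cong_past[OF _ _ _ _ _ that])
    have "(\<lambda>t. zero_ext a b (marchaud_trunc \<alpha> \<epsilon> f) t) = (\<lambda>t. if t \<in> {a..b} then marchaud_trunc \<alpha> \<epsilon> f t else 0)"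
      by (auto simp: zero_ext_def)
    then show "zero_ext a b (marchaud_trunc \<alpha> \<epsilon> f) \<in> borel_measurable borel" by simp
    show "AE r in lborel. r \<le> b \<longrightarrow> zero_ext a b (marchaud_trunc \<alpha> \<epsilon> f) r = marchaud_trunc \<alpha> \<epsilon> f r"
      using D0 by (auto simp: zero_ext_def not_le)
  qed (auto simp: riesz_kernel_def)
  have "AE t in lborel. t \<le> b \<longrightarrow> marchaud_trunc \<alpha> \<epsilon> (conv ?r f) t = conv (\<lambda>v. marchaud_kernel \<alpha> (v / \<epsilon>) / \<epsilon>) f t"
    by (rule marchaud_trunc_riesz[OF \<alpha> \<epsilon> _ f_int f_past]) (use ab in auto)
  with conv_assoc_AE[OF ti ri f_int] conv_assoc_AE[OF ri ti f_int]
    conv_AE_integrable[OF ri f_int] conv_AE_integrable[OF ri tf]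
  show ?thesis
  proof eventually_elim
    case (elim t)
    show ?case
    proof
      assume t: "t \<le> b"
      have "conv ?r (marchaud_trunc \<alpha> \<epsilon> f) t
        = (LBINT u. \<epsilon> powr (-\<alpha>) / Gamma (1 - \<alpha>) * (?r u * f (t - u)) - \<alpha> / Gamma (1 - \<alpha>) * (?r u * conv ?t f (t - u)))"
        unfolding conv_def[of ?r "marchaud_trunc \<alpha> \<epsilon> f"] marchaud_trunc_def
        by (intro Bochner_Integration.integral_cong refl) (simp add: algebra_simps diff_divide_distrib)
      also have "\<dots> = \<epsilon> powr (-\<alpha>) / Gamma (1 - \<alpha>) * conv ?r f t - \<alpha> / Gamma (1 - \<alpha>) * conv ?r (conv ?t f) t"
        using elim(3,4) unfolding conv_def[of ?r f] conv_def[of ?r "conv ?t f"] by simp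
      also have "conv ?r (conv ?t f) t = conv ?t (conv ?r f) t" using elim(1,2) by (simp add: comm)
      also have "\<epsilon> powr (-\<alpha>) / Gamma (1 - \<alpha>) * conv ?r f t - \<alpha> / Gamma (1 - \<alpha>) * conv ?t (conv ?r f) t = marchaud_trunc \<alpha> \<epsilon> (conv ?r f) t"
        by (simp add: marchaud_trunc_def diff_divide_distrib)
      finally show "conv ?r (zero_ext a b (marchaud_trunc \<alpha> \<epsilon> f)) t = conv (\<lambda>v. marchaud_kernel \<alpha> (v / \<epsilon>) / \<epsilon>) f t"
        using elim(5) t z by simp
    qed
  qed
qed

text \<open>Let \<open>\<epsilon> \<rightarrow> 0\<close> in \<open>riesz_marchaud_trunc_AE\<close>. The right-hand sides tend to \<open>f\<close>, the left-hand sides to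
  the fractional integral of the Marchaud derivative, both in \<open>L\<^sup>1\<close>.\<close>
theorem riesz_marchaud_AE:
  "AE t in lborel. t \<in> {a..b} \<longrightarrow> f t = conv (riesz_kernel (b - a) \<alpha>) (zero_ext a b (marchaud \<alpha> f)) t"
proof -
  let ?r = "riesz_kernel (b - a) \<alpha>" and ?m = "zero_ext a b (marchaud \<alpha> f)"
  let ?D = "\<lambda>\<epsilon>. zero_ext a b (marchaud_trunc \<alpha> \<epsilon> f)"
  have ri: "integrable lborel ?r" using riesz_integrable \<alpha> ab by auto
  have mi: "integrable lborel ?m" using marchaud_integrable by (simp add: zero_ext_integrable_iff)
  have Di: "integrable lborel (?D \<epsilon>)" if "\<epsilon> > 0" for \<epsilon>
    using marchaud_trunc_integrable[OF \<alpha>(1) that f_int] unfolding zero_ext_integrable_iff set_integrable_def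
    by (rule integrable_mult_indicator[rotated]) simp
  note [measurable] = integrable_borel[OF mi]
  define I where "I = L1norm_on {a..b} (\<lambda>t. f t - conv ?r ?m t)"
  define C where "C = L1norm ?r"
  have C: "C < \<infinity>" unfolding C_def by (rule integrable_nn_finite[OF ri])
  have le: "I \<le> L1norm (\<lambda>t. conv (\<lambda>v. marchaud_kernel \<alpha> (v / \<epsilon>) / \<epsilon>) f t - f t)
      + C * L1norm_on {a..b} (\<lambda>t. marchaud_trunc \<alpha> \<epsilon> f t - marchaud \<alpha> f t)" if \<epsilon>: "\<epsilon> > 0" for \<epsilon>
  proof -
    note [measurable] = integrable_borel[OF Di[OF \<epsilon>]]
    have "I \<le> (\<integral>\<^sup>+t. ennreal \<bar>conv (\<lambda>v. marchaud_kernel \<alpha> (v / \<epsilon>) / \<epsilon>) f t - f t\<bar> + ennreal \<bar>conv ?r (\<lambda>u. ?D \<epsilon> u - ?m u) t\<bar> \<partial>lborel)"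
      unfolding I_def
    proof (rule nn_integral_mono_AE)
      show "AE t in lborel. ennreal \<bar>f t - conv ?r ?m t\<bar> * indicator {a..b} t
        \<le> ennreal \<bar>conv (\<lambda>v. marchaud_kernel \<alpha> (v / \<epsilon>) / \<epsilon>) f t - f t\<bar> + ennreal \<bar>conv ?r (\<lambda>u. ?D \<epsilon> u - ?m u) t\<bar>"
        using riesz_marchaud_trunc_AE[OF \<epsilon>] conv_diff_right_AE[OF ri Di[OF \<epsilon>] mi]
        by eventually_elim (auto simp: indicator_def simp flip: ennreal_plus intro!: ennreal_leI)
    qed
    also have "\<dots> = L1norm (\<lambda>t. conv (\<lambda>v. marchaud_kernel \<alpha> (v / \<epsilon>) / \<epsilon>) f t - f t) + L1norm (\<lambda>t. conv ?r (\<lambda>u. ?D \<epsilon> u - ?m u) t)"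
      by (rule nn_integral_add) measurable
    also have "L1norm (\<lambda>t. conv ?r (\<lambda>u. ?D \<epsilon> u - ?m u) t) \<le> C * L1norm (\<lambda>t. ?D \<epsilon> t - ?m t)"
      unfolding C_def by (rule nn_integral_conv_le) measurable
    also have "L1norm (\<lambda>t. ?D \<epsilon> t - ?m t) = L1norm_on {a..b} (\<lambda>t. marchaud_trunc \<alpha> \<epsilon> f t - marchaud \<alpha> f t)"
      by (intro nn_integral_cong) (auto simp: zero_ext_def indicator_def)
    finally show ?thesis by (simp add: add_left_mono)
  qed
  have "I \<le> 0"
  proof (rule tendsto_lowerbound)
    show "((\<lambda>\<epsilon>. L1norm (\<lambda>t. conv (\<lambda>v. marchaud_kernel \<alpha> (v / \<epsilon>) / \<epsilon>) f t - f t)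
      + C * L1norm_on {a..b} (\<lambda>t. marchaud_trunc \<alpha> \<epsilon> f t - marchaud \<alpha> f t)) \<longlongrightarrow> 0) (at_right 0)"
      using tendsto_add[OF approximate_identity_L1[OF marchaud_kernel_integrable[OF \<alpha>] marchaud_kernel_integral[OF \<alpha>] f_int]
          ennreal_tendsto_cmult[OF _ marchaud_trunc_tendsto_marchaud, of C]] C by simp
    show "\<forall>\<^sub>F \<epsilon> in at_right 0. I \<le> L1norm (\<lambda>t. conv (\<lambda>v. marchaud_kernel \<alpha> (v / \<epsilon>) / \<epsilon>) f t - f t)
      + C * L1norm_on {a..b} (\<lambda>t. marchaud_trunc \<alpha> \<epsilon> f t - marchaud \<alpha> f t)"
      using le by (intro eventually_at_rightI[of 0 1]) auto
  qed simp
  then have "AE t in lborel. ennreal \<bar>f t - conv ?r ?m t\<bar> * indicator {a..b} t = 0"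
    unfolding I_def by (subst (asm) le_zero_eq, subst (asm) nn_integral_0_iff_AE) auto
  then show ?thesis by eventually_elim (auto simp: indicator_def)
qed

end

text \<open>The kernel decreases on \<open>(0, L]\<close>. Adding \<open>riesz_kernel L \<delta> w\<close> to the absolute value therefore
  produces a translate of the kernel for \<open>w > u\<close> and twice the kernel for \<open>w \<le> u\<close>. The integrals of
  the kernel and of its translate cancel, and twice the mass on \<open>(0, u]\<close> remains.\<close>
lemma riesz_shift_L1:
  assumes "0 < \<delta>" "\<delta> < 1" "0 \<le> L" "0 < u"
  shows "L1norm (\<lambda>w. indicator {..L} w * (riesz_kernel L \<delta> w - riesz_kernel L \<delta> (w - u))) \<le> ennreal (2 * (u powr \<delta> / (\<delta> * Gamma \<delta>)))"
proof -
  let ?R = "\<integral>\<^sup>+w. ennreal (riesz_kernel L \<delta> w) \<partial>lborel"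
  let ?q = "\<lambda>w. indicator {..L} w * (riesz_kernel L \<delta> w - riesz_kernel L \<delta> (w - u))"
  let ?A = "L1norm ?q"
  have G: "Gamma \<delta> > 0" using assms by (intro Gamma_real_pos)
  have R: "?R < \<infinity>" using nn_integral_riesz[of \<delta> L] assms by simp
  have pw: "\<bar>?q w\<bar> + riesz_kernel L \<delta> w \<le> 2 * riesz_kernel u \<delta> w + riesz_kernel L \<delta> (w - u)" for w
  proof -
    have "(w powr (\<delta> - 1)) / Gamma \<delta> \<le> ((w - u) powr (\<delta> - 1)) / Gamma \<delta>" if "u < w"
      using that assms G by (intro divide_right_mono powr_mono2') auto
    then show ?thesis
      using assms G by (auto simp: riesz_kernel_def indicator_def abs_if)
  qed
  have "?A + ?R = (\<integral>\<^sup>+w. ennreal \<bar>?q w\<bar> + ennreal (riesz_kernel L \<delta> w) \<partial>lborel)"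
    by (rule nn_integral_add[symmetric]) measurable
  also have "\<dots> \<le> (\<integral>\<^sup>+w. 2 * ennreal (riesz_kernel u \<delta> w) + ennreal (riesz_kernel L \<delta> (w - u)) \<partial>lborel)"
  proof (rule nn_integral_mono)
    fix w
    have "ennreal \<bar>?q w\<bar> + ennreal (riesz_kernel L \<delta> w) = ennreal (\<bar>?q w\<bar> + riesz_kernel L \<delta> w)"
      using assms by (simp add: riesz_nonneg)
    also have "\<dots> \<le> ennreal (2 * riesz_kernel u \<delta> w + riesz_kernel L \<delta> (w - u))" using pw by (rule ennreal_leI)
    also have "\<dots> = 2 * ennreal (riesz_kernel u \<delta> w) + ennreal (riesz_kernel L \<delta> (w - u))"
      using assms by (simp add: riesz_nonneg ennreal_mult)
    finally show "ennreal \<bar>?q w\<bar> + ennreal (riesz_kernel L \<delta> w) \<le> 2 * ennreal (riesz_kernel u \<delta> w) + ennreal (riesz_kernel L \<delta> (w - u))" .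
  qed
  also have "\<dots> = 2 * ennreal (u powr \<delta> / (\<delta> * Gamma \<delta>)) + ?R"
    using assms nn_integral_shift[of "\<lambda>w. ennreal (riesz_kernel L \<delta> w)" u]
    by (subst nn_integral_add) (auto simp: nn_integral_cmult nn_integral_riesz)
  finally have "?R + ?A \<le> ?R + 2 * ennreal (u powr \<delta> / (\<delta> * Gamma \<delta>))"
    by (simp only: add.commute)
  then have "?A \<le> 2 * ennreal (u powr \<delta> / (\<delta> * Gamma \<delta>))"
    using R by (auto simp only: ennreal_add_left_cancel_le infinity_ennreal_def)
  also have "2 * ennreal (u powr \<delta> / (\<delta> * Gamma \<delta>)) = ennreal (2 * (u powr \<delta> / (\<delta> * Gamma \<delta>)))"
    using assms G by (subst ennreal_mult) auto
  finally show ?thesis .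
qed

lemma L1_modulus_riesz:
  assumes "0 < \<delta>" "\<delta> < 1" "a \<le> b" "0 < u" and \<phi>: "integrable lborel \<phi>" "\<And>r. r < a \<Longrightarrow> \<phi> r = 0"
  shows "L1_modulus a b (conv (riesz_kernel (b - a) \<delta>) \<phi>) u
    \<le> ennreal (2 * (u powr \<delta> / (\<delta> * Gamma \<delta>))) * L1norm \<phi>"
proof -
  let ?r = "riesz_kernel (b - a) \<delta>"
  let ?q = "\<lambda>w. indicator {..b - a} w * (?r w - ?r (w - u))"
  have ri: "integrable lborel ?r" using assms by (intro riesz_integrable) auto
  have rs: "integrable lborel (\<lambda>w. ?r (w - u))"
    using lborel_integrable_real_affine[OF ri, of 1 "-u"] by simp
  note [measurable] = integrable_borel[OF \<phi>(1)]
  have "L1_modulus a b (conv ?r \<phi>) u \<le> L1norm (\<lambda>t. conv ?q \<phi> t)"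
    unfolding L1_modulus_def
  proof (rule nn_integral_mono_AE)
    show "AE t in lborel. ennreal \<bar>conv ?r \<phi> t - conv ?r \<phi> (t - u)\<bar> * indicator {a..b} t \<le> ennreal \<bar>conv ?q \<phi> t\<bar>"
      using conv_diff_left_AE[OF ri rs \<phi>(1)]
    proof eventually_elim
      case (elim t)
      have s: "conv ?r \<phi> (t - u) = conv (\<lambda>w. ?r (w - u)) \<phi> t"
        unfolding conv_def using lborel_integral_real_affine[of 1 "\<lambda>w. ?r (w - u) * \<phi> (t - w)" u] by (simp add: algebra_simps)
      have "conv ?q \<phi> t = conv (\<lambda>w. ?r w - ?r (w - u)) \<phi> t" if "t \<le> b"
        by (rule conv_cong_kernel[OF \<phi>(2)]) (use that in \<open>auto simp: indicator_def\<close>)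
      then show ?case using s elim by (auto simp: indicator_def)
    qed
  qed
  also have "\<dots> \<le> L1norm ?q * L1norm \<phi>"
    by (rule nn_integral_conv_le) measurable
  also have "\<dots> \<le> ennreal (2 * (u powr \<delta> / (\<delta> * Gamma \<delta>))) * L1norm \<phi>"
    using assms by (intro mult_right_mono riesz_shift_L1) auto
  finally show ?thesis .
qed

section \<open>Fractional integrals: semigroup law and uniqueness\<close>

lemma conv_riesz_riesz:
  assumes "0 < \<alpha>" "0 < \<beta>" "v \<le> L"
  shows "conv (riesz_kernel L \<alpha>) (riesz_kernel L \<beta>) v = riesz_kernel L (\<alpha> + \<beta>) v"
proof (cases "v > 0")
  case False
  then have "(\<lambda>u. riesz_kernel L \<alpha> u * riesz_kernel L \<beta> (v - u)) = (\<lambda>u. 0)" by (auto simp: riesz_kernel_def)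
  then show ?thesis using False by (simp add: conv_def riesz_kernel_def)
next
  case True
  let ?f = "\<lambda>t. t powr (\<alpha> - 1) * (1 - t) powr (\<beta> - 1)"
  have G: "Gamma \<alpha> > 0" "Gamma \<beta> > 0" "Gamma (\<alpha> + \<beta>) > 0" using assms by (auto intro: Gamma_real_pos)
  then have B: "Beta \<alpha> \<beta> \<ge> 0" by (simp add: Beta_def)
  have "(\<integral>\<^sup>+t. ennreal (indicator {0..1} t * ?f t) \<partial>lborel) = ennreal (Beta \<alpha> \<beta>)"
    by (rule nn_integral_has_integral_lebesgue[OF _ has_integral_Beta_real]) (use assms in auto)
  then have I: "(LBINT t. indicator {0..1} t * ?f t) = Beta \<alpha> \<beta>"
    using B by (subst integral_eq_nn_integral) auto
  have "conv (riesz_kernel L \<alpha>) (riesz_kernel L \<beta>) v = v * (LBINT t. riesz_kernel L \<alpha> (v * t) * riesz_kernel L \<beta> (v - v * t))"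
    unfolding conv_def using True
    by (subst lborel_integral_real_affine[where c=v and t=0]) auto
  also have "\<dots> = v * (LBINT t. (v powr (\<alpha> + \<beta> - 2) / (Gamma \<alpha> * Gamma \<beta>)) * (indicator {0..1} t * ?f t))"
  proof (rule arg_cong2[where f="(*)", OF refl Bochner_Integration.integral_cong[OF refl]])
    fix t :: real
    show "riesz_kernel L \<alpha> (v * t) * riesz_kernel L \<beta> (v - v * t) = v powr (\<alpha> + \<beta> - 2) / (Gamma \<alpha> * Gamma \<beta>) * (indicator {0..1} t * ?f t)"
    proof (cases "0 < t \<and> t < 1")
      case True
      have vt: "0 < v * t" "v * t < v" using True \<open>v > 0\<close> by auto
      have 1: "v - v * t = v * (1 - t)" by (simp add: algebra_simps)
      have "v powr (\<alpha> + \<beta> - 2) = v powr (\<alpha> - 1) * v powr (\<beta> - 1)" by (simp flip: powr_add)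
      moreover have "riesz_kernel L \<alpha> (v * t) = v powr (\<alpha> - 1) * t powr (\<alpha> - 1) / Gamma \<alpha>"
      proof -
        have "v * t \<le> L" using vt \<open>v \<le> L\<close> by linarith
        then show ?thesis using vt True \<open>v > 0\<close> by (simp add: riesz_kernel_def powr_mult)
      qed
      moreover have "riesz_kernel L \<beta> (v - v * t) = v powr (\<beta> - 1) * (1 - t) powr (\<beta> - 1) / Gamma \<beta>"
      proof -
        have "0 < v - v * t" "v - v * t \<le> L" using vt \<open>v \<le> L\<close> by linarith+
        then show ?thesis using True \<open>v > 0\<close> unfolding riesz_kernel_def 1 by (simp add: powr_mult)
      qed
      moreover have "indicator {0..1} t = (1::real)" using True by simp
      ultimately show ?thesis by (simp only:) simp
    next
      case False
      then consider "t \<le> 0" | "t \<ge> 1" by linarith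
      then have "riesz_kernel L \<alpha> (v * t) * riesz_kernel L \<beta> (v - v * t) = 0"
      proof cases
        case 1
        then have "v * t \<le> 0" using \<open>v > 0\<close> by (simp add: mult_le_0_iff)
        then show ?thesis by (simp add: riesz_kernel_def)
      next
        case 2
        then have "v - v * t \<le> 0" using \<open>v > 0\<close> by simp
        then have "riesz_kernel L \<beta> (v - v * t) = 0" unfolding riesz_kernel_def by (metis not_le)
        then show ?thesis by simp
      qed
      moreover have "indicator {0..1} t * ?f t = 0" using False by (auto simp: indicator_def)
      ultimately show ?thesis by (simp only: mult_zero_right)
    qed
  qed
  also have "\<dots> = v * (v powr (\<alpha> + \<beta> - 2) / (Gamma \<alpha> * Gamma \<beta>)) * Beta \<alpha> \<beta>"
    using I by (subst integral_mult_right_zero) simp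
  also have "v * (v powr (\<alpha> + \<beta> - 2) / (Gamma \<alpha> * Gamma \<beta>)) = v powr (\<alpha> + \<beta> - 1) / (Gamma \<alpha> * Gamma \<beta>)"
    using True powr_add[of v 1 "\<alpha> + \<beta> - 2"] by simp
  also have "\<dots> * Beta \<alpha> \<beta> = riesz_kernel L (\<alpha> + \<beta>) v"
    using True assms G[THEN less_imp_neq] by (simp add: riesz_kernel_def Beta_def)
  finally show ?thesis .
qed

text \<open>Representation of \<open>f\<close> on \<open>[a, b]\<close> as the fractional integral of order \<open>\<alpha>\<close> of \<open>\<phi>\<close>. Requiring \<open>\<phi>\<close> to
  vanish outside \<open>[a, b]\<close> makes \<open>\<phi>\<close> unique up to null sets on the whole line.\<close>
definition frac_rep :: "real \<Rightarrow> real \<Rightarrow> real \<Rightarrow> (real \<Rightarrow> real) \<Rightarrow> (real \<Rightarrow> real) \<Rightarrow> bool" where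
  "frac_rep a b \<alpha> f \<phi> \<longleftrightarrow> integrable lborel \<phi> \<and> (\<forall>r. r \<notin> {a..b} \<longrightarrow> \<phi> r = 0) \<and>
     (AE t in lborel. t \<in> {a..b} \<longrightarrow> f t = conv (riesz_kernel (b - a) \<alpha>) \<phi> t)"

lemma frac_repD:
  assumes "frac_rep a b \<alpha> f \<phi>"
  shows "integrable lborel \<phi>" "\<phi> \<in> borel_measurable borel" "\<And>r. r \<notin> {a..b} \<Longrightarrow> \<phi> r = 0"
    "AE t in lborel. t \<in> {a..b} \<longrightarrow> f t = conv (riesz_kernel (b - a) \<alpha>) \<phi> t"
  using assms by (auto simp: frac_rep_def dest: borel_measurable_integrable)

lemma zero_ext_measurable [measurable]:
  assumes [measurable]: "f \<in> borel_measurable borel" shows "zero_ext a b f \<in> borel_measurable borel"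
proof -
  have "zero_ext a b f = (\<lambda>t. if t \<in> {a..b} then f t else 0)" by (auto simp: zero_ext_def)
  then show ?thesis by simp
qed

lemma zero_ext_integrable:
  assumes "integrable lborel f" shows "integrable lborel (zero_ext a b f)"
  using assms unfolding zero_ext_integrable_iff set_integrable_def by (rule integrable_mult_indicator[rotated]) simp

lemma zero_ext_idem: "(\<And>r. r \<notin> {a..b} \<Longrightarrow> f r = 0) \<Longrightarrow> zero_ext a b f = f"
  by (auto simp: zero_ext_def fun_eq_iff)

lemma in_frac_image_left_iff: "in_frac_image_left \<alpha> a b f \<longleftrightarrow> (\<exists>\<phi>. frac_rep a b \<alpha> f \<phi>)"
proof
  assume "in_frac_image_left \<alpha> a b f"
  then obtain \<phi> where \<phi>: "set_integrable lborel {a..b} \<phi>" "AE t in lborel. t \<in> {a..b} \<longrightarrow> f t = frac_int_left \<alpha> a \<phi> t"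
    by (auto simp: in_frac_image_left_def)
  from \<phi>(2) have "AE t in lborel. t \<in> {a..b} \<longrightarrow> f t = conv (riesz_kernel (b - a) \<alpha>) (zero_ext a b \<phi>) t"
    by eventually_elim (simp add: frac_int_left_eq_conv)
  then have "frac_rep a b \<alpha> f (zero_ext a b \<phi>)"
    using \<phi>(1) by (auto simp: frac_rep_def zero_ext_integrable_iff) (simp_all add: zero_ext_def)
  then show "\<exists>\<phi>. frac_rep a b \<alpha> f \<phi>" by blast
next
  assume "\<exists>\<phi>. frac_rep a b \<alpha> f \<phi>"
  then obtain \<phi> where \<phi>: "frac_rep a b \<alpha> f \<phi>" ..
  note d = frac_repD[OF this]
  have z: "zero_ext a b \<phi> = \<phi>" using d(3) by (rule zero_ext_idem)
  show "in_frac_image_left \<alpha> a b f"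
    unfolding in_frac_image_left_def
  proof (intro exI[of _ \<phi>] conjI)
    show "set_integrable lborel {a..b} \<phi>" using d(1) z by (simp add: zero_ext_integrable_iff[symmetric])
    show "AE t in lborel. t \<in> {a..b} \<longrightarrow> f t = frac_int_left \<alpha> a \<phi> t"
      using d(4) by eventually_elim (simp add: frac_int_left_eq_conv[of _ a b] z)
  qed
qed

lemma frac_rep_deriv:
  assumes "0 < \<alpha>" "\<alpha> < 1" "a < b" and meas: "zero_ext a b f \<in> borel_measurable borel" and rep: "frac_rep a b \<alpha> f \<phi>"
  shows "set_integrable lborel {a..b} (frac_deriv_left \<alpha> a b f)"
    and "AE t in lborel. t \<in> {a..b} \<longrightarrow> frac_deriv_left \<alpha> a b f t = \<phi> t"
proof -
  note d = frac_repD[OF rep]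
  have z: "zero_ext a b \<phi> = \<phi>" using d(3) by (rule zero_ext_idem)
  have si: "set_integrable lborel {a..b} \<phi>" using d(1) z by (simp add: zero_ext_integrable_iff[symmetric])
  have "AE t in lborel. t \<in> {a..b} \<longrightarrow> f t = frac_int_left \<alpha> a \<phi> t"
    using d(4) by eventually_elim (simp add: frac_int_left_eq_conv[of _ a b] z)
  from frac_deriv_left_AE[OF assms(1-3) meas si this]
  show "set_integrable lborel {a..b} (frac_deriv_left \<alpha> a b f)"
    "AE t in lborel. t \<in> {a..b} \<longrightarrow> frac_deriv_left \<alpha> a b f t = \<phi> t" .
qed

text \<open>Both functions are representatives of the fractional derivative.\<close>
lemma frac_rep_unique:
  assumes "0 < \<alpha>" "\<alpha> < 1" "a < b" "zero_ext a b f \<in> borel_measurable borel" "frac_rep a b \<alpha> f \<phi>" "frac_rep a b \<alpha> f \<psi>"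
  shows "AE t in lborel. \<phi> t = \<psi> t"
  using frac_rep_deriv(2)[OF assms(1-4) assms(5)] frac_rep_deriv(2)[OF assms(1-4) assms(6)]
proof eventually_elim
  case (elim t)
  then show ?case using frac_repD(3)[OF assms(5), of t] frac_repD(3)[OF assms(6), of t] by (cases "t \<in> {a..b}") auto
qed

lemma conv_riesz_past: "(\<And>r. r < a \<Longrightarrow> \<phi> r = 0) \<Longrightarrow> t < a \<Longrightarrow> conv (riesz_kernel L \<alpha>) \<phi> t = 0"
proof -
  assume "\<And>r. r < a \<Longrightarrow> \<phi> r = 0" "t < a"
  then have "(\<lambda>u. riesz_kernel L \<alpha> u * \<phi> (t - u)) = (\<lambda>u. 0)" by (auto simp: riesz_kernel_def)
  then show ?thesis by (simp add: conv_def)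
qed

lemma conv_riesz_zero_ext:
  assumes \<phi>: "integrable lborel \<phi>" "\<And>r. r < a \<Longrightarrow> \<phi> r = 0" and "t \<le> b"
  shows "conv (riesz_kernel L \<alpha>) (zero_ext a b (conv (riesz_kernel K \<beta>) \<phi>)) t = conv (riesz_kernel L \<alpha>) (conv (riesz_kernel K \<beta>) \<phi>) t"
proof (rule conv_cong_past[OF _ _ _ _ _ assms(3)])
  have [measurable]: "\<phi> \<in> borel_measurable borel" using \<phi> by (auto dest: borel_measurable_integrable)
  show "riesz_kernel L \<alpha> \<in> borel_measurable borel" "conv (riesz_kernel K \<beta>) \<phi> \<in> borel_measurable borel"
    "zero_ext a b (conv (riesz_kernel K \<beta>) \<phi>) \<in> borel_measurable borel" by measurable
  show "AE r in lborel. r \<le> b \<longrightarrow> zero_ext a b (conv (riesz_kernel K \<beta>) \<phi>) r = conv (riesz_kernel K \<beta>) \<phi> r"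
    using conv_riesz_past[of a \<phi>, OF \<phi>(2)] by (intro AE_I2) (auto simp: zero_ext_def not_le)
qed (auto simp: riesz_kernel_def)

lemma frac_rep_semigroup:
  assumes "0 < \<alpha>" "0 < \<beta>" "a < b" and rep: "frac_rep a b (\<alpha> + \<beta>) f \<phi>"
  shows "frac_rep a b \<alpha> f (zero_ext a b (conv (riesz_kernel (b - a) \<beta>) \<phi>))"
proof -
  note d = frac_repD[OF rep]
  have r: "integrable lborel (riesz_kernel (b - a) \<alpha>)" "integrable lborel (riesz_kernel (b - a) \<beta>)"
    using assms by (auto intro: riesz_integrable)
  have past: "\<And>r. r < a \<Longrightarrow> \<phi> r = 0" using d(3) by auto
  show ?thesis
    unfolding frac_rep_def
  proof (intro conjI allI impI)
    show "integrable lborel (zero_ext a b (conv (riesz_kernel (b - a) \<beta>) \<phi>))"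
      by (intro zero_ext_integrable conv_integrable r d)
    show "AE t in lborel. t \<in> {a..b} \<longrightarrow> f t = conv (riesz_kernel (b - a) \<alpha>) (zero_ext a b (conv (riesz_kernel (b - a) \<beta>) \<phi>)) t"
      using d(4) conv_assoc_AE[OF r d(1)]
    proof eventually_elim
      case (elim t)
      show ?case
      proof
        assume t: "t \<in> {a..b}"
        have "conv (conv (riesz_kernel (b - a) \<alpha>) (riesz_kernel (b - a) \<beta>)) \<phi> t = conv (riesz_kernel (b - a) (\<alpha> + \<beta>)) \<phi> t"
          by (rule conv_cong_kernel[OF past]) (use t assms in \<open>auto intro!: conv_riesz_riesz\<close>)
        then show "f t = conv (riesz_kernel (b - a) \<alpha>) (zero_ext a b (conv (riesz_kernel (b - a) \<beta>) \<phi>)) t"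
          using elim t conv_riesz_zero_ext[OF d(1) past] by simp
      qed
    qed
  qed (auto simp: zero_ext_def)
qed

text \<open>The inverse of the semigroup law: lowering the order of integration by \<open>\<alpha>\<close> on both sides.\<close>
lemma frac_rep_quotient:
  assumes "0 < \<alpha>" "\<alpha> < 1" "0 < \<beta>" "a < b" "zero_ext a b f \<in> borel_measurable borel"
    and rep: "frac_rep a b (\<alpha> + \<beta>) f \<phi>" "frac_rep a b \<alpha> f F"
  shows "frac_rep a b \<beta> F \<phi>"
proof -
  have "AE t in lborel. F t = zero_ext a b (conv (riesz_kernel (b - a) \<beta>) \<phi>) t"
    by (rule frac_rep_unique[OF assms(1,2,4,5) rep(2) frac_rep_semigroup[OF assms(1,3,4) rep(1)]])
  then have "AE t in lborel. t \<in> {a..b} \<longrightarrow> F t = conv (riesz_kernel (b - a) \<beta>) \<phi> t"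
    by eventually_elim (auto simp: zero_ext_def)
  then show ?thesis using frac_repD[OF rep(1)] by (auto simp: frac_rep_def)
qed

lemma (in nikolskii) frac_rep_marchaud: "frac_rep a b \<alpha> f (zero_ext a b (marchaud \<alpha> f))"
  unfolding frac_rep_def
  using marchaud_integrable riesz_marchaud_AE by (auto simp: zero_ext_integrable_iff) (simp_all add: zero_ext_def)

text \<open>Fractional integrals gain smoothness: a fractional integral of order \<open>\<beta>\<close> of an \<open>L\<^sup>1\<close> function has an
  \<open>L\<^sup>1\<close> modulus of order \<open>u powr \<beta>\<close>.\<close>
lemma frac_rep_L1_modulus:
  assumes "0 < \<beta>" "\<beta> < 1" "a < b" and rep: "frac_rep a b \<beta> F \<phi>"
    and F: "F \<in> borel_measurable borel" "\<And>r. r < a \<Longrightarrow> F r = 0"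
  shows "\<exists>M\<ge>0. \<forall>u>0. L1_modulus a b F u \<le> ennreal (M * u powr \<beta>)"
proof -
  note d = frac_repD[OF rep]
  note [measurable] = d(2) F(1)
  have past: "\<And>r. r < a \<Longrightarrow> \<phi> r = 0" using d(3) by auto
  have G: "Gamma \<beta> > 0" using assms by (intro Gamma_real_pos)
  obtain N where N: "0 \<le> N" "L1norm \<phi> = ennreal N"
    using integrable_nn_finite[OF d(1)] by (cases "L1norm \<phi>") auto
  show ?thesis
  proof (intro exI[of _ "2 / (\<beta> * Gamma \<beta>) * N"] conjI allI impI)
    fix u :: real assume u: "u > 0"
    have "L1_modulus a b F u = L1_modulus a b (conv (riesz_kernel (b - a) \<beta>) \<phi>) u"
    proof (rule L1_modulus_cong_AE)
      show "AE t in lborel. t \<le> b \<longrightarrow> F t = conv (riesz_kernel (b - a) \<beta>) \<phi> t"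
        using d(4)
      proof eventually_elim
        case (elim t)
        then show ?case using F(2)[of t] conv_riesz_past[of a \<phi> t, OF past] by (cases "t < a") auto
      qed
    qed (use u in auto)
    also have "\<dots> \<le> ennreal (2 * (u powr \<beta> / (\<beta> * Gamma \<beta>))) * ennreal N"
      unfolding N(2)[symmetric] by (rule L1_modulus_riesz) (use assms u d(1) past in auto)
    also have "\<dots> = ennreal (2 * (u powr \<beta> / (\<beta> * Gamma \<beta>)) * N)"
      by (rule ennreal_mult[symmetric]) (use G assms N in auto)
    also have "2 * (u powr \<beta> / (\<beta> * Gamma \<beta>)) * N = 2 / (\<beta> * Gamma \<beta>) * N * u powr \<beta>"
      by simp
    finally show "L1_modulus a b F u \<le> ennreal (2 / (\<beta> * Gamma \<beta>) * N * u powr \<beta>)" .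
  qed (use G assms N in auto)
qed

section \<open>Fractional integration by parts and mollification\<close>

text \<open>Fractional integration by parts in the case where Fubini applies. The reflected convolution on the
  right is the right-sided fractional integral of \<open>\<psi>\<close> if \<open>k\<close> is a Riesz kernel.\<close>
lemma conv_duality:
  assumes k: "integrable lborel k" and \<Phi>: "integrable lborel \<Phi>" and [measurable]: "\<psi> \<in> borel_measurable borel"
    and B: "\<And>t. \<bar>\<psi> t\<bar> \<le> B"
  shows "(LBINT t. conv k \<Phi> t * \<psi> t) = (LBINT r. \<Phi> r * conv k (\<lambda>s. \<psi> (- s)) (- r))"
proof -
  have [measurable]: "k \<in> borel_measurable borel" "\<Phi> \<in> borel_measurable borel"
    using k \<Phi> by (auto dest: borel_measurable_integrable)
  have "B \<ge> 0" using B[of 0] by linarith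
  have "(\<integral>\<^sup>+p. ennreal (norm (case p of (t, r) \<Rightarrow> k (t - r) * \<Phi> r * \<psi> t)) \<partial>(lborel \<Otimes>\<^sub>M lborel))
    = (\<integral>\<^sup>+t. \<integral>\<^sup>+r. ennreal \<bar>k (t - r) * \<Phi> r * \<psi> t\<bar> \<partial>lborel \<partial>lborel)"
    by (subst lborel.nn_integral_fst[symmetric]) auto
  also have "\<dots> \<le> (\<integral>\<^sup>+t. \<integral>\<^sup>+r. ennreal B * ennreal \<bar>\<Phi> r * k (t - r)\<bar> \<partial>lborel \<partial>lborel)"
  proof (intro nn_integral_mono)
    fix t r
    have "\<bar>k (t - r) * \<Phi> r * \<psi> t\<bar> \<le> B * \<bar>\<Phi> r * k (t - r)\<bar>"
      using mult_right_mono[OF B[of t], of "\<bar>\<Phi> r * k (t - r)\<bar>"] by (simp add: abs_mult mult_ac)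
    then show "ennreal \<bar>k (t - r) * \<Phi> r * \<psi> t\<bar> \<le> ennreal B * ennreal \<bar>\<Phi> r * k (t - r)\<bar>"
      using \<open>B \<ge> 0\<close> by (simp add: ennreal_leI flip: ennreal_mult)
  qed
  also have "\<dots> = ennreal B * (\<integral>\<^sup>+t. \<integral>\<^sup>+r. ennreal \<bar>\<Phi> r * k (t - r)\<bar> \<partial>lborel \<partial>lborel)"
    by (simp add: nn_integral_cmult)
  also have "\<dots> < \<infinity>"
    using integrable_nn_finite[OF k] integrable_nn_finite[OF \<Phi>]
    by (subst nn_integral_conv_kernel) (auto simp: ennreal_mult_less_top)
  finally have int: "integrable (lborel \<Otimes>\<^sub>M lborel) (\<lambda>(t, r). k (t - r) * \<Phi> r * \<psi> t)"
    by (intro integrableI_bounded) auto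
  have "(LBINT t. conv k \<Phi> t * \<psi> t) = (LBINT t. LBINT r. k (t - r) * \<Phi> r * \<psi> t)"
    unfolding conv_eq_integral_reflect by simp
  also have "\<dots> = (LBINT r. LBINT t. k (t - r) * \<Phi> r * \<psi> t)"
    by (rule lborel_pair.Fubini_integral[OF int, symmetric])
  also have "\<dots> = (LBINT r. \<Phi> r * conv k (\<lambda>s. \<psi> (- s)) (- r))"
  proof (intro Bochner_Integration.integral_cong refl)
    fix r
    have "conv k (\<lambda>s. \<psi> (- s)) (- r) = (LBINT s. k (- r - s) * \<psi> (- s))"
      by (rule conv_eq_integral_reflect)
    also have "\<dots> = (LBINT t. k (t - r) * \<psi> t)"
      using integral_reflect_shift[of "\<lambda>t. k (t - r) * \<psi> t" 0] by (simp add: minus_diff_commute)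
    finally have c: "conv k (\<lambda>s. \<psi> (- s)) (- r) = (LBINT t. k (t - r) * \<psi> t)" .
    have "(LBINT t. k (t - r) * \<Phi> r * \<psi> t) = (LBINT t. \<Phi> r * (k (t - r) * \<psi> t))"
      by (simp add: mult_ac)
    then show "(LBINT t. k (t - r) * \<Phi> r * \<psi> t) = \<Phi> r * conv k (\<lambda>s. \<psi> (- s)) (- r)"
      unfolding c by simp
  qed
  finally show ?thesis .
qed

lemma integral_reflect: "(LBINT t. f (- t)) = (LBINT t. f t)" for f :: "real \<Rightarrow> real"
  using integral_reflect_shift[of f 0] by simp

lemma integrable_reflect: "integrable lborel (\<lambda>t. f (- t)) \<longleftrightarrow> integrable lborel f" for f :: "real \<Rightarrow> real"
  using integrable_reflect_shift[of f 0] by simp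

text \<open>The roles of the two functions are exchanged by reflection.\<close>
lemma conv_duality_swapped:
  assumes k: "integrable lborel k" and \<psi>: "integrable lborel \<psi>" and [measurable]: "\<Phi> \<in> borel_measurable borel"
    and B: "\<And>t. \<bar>\<Phi> t\<bar> \<le> B"
  shows "(LBINT t. conv k \<Phi> t * \<psi> t) = (LBINT r. \<Phi> r * conv k (\<lambda>s. \<psi> (- s)) (- r))"
proof -
  have "integrable lborel (\<lambda>s. \<psi> (- s))" using \<psi> by (simp add: integrable_reflect)
  from conv_duality[OF k this, of "\<lambda>s. \<Phi> (- s)" B] B
  have "(LBINT t. conv k (\<lambda>s. \<psi> (- s)) t * \<Phi> (- t)) = (LBINT r. \<psi> (- r) * conv k \<Phi> (- r))" by simp
  also have "\<dots> = (LBINT t. conv k \<Phi> t * \<psi> t)"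
    using integral_reflect[of "\<lambda>r. \<psi> r * conv k \<Phi> r"] by (simp add: mult.commute)
  also have "(LBINT t. conv k (\<lambda>s. \<psi> (- s)) t * \<Phi> (- t)) = (LBINT r. \<Phi> r * conv k (\<lambda>s. \<psi> (- s)) (- r))"
    using integral_reflect[of "\<lambda>t. conv k (\<lambda>s. \<psi> (- s)) (- t) * \<Phi> t"] by (simp add: mult.commute)
  finally show ?thesis ..
qed

text \<open>A box mollifier turns an integrable function into a bounded one.\<close>
lemma conv_box_bounded:
  assumes f: "integrable lborel f" and h: "h > 0"
  shows "\<bar>conv (\<lambda>v. indicator {0..1} (v / h) / h) f t\<bar> \<le> (LBINT u. \<bar>f u\<bar>) / h"
proof -
  have [measurable]: "f \<in> borel_measurable borel" using f by (auto dest: borel_measurable_integrable)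
  have i: "integrable lborel (\<lambda>u. f (t - u))" using f by (simp add: integrable_reflect_shift)
  have "\<bar>conv (\<lambda>v. indicator {0..1} (v / h) / h) f t\<bar> \<le> (LBINT u. \<bar>f (t - u)\<bar> / h)"
    unfolding conv_def
  proof (rule integral_abs_bound_integral)
    show "integrable lborel (\<lambda>u. \<bar>f (t - u)\<bar> / h)" using i by simp
    show "integrable lborel (\<lambda>u. indicator {0..1} (u / h) / h * f (t - u))"
      by (rule Bochner_Integration.integrable_bound[OF integrable_abs[OF i, THEN integrable_divide, of h]])
         (use h in \<open>auto simp: indicator_def\<close>)
    show "\<bar>indicator {0..1} (u / h) / h * f (t - u)\<bar> \<le> \<bar>f (t - u)\<bar> / h" for u
      using h by (auto simp: indicator_def)
  qed
  also have "\<dots> = (LBINT u. \<bar>f u\<bar>) / h"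
    using integral_reflect_shift[of "\<lambda>u. \<bar>f u\<bar>" t] by simp
  finally show ?thesis .
qed

lemma box_integrable: "h > 0 \<Longrightarrow> integrable lborel (\<lambda>v. indicator {0..1} (v / h) / h :: real)"
  and box_integral: "h > 0 \<Longrightarrow> (LBINT v. indicator {0..1} (v / h) / h :: real) = 1"
proof -
  assume h: "h > 0"
  have i: "integrable lborel (indicator {0..1} :: real \<Rightarrow> real)" by simp
  show "integrable lborel (\<lambda>v. indicator {0..1} (v / h) / h :: real)"
    using lborel_integrable_real_affine[OF i, of "1/h" 0] h by simp
  show "(LBINT v. indicator {0..1} (v / h) / h :: real) = 1"
    using h by (subst lborel_integral_real_affine[where c=h and t=0]) auto
qed

lemma conv_box_le:
  assumes [measurable]: "f \<in> borel_measurable borel" and B: "\<And>t. \<bar>f t\<bar> \<le> B" and h: "h > 0"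
  shows "\<bar>conv (\<lambda>v. indicator {0..1} (v / h) / h) f t\<bar> \<le> B"
proof -
  have "\<bar>conv (\<lambda>v. indicator {0..1} (v / h) / h) f t\<bar> \<le> (LBINT v. B * (indicator {0..1} (v / h) / h))"
    unfolding conv_def
  proof (rule integral_abs_bound_integral)
    show i: "integrable lborel (\<lambda>u. B * (indicator {0..1} (u / h) / h))"
      by (rule integrable_mult_right) (rule box_integrable[OF h])
    show le: "\<bar>indicator {0..1} (u / h) / h * f (t - u)\<bar> \<le> B * (indicator {0..1} (u / h) / h)" for u
      using B[of "t - u"] h by (auto simp: indicator_def divide_right_mono)
    show "integrable lborel (\<lambda>u. indicator {0..1} (u / h) / h * f (t - u))"
    proof (rule Bochner_Integration.integrable_bound[OF i])
      show "AE u in lborel. norm (indicator {0..1} (u / h) / h * f (t - u)) \<le> norm (B * (indicator {0..1} (u / h) / h))"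
        unfolding real_norm_def by (intro AE_I2 order_trans[OF le abs_ge_self])
    qed measurable
  qed
  then show ?thesis using box_integral[OF h] by simp
qed

section \<open>Integration by parts against unbounded derivatives\<close>

lemma integral_mult_bounded_tendsto:
  fixes u :: "'i \<Rightarrow> real \<Rightarrow> real"
  assumes u: "\<And>n. integrable lborel (u n)" and v: "integrable lborel v" and [measurable]: "w \<in> borel_measurable borel"
    and B: "AE r in lborel. \<bar>w r\<bar> \<le> B" and lim: "((\<lambda>n. L1norm (\<lambda>r. u n r - v r)) \<longlongrightarrow> 0) F"
  shows "((\<lambda>n. LBINT r. u n r * w r) \<longlongrightarrow> (LBINT r. v r * w r)) F"
proof -
  have [measurable]: "\<And>n. u n \<in> borel_measurable borel" "v \<in> borel_measurable borel"
    using u v by (auto dest: borel_measurable_integrable)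
  define B' where "B' = max B 0"
  have B': "AE r in lborel. \<bar>w r\<bar> \<le> B'" "B' \<ge> 0" using B by (auto simp: B'_def)
  have i: "integrable lborel (\<lambda>r. f r * w r)" if "integrable lborel f" for f
  proof (rule Bochner_Integration.integrable_bound[of _ "\<lambda>r. f r * B'"])
    note [measurable] = integrable_borel[OF that]
    show "(\<lambda>r. f r * w r) \<in> borel_measurable lborel" by measurable
    show "AE r in lborel. norm (f r * w r) \<le> norm (f r * B')"
      using B'(1) by eventually_elim (use B'(2) in \<open>auto simp: abs_mult intro!: mult_left_mono\<close>)
  qed (use that in simp)
  have le: "ennreal \<bar>(LBINT r. u n r * w r) - (LBINT r. v r * w r)\<bar> \<le> ennreal B' * L1norm (\<lambda>r. u n r - v r)" for n
  proof -
    have "(LBINT r. u n r * w r) - (LBINT r. v r * w r) = (LBINT r. (u n r - v r) * w r)"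
      using i[OF u] i[OF v] by (simp add: left_diff_distrib)
    then have "ennreal \<bar>(LBINT r. u n r * w r) - (LBINT r. v r * w r)\<bar> \<le> L1norm (\<lambda>r. (u n r - v r) * w r)"
      by (simp add: ennreal_abs_integral_le)
    also have "\<dots> \<le> (\<integral>\<^sup>+r. ennreal B' * ennreal \<bar>u n r - v r\<bar> \<partial>lborel)"
    proof (rule nn_integral_mono_AE)
      show "AE r in lborel. ennreal \<bar>(u n r - v r) * w r\<bar> \<le> ennreal B' * ennreal \<bar>u n r - v r\<bar>"
        using B'(1)
      proof eventually_elim
        case (elim r)
        have "\<bar>(u n r - v r) * w r\<bar> \<le> B' * \<bar>u n r - v r\<bar>"
          using mult_right_mono[OF elim, of "\<bar>u n r - v r\<bar>"] by (simp add: abs_mult mult.commute)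
        then show ?case using B'(2) by (simp add: ennreal_leI flip: ennreal_mult)
      qed
    qed
    also have "\<dots> = ennreal B' * L1norm (\<lambda>r. u n r - v r)" by (rule nn_integral_cmult) measurable
    finally show ?thesis .
  qed
  have "((\<lambda>n. ennreal B' * L1norm (\<lambda>r. u n r - v r)) \<longlongrightarrow> 0) F"
    using ennreal_tendsto_cmult[OF _ lim, of "ennreal B'"] by simp
  then have "((\<lambda>n. ennreal \<bar>(LBINT r. u n r * w r) - (LBINT r. v r * w r)\<bar>) \<longlongrightarrow> 0) F"
    by (rule tendsto_sandwich[OF always_eventually[OF allI] always_eventually[OF allI] tendsto_const, rotated 2])
       (rule zero_le, rule le)
  then have "((\<lambda>n. ennreal \<bar>(LBINT r. u n r * w r) - (LBINT r. v r * w r)\<bar>) \<longlongrightarrow> ennreal 0) F"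
    by (simp only: ennreal_0)
  then have "((\<lambda>n. \<bar>(LBINT r. u n r * w r) - (LBINT r. v r * w r)\<bar>) \<longlongrightarrow> 0) F"
    by (rule tendsto_ennrealD) simp_all
  then show ?thesis
    by (simp only: tendsto_rabs_zero_iff LIM_zero_iff)
qed

lemma L1_conv_box_tendsto:
  assumes "integrable lborel f"
  shows "(\<lambda>n. L1norm (\<lambda>t. conv (\<lambda>v. indicator {0..1} (v / (1 / real (Suc n))) / (1 / real (Suc n))) f t - f t)) \<longlonglongrightarrow> 0"
proof -
  have i: "integrable lborel (indicator {0..1} :: real \<Rightarrow> real)" "(LBINT s::real. indicator {0..1} s :: real) = 1"
    by simp_all
  have h: "filterlim (\<lambda>n. 1 / real (Suc n)) (at_right 0) sequentially"
    unfolding filterlim_at using LIMSEQ_Suc[OF lim_1_over_n] by (auto intro!: always_eventually)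
  show ?thesis
    by (rule filterlim_compose[OF approximate_identity_L1[OF i assms] h])
qed

text \<open>Integration by parts when \<open>\<psi>\<close> is only integrable, but \<open>G\<close> and the reflected convolution of \<open>\<psi>\<close> are
  bounded. Mollify \<open>\<Phi>\<close> by boxes of width \<open>1 / (n + 1)\<close>: the mollified function is bounded, so
  \<open>conv_duality_swapped\<close> applies, and up to \<open>b\<close> its convolution with \<open>k\<close> is the mollification of \<open>G\<close>. As \<open>n \<rightarrow> \<infinity>\<close> the
  mollifications of \<open>G\<close> converge boundedly and, along a subsequence, almost everywhere, while those
  of \<open>\<Phi>\<close> converge in \<open>L\<^sup>1\<close>.\<close>
lemma bounded_duality:
  assumes k: "integrable lborel k" "\<And>u. u < 0 \<Longrightarrow> k u = 0"
    and \<Phi>: "integrable lborel \<Phi>" "\<And>r. r < a \<Longrightarrow> \<Phi> r = 0" 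
    and G: "integrable lborel G" "\<And>t. \<bar>G t\<bar> \<le> B" "AE t in lborel. t \<le> b \<longrightarrow> G t = conv k \<Phi> t"
    and \<psi>: "integrable lborel \<psi>" "\<And>t. t > b \<Longrightarrow> \<psi> t = 0"
    and H: "AE r in lborel. r \<in> {a..b} \<longrightarrow> \<bar>conv k (\<lambda>s. \<psi> (- s)) (- r)\<bar> \<le> B'"
  shows "(LBINT t. G t * \<psi> t) = (LBINT r. \<Phi> r * conv k (\<lambda>s. \<psi> (- s)) (- r))"
proof -
  note [measurable] = borel_measurable_integrable[OF k(1), simplified] borel_measurable_integrable[OF \<Phi>(1), simplified]
    borel_measurable_integrable[OF G(1), simplified] borel_measurable_integrable[OF \<psi>(1), simplified]
  let ?H = "\<lambda>r. conv k (\<lambda>s. \<psi> (- s)) (- r)"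
  \<comment> \<open>Outside \<open>[a, b]\<close> there is no bound on the convolution of \<open>\<psi>\<close>, but there one of the two factors
    vanishes.\<close>
  define H' where "H' r = (if r \<in> {a..b} then ?H r else 0)" for r
  define \<rho> :: "nat \<Rightarrow> real \<Rightarrow> real" where "\<rho> n v = indicator {0..1} (v / (1 / real (Suc n))) / (1 / real (Suc n))" for n v
  have \<rho>: "integrable lborel (\<rho> n)" for n unfolding \<rho>_def by (rule box_integrable) simp
  have \<rho>0: "\<rho> n v = 0" if "v < 0" for n v using that by (auto simp: \<rho>_def indicator_def zero_le_mult_iff)
  have [measurable]: "\<rho> n \<in> borel_measurable borel" for n using \<rho>[of n] by (auto dest: borel_measurable_integrable)
  have [measurable]: "H' \<in> borel_measurable borel" unfolding H'_def by measurable
  have Hb: "?H r = 0" if "r > b" for r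
  proof -
    have "(\<lambda>u. k u * \<psi> (- (- r - u))) = (\<lambda>u. 0)"
    proof
      fix u show "k u * \<psi> (- (- r - u)) = 0" using k(2)[of u] \<psi>(2)[of "r + u"] that by (cases "u < 0") (auto simp: add.commute)
    qed
    then show ?thesis by (simp add: conv_def)
  qed
  have \<Phi>na: "conv (\<rho> n) \<Phi> r = 0" if "r < a" for r n
  proof -
    have "(\<lambda>u. \<rho> n u * \<Phi> (r - u)) = (\<lambda>u. 0)"
    proof
      fix u show "\<rho> n u * \<Phi> (r - u) = 0" using \<rho>0[of u n] \<Phi>(2)[of "r - u"] that by (cases "u < 0") auto
    qed
    then show ?thesis by (simp add: conv_def)
  qed
  have X: "(LBINT t. conv (\<rho> n) G t * \<psi> t) = (LBINT r. conv (\<rho> n) \<Phi> r * H' r)" for n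
  proof -
    have comm: "conv k (\<rho> n) = conv (\<rho> n) k" using conv_commute by blast
    have "(LBINT t. conv (\<rho> n) G t * \<psi> t) = (LBINT t. conv k (conv (\<rho> n) \<Phi>) t * \<psi> t)"
    proof (rule integral_cong_AE)
      show "AE t in lborel. conv (\<rho> n) G t * \<psi> t = conv k (conv (\<rho> n) \<Phi>) t * \<psi> t"
        using conv_assoc_AE[OF k(1) \<rho> \<Phi>(1), of n] conv_assoc_AE[OF \<rho> k(1) \<Phi>(1), of n]
      proof eventually_elim
        case (elim t)
        show ?case
        proof (cases "t \<le> b")
          case True
          have "conv (\<rho> n) G t = conv (\<rho> n) (conv k \<Phi>) t"
            by (rule conv_cong_past[OF _ _ _ \<rho>0 G(3) True]) measurable
          then show ?thesis using elim comm by simp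
        qed (use \<psi>(2) in auto)
      qed
    qed measurable
    also have "\<dots> = (LBINT r. conv (\<rho> n) \<Phi> r * ?H r)"
    proof (rule conv_duality_swapped[OF k(1) \<psi>(1)])
      fix t show "\<bar>conv (\<rho> n) \<Phi> t\<bar> \<le> (LBINT u. \<bar>\<Phi> u\<bar>) / (1 / real (Suc n))"
        unfolding \<rho>_def by (rule conv_box_bounded[OF \<Phi>(1)]) simp
    qed measurable
    also have "\<dots> = (LBINT r. conv (\<rho> n) \<Phi> r * H' r)"
      using \<Phi>na Hb by (intro Bochner_Integration.integral_cong refl) (auto simp: H'_def not_le)
    finally show ?thesis .
  qed
  have L1: "(\<lambda>n. LBINT r. conv (\<rho> n) \<Phi> r * H' r) \<longlonglongrightarrow> (LBINT r. \<Phi> r * H' r)"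
  proof (rule integral_mult_bounded_tendsto)
    show "AE r in lborel. \<bar>H' r\<bar> \<le> max B' 0" using H by eventually_elim (auto simp: H'_def)
    show "(\<lambda>n. L1norm (\<lambda>r. conv (\<rho> n) \<Phi> r - \<Phi> r)) \<longlonglongrightarrow> 0"
      using L1_conv_box_tendsto[OF \<Phi>(1)] unfolding \<rho>_def .
  qed (auto intro: conv_integrable[OF \<rho> \<Phi>(1)] \<Phi>)
  have Gn: "integrable lborel (\<lambda>t. conv (\<rho> n) G t - G t)" for n
    using conv_integrable[OF \<rho> G(1)] G(1) by simp
  have "(\<lambda>n. ennreal (LBINT t. norm (conv (\<rho> n) G t - G t))) \<longlonglongrightarrow> ennreal 0"
    using L1_conv_box_tendsto[OF G(1)] nn_integral_eq_integral[OF integrable_norm[OF Gn]] unfolding \<rho>_def by simp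
  then have "(\<lambda>n. LBINT t. norm (conv (\<rho> n) G t - G t)) \<longlonglongrightarrow> 0"
    by (rule tendsto_ennrealD) (auto intro: always_eventually)
  from tendsto_L1_AE_subseq[OF Gn this] obtain s where s: "strict_mono s" "AE t in lborel. (\<lambda>n. conv (\<rho> (s n)) G t - G t) \<longlonglongrightarrow> 0"
    by blast
  have "(\<lambda>n. LBINT t. conv (\<rho> (s n)) G t * \<psi> t) \<longlonglongrightarrow> (LBINT t. G t * \<psi> t)"
  proof (rule integral_dominated_convergence[where w="\<lambda>t. B * \<bar>\<psi> t\<bar>"])
    show "AE t in lborel. (\<lambda>n. conv (\<rho> (s n)) G t * \<psi> t) \<longlonglongrightarrow> G t * \<psi> t"
      using s(2)
    proof eventually_elim
      case (elim t)
      then have "(\<lambda>n. conv (\<rho> (s n)) G t) \<longlonglongrightarrow> G t" by (simp add: LIM_zero_iff)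
      then show ?case by (intro tendsto_intros)
    qed
    show "AE t in lborel. norm (conv (\<rho> (s n)) G t * \<psi> t) \<le> B * \<bar>\<psi> t\<bar>" for n
      unfolding \<rho>_def by (intro AE_I2) (auto simp only: real_norm_def abs_mult intro!: mult_right_mono conv_box_le G, auto)
  qed (use \<psi>(1) in \<open>auto\<close>)
  moreover have "(\<lambda>n. LBINT t. conv (\<rho> (s n)) G t * \<psi> t) \<longlonglongrightarrow> (LBINT r. \<Phi> r * H' r)"
    unfolding X using LIMSEQ_subseq_LIMSEQ[OF L1 s(1)] by (simp add: comp_def)
  ultimately have "(LBINT t. G t * \<psi> t) = (LBINT r. \<Phi> r * H' r)" by (rule LIMSEQ_unique)
  also have "\<dots> = (LBINT r. \<Phi> r * ?H r)"
    using \<Phi>(2) Hb by (intro Bochner_Integration.integral_cong refl) (auto simp: H'_def not_le)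
  finally show ?thesis .
qed

section \<open>Independence of the order\<close>

text \<open>Truncation of values to \<open>[-N, N]\<close>. It is \<open>1\<close>-Lipschitz, and so is its difference to the identity;
  hence neither operation increases an \<open>L\<^sup>1\<close> modulus.\<close>
definition clip :: "real \<Rightarrow> real \<Rightarrow> real" where "clip N x = max (- N) (min N x)"

lemma clip_bound: "0 \<le> N \<Longrightarrow> \<bar>clip N x\<bar> \<le> N" and clip_le: "0 \<le> N \<Longrightarrow> \<bar>clip N x\<bar> \<le> \<bar>x\<bar>"
  and clip_lipschitz: "0 \<le> N \<Longrightarrow> \<bar>clip N x - clip N y\<bar> \<le> \<bar>x - y\<bar>"
  and clip_diff_lipschitz: "0 \<le> N \<Longrightarrow> \<bar>(clip N x - x) - (clip N y - y)\<bar> \<le> \<bar>x - y\<bar>"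
  and clip_zero: "0 \<le> N \<Longrightarrow> clip N 0 = 0"
  by (auto simp: clip_def)

lemma clip_measurable [measurable]: "clip N \<in> borel_measurable borel"
  unfolding clip_def by measurable

lemma clip_eventually: "\<forall>\<^sub>F n in sequentially. clip (real n) x = x"
  using eventually_ge_at_top[of "nat \<lceil>\<bar>x\<bar>\<rceil>"]
proof eventually_elim
  case (elim n)
  then have "\<bar>x\<bar> \<le> real n" by linarith
  then show ?case by (auto simp: clip_def)
qed

lemma L1_modulus_mono:
  assumes "\<And>t s. \<bar>f t - f s\<bar> \<le> \<bar>g t - g s\<bar>"
  shows "L1_modulus a b f u \<le> L1_modulus a b g u"
  unfolding L1_modulus_def by (intro nn_integral_mono mult_right_mono ennreal_leI assms) auto

text \<open>Two pairs of derivatives of complementary orders have the same pairing. The pair of order \<open>\<alpha>0\<close> is the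
  good one, its right-sided member \<open>\<psi>0\<close> being bounded; about the pair of order \<open>\<alpha>\<close> only the
  integrability of the product is known. That \<open>f\<close> can be differentiated up to an order \<open>\<alpha>1 > \<alpha>0\<close>
  leaves room for the truncation argument in the case \<open>\<alpha> < \<alpha>0\<close>. Right-sided objects are given by
  their reflections, as functions on \<open>[-b, -a]\<close>.\<close>
theorem frac_pairing_unique:
  assumes ab: "a < b" and \<alpha>01: "0 < \<alpha>0" "\<alpha>0 < \<alpha>1" "\<alpha>1 < 1"
    and f: "zero_ext a b f \<in> borel_measurable borel" "frac_rep a b \<alpha>1 f \<phi>1" "frac_rep a b \<alpha>0 f \<phi>0"
    and g: "zero_ext (-b) (-a) g \<in> borel_measurable borel" "frac_rep (-b) (-a) (1 - \<alpha>0) g \<psi>0" "\<And>t. \<bar>\<psi>0 t\<bar> \<le> B"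
    and \<alpha>: "0 < \<alpha>" "\<alpha> < 1" "frac_rep a b \<alpha> f F" "frac_rep (-b) (-a) (1 - \<alpha>) g \<psi>"
    and int: "integrable lborel (\<lambda>t. F t * \<psi> (- t))"
  shows "(LBINT t. F t * \<psi> (- t)) = (LBINT t. \<phi>0 t * \<psi>0 (- t))"
proof -
  note dF = frac_repD[OF \<alpha>(3)] and d\<psi> = frac_repD[OF \<alpha>(4)] and d\<phi> = frac_repD[OF f(3)] and d\<psi>0 = frac_repD[OF g(2)]
  note [measurable] = dF(2) d\<psi>(2) d\<phi>(2) d\<psi>0(2)
  have ab': "- b < - a" using ab by simp
  have refl_ae: "AE t in lborel. P (- t)" if "Measurable.pred borel P" "AE t in lborel. P t" for P :: "real \<Rightarrow> bool"
    using AE_reflect_shift[OF that, of 0] by simp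
  have L: "- a - - b = b - a" by simp
  consider "\<alpha> = \<alpha>0" | "\<alpha>0 < \<alpha>" | "\<alpha> < \<alpha>0" by linarith
  then show ?thesis
  proof cases
    case 1
    have 1: "AE t in lborel. F t = \<phi>0 t"
      by (rule frac_rep_unique[OF \<alpha>(1,2) ab f(1) \<alpha>(3)]) (use f 1 in simp)
    have "AE t in lborel. \<psi> t = \<psi>0 t"
      by (rule frac_rep_unique[OF _ _ ab' g(1) \<alpha>(4)]) (use g \<alpha> \<open>\<alpha> = \<alpha>0\<close> in simp_all)
    then have 2: "AE t in lborel. \<psi> (- t) = \<psi>0 (- t)" by (rule refl_ae[rotated]) measurable
    show ?thesis
      by (rule integral_cong_AE) (measurable, use 1 2 in eventually_elim, simp)
  next
    case 2
    \<comment> \<open>Here \<open>\<phi>0\<close> and \<open>\<psi>\<close> are fractional integrals of order \<open>\<delta>\<close> of \<open>F\<close> and of the bounded \<open>\<psi>0\<close>.\<close>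
    define \<delta> where "\<delta> = \<alpha> - \<alpha>0"
    let ?r = "riesz_kernel (b - a) \<delta>"
    have ri: "integrable lborel ?r" using 2 ab by (intro riesz_integrable) (auto simp: \<delta>_def)
    have "frac_rep a b (\<alpha>0 + \<delta>) f F" using \<alpha>(3) by (simp add: \<delta>_def)
    then have "frac_rep a b \<delta> \<phi>0 F"
      by (rule frac_rep_quotient[rotated 5]) (use \<alpha> \<alpha>01 ab f 2 in \<open>auto simp: \<delta>_def\<close>)
    then have p: "AE t in lborel. t \<in> {a..b} \<longrightarrow> \<phi>0 t = conv ?r F t" by (rule frac_repD)
    have "frac_rep (-b) (-a) ((1 - \<alpha>) + \<delta>) g \<psi>0" using g(2) by (simp add: \<delta>_def)
    then have "frac_rep (-b) (-a) \<delta> \<psi> \<psi>0"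
      by (rule frac_rep_quotient[rotated 5]) (use \<alpha> \<alpha>01 ab' g 2 in \<open>auto simp: \<delta>_def\<close>)
    then have "AE t in lborel. t \<in> {-b..-a} \<longrightarrow> \<psi> t = conv ?r \<psi>0 t" using frac_repD(4) L by metis
    then have q: "AE t in lborel. - t \<in> {-b..-a} \<longrightarrow> \<psi> (- t) = conv ?r \<psi>0 (- t)" by (rule refl_ae[rotated]) measurable
    have "(LBINT t. \<phi>0 t * \<psi>0 (- t)) = (LBINT t. conv ?r F t * \<psi>0 (- t))"
    proof (rule integral_cong_AE)
      show "AE t in lborel. \<phi>0 t * \<psi>0 (- t) = conv ?r F t * \<psi>0 (- t)"
        using p
      proof eventually_elim
        case (elim t)
        then show ?case using d\<psi>0(3)[of "- t"] by (cases "t \<in> {a..b}") auto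
      qed
    qed measurable
    also have "\<dots> = (LBINT r. F r * conv ?r (\<lambda>s. \<psi>0 (- (- s))) (- r))"
      by (rule conv_duality[OF ri dF(1)]) (use g(3) in auto)
    also have "\<dots> = (LBINT r. F r * \<psi> (- r))"
    proof (rule integral_cong_AE)
      show "AE r in lborel. F r * conv ?r (\<lambda>s. \<psi>0 (- (- s))) (- r) = F r * \<psi> (- r)"
        using q
      proof eventually_elim
        case (elim t)
        then show ?case using dF(3)[of t] by (cases "t \<in> {a..b}") auto
      qed
    qed measurable
    finally show ?thesis ..
  next
    case 3
    \<comment> \<open>Now \<open>F\<close> is a fractional integral of order \<open>\<delta>\<close> of \<open>\<phi>0\<close> and of order \<open>\<beta> > \<delta>\<close> of \<open>\<phi>1\<close>, and \<open>\<psi>0\<close> is the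
    one of order \<open>\<delta>\<close> of \<open>\<psi>\<close>. The surplus \<open>\<beta> - \<delta>\<close> is used for the convergence of \<open>\<Phi> n\<close> below.\<close>
    define \<delta> where "\<delta> = \<alpha>0 - \<alpha>"
    define \<beta> where "\<beta> = \<alpha>1 - \<alpha>"
    have \<delta>: "0 < \<delta>" "\<delta> < 1" "\<delta> < \<beta>" "0 < \<beta>" "\<beta> < 1" using 3 \<alpha> \<alpha>01 by (auto simp: \<delta>_def \<beta>_def)
    let ?r = "riesz_kernel (b - a) \<delta>"
    have ri: "integrable lborel ?r" using \<delta> ab by (intro riesz_integrable) auto
    have "frac_rep a b (\<alpha> + \<beta>) f \<phi>1" using f(2) by (simp add: \<beta>_def)
    then have F1: "frac_rep a b \<beta> F \<phi>1"
      by (rule frac_rep_quotient[rotated 5]) (use \<alpha> \<delta> ab f in auto)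
    have "frac_rep a b (\<alpha> + \<delta>) f \<phi>0" using f(3) by (simp add: \<delta>_def)
    then have F0: "frac_rep a b \<delta> F \<phi>0"
      by (rule frac_rep_quotient[rotated 5]) (use \<alpha> \<delta> ab f in auto)
    have "frac_rep (-b) (-a) ((1 - \<alpha>0) + \<delta>) g \<psi>" using \<alpha>(4) by (simp add: \<delta>_def)
    then have "frac_rep (-b) (-a) \<delta> \<psi>0 \<psi>"
      by (rule frac_rep_quotient[rotated 5]) (use \<alpha> \<alpha>01 \<delta> ab' g in auto)
    then have "AE t in lborel. t \<in> {-b..-a} \<longrightarrow> \<psi>0 t = conv ?r \<psi> t" using frac_repD(4) L by metis
    then have q: "AE t in lborel. - t \<in> {-b..-a} \<longrightarrow> \<psi>0 (- t) = conv ?r \<psi> (- t)" by (rule refl_ae[rotated]) measurable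
    have Fa: "\<And>r. r < a \<Longrightarrow> F r = 0" using dF(3) by auto
    obtain M where M: "0 \<le> M" "\<And>u. u > 0 \<Longrightarrow> L1_modulus a b F u \<le> ennreal (M * u powr \<beta>)"
      using frac_rep_L1_modulus[OF \<delta>(4,5) ab F1 dF(2) Fa] by blast
    interpret NF: nikolskii a b \<delta> \<beta> M F
      by standard (use ab \<delta> M dF Fa in auto)
    have \<phi>m: "AE t in lborel. zero_ext a b (marchaud \<delta> F) t = \<phi>0 t"
      by (rule frac_rep_unique[OF \<delta>(1,2) ab _ NF.frac_rep_marchaud F0]) measurable
    define FN where "FN n t = clip (real n) (F t)" for n t
    have [measurable]: "FN n \<in> borel_measurable borel" for n unfolding FN_def by measurable
    have FNi: "integrable lborel (FN n)" for n
      by (rule Bochner_Integration.integrable_bound[OF dF(1)]) (auto simp: FN_def clip_le)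
    have FNa: "FN n r = 0" if "r < a" for n r using Fa[OF that] by (simp add: FN_def clip_zero)
    interpret NN: nikolskii a b \<delta> \<beta> M "FN n" for n
    proof
      fix u :: real assume u: "u > 0"
      have "L1_modulus a b (FN n) u \<le> L1_modulus a b F u"
        unfolding FN_def by (rule L1_modulus_mono) (rule clip_lipschitz, simp)
      also have "\<dots> \<le> ennreal (M * u powr \<beta>)" by (rule M(2)[OF u])
      finally show "L1_modulus a b (FN n) u \<le> ennreal (M * u powr \<beta>)" .
    qed (use ab \<delta> M FNi FNa in auto)
    define \<Phi> where "\<Phi> n = zero_ext a b (marchaud \<delta> (FN n))" for n
    have rep\<Phi>: "frac_rep a b \<delta> (FN n) (\<Phi> n)" for n unfolding \<Phi>_def by (rule NN.frac_rep_marchaud)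
    note d\<Phi> = frac_repD[OF rep\<Phi>]
    have dual: "(LBINT t. FN n t * \<psi> (- t)) = (LBINT t. \<Phi> n t * \<psi>0 (- t))" for n
    proof -
      have "(LBINT t. FN n t * \<psi> (- t)) = (LBINT r. \<Phi> n r * conv ?r (\<lambda>s. \<psi> (- (- s))) (- r))"
      proof (rule bounded_duality[where a=a and b=b and B="real n" and B'=B])
        show "AE t in lborel. t \<le> b \<longrightarrow> FN n t = conv ?r (\<Phi> n) t"
          using d\<Phi>(4)[of n]
        proof eventually_elim
          case (elim t)
          then show ?case using FNa[of t n] conv_riesz_past[of a "\<Phi> n" t] d\<Phi>(3) by (cases "t < a") auto
        qed
        show "AE r in lborel. r \<in> {a..b} \<longrightarrow> \<bar>conv ?r (\<lambda>s. \<psi> (- (- s))) (- r)\<bar> \<le> B"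
          using q
        proof eventually_elim
          case (elim r)
          then show ?case using g(3)[of "- r"] by auto
        qed
        show "integrable lborel (\<lambda>t. \<psi> (- t))" using d\<psi>(1) by (simp add: integrable_reflect)
        show "\<psi> (- t) = 0" if "t > b" for t using d\<psi>(3)[of "- t"] that by auto
        show "\<bar>FN n t\<bar> \<le> real n" for t by (simp add: FN_def clip_bound)
      qed (use ri d\<Phi> FNi in \<open>auto simp: riesz_kernel_def\<close>)
      also have "\<dots> = (LBINT r. \<Phi> n r * \<psi>0 (- r))"
      proof (rule integral_cong_AE)
        show "AE r in lborel. \<Phi> n r * conv ?r (\<lambda>s. \<psi> (- (- s))) (- r) = \<Phi> n r * \<psi>0 (- r)"
          using q
        proof eventually_elim
          case (elim t)
          then show ?case using d\<Phi>(3)[of t n] by (cases "t \<in> {a..b}") auto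
        qed
      qed (use d\<Phi>(2) in measurable)
      finally show ?thesis .
    qed
    have l1: "(\<lambda>n. LBINT t. FN n t * \<psi> (- t)) \<longlonglongrightarrow> (LBINT t. F t * \<psi> (- t))"
    proof (rule integral_dominated_convergence[where w="\<lambda>t. \<bar>F t * \<psi> (- t)\<bar>"])
      show "AE t in lborel. (\<lambda>n. FN n t * \<psi> (- t)) \<longlonglongrightarrow> F t * \<psi> (- t)"
      proof (rule AE_I2)
        fix t
        have "\<forall>\<^sub>F n in sequentially. FN n t * \<psi> (- t) = F t * \<psi> (- t)"
          using clip_eventually[of "F t"] by eventually_elim (simp add: FN_def)
        then show "(\<lambda>n. FN n t * \<psi> (- t)) \<longlonglongrightarrow> F t * \<psi> (- t)" by (rule tendsto_eventually)
      qed
      show "AE t in lborel. norm (FN n t * \<psi> (- t)) \<le> \<bar>F t * \<psi> (- t)\<bar>" for n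
        by (auto simp: FN_def abs_mult intro!: mult_right_mono clip_le)
    qed (use int in auto)
    have FNF: "(\<lambda>n. L1norm (\<lambda>t. FN n t - F t)) \<longlonglongrightarrow> 0"
    proof -
      have "(\<lambda>n. \<integral>\<^sup>+t. ennreal (norm (F t - FN n t)) \<partial>lborel) \<longlonglongrightarrow> 0"
      proof (rule nn_integral_dominated_convergence_norm[where w="\<lambda>t. \<bar>F t\<bar>"])
        show "L1norm F < \<infinity>" by (rule integrable_nn_finite[OF dF(1)])
        show "AE t in lborel. (\<lambda>n. FN n t) \<longlonglongrightarrow> F t"
        proof (rule AE_I2)
          fix t show "(\<lambda>n. FN n t) \<longlonglongrightarrow> F t"
            using clip_eventually[of "F t"] unfolding FN_def by (rule tendsto_eventually)
        qed
      qed (auto simp: FN_def clip_le)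
      then show ?thesis by (simp add: abs_minus_commute)
    qed
    have "(\<lambda>n. L1norm_on {a..b} (\<lambda>t. marchaud \<delta> (\<lambda>t. FN n t - F t) t)) \<longlonglongrightarrow> 0"
    proof (rule LIMSEQ_zero_le)
      have "(\<lambda>n. \<integral>\<^sup>+u. ennreal (singular_kernel \<delta> u) * L1_modulus a b (\<lambda>t. FN n t - F t) u \<partial>lborel) \<longlonglongrightarrow> 0"
      proof (rule singular_kernel_L1_modulus_tendsto_0[OF \<delta>(1,3) M(1)])
        fix n and u :: real assume u: "u > 0"
        have "L1_modulus a b (\<lambda>t. FN n t - F t) u \<le> L1_modulus a b F u"
          unfolding FN_def by (rule L1_modulus_mono) (rule clip_diff_lipschitz, simp)
        also have "\<dots> \<le> ennreal (M * u powr \<beta>)" by (rule M(2)[OF u])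
        finally show "L1_modulus a b (\<lambda>t. FN n t - F t) u \<le> ennreal (M * u powr \<beta>)" .
      qed (use FNF in auto)
      then show "(\<lambda>n. ennreal (\<delta> / Gamma (1 - \<delta>)) * (\<integral>\<^sup>+u. ennreal (singular_kernel \<delta> u) * L1_modulus a b (\<lambda>t. FN n t - F t) u \<partial>lborel)) \<longlonglongrightarrow> 0"
        using ennreal_tendsto_cmult[of "ennreal (\<delta> / Gamma (1 - \<delta>))"] by fastforce
    qed (use \<delta> in \<open>auto intro!: marchaud_nn_le\<close>)
    also have "(\<lambda>n. L1norm_on {a..b} (\<lambda>t. marchaud \<delta> (\<lambda>t. FN n t - F t) t)) = (\<lambda>n. L1norm (\<lambda>t. \<Phi> n t - \<phi>0 t))"
    proof (rule ext, rule nn_integral_cong_AE)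
      fix n
      show "AE t in lborel. ennreal \<bar>marchaud \<delta> (\<lambda>t. FN n t - F t) t\<bar> * indicator {a..b} t = ennreal \<bar>\<Phi> n t - \<phi>0 t\<bar>"
        using marchaud_diff_AE[OF _ _ NN.singular_kernel_finite[of n] NF.singular_kernel_finite, simplified] \<phi>m
      proof eventually_elim
        case (elim t)
        show ?case
        proof (cases "t \<in> {a..b}")
          case True
          then show ?thesis using elim by (simp add: \<Phi>_def zero_ext_def)
        next
          case False
          then show ?thesis using d\<Phi>(3)[of t n] d\<phi>(3)[of t] by simp
        qed
      qed
    qed
    finally have \<Phi>l: "(\<lambda>n. L1norm (\<lambda>t. \<Phi> n t - \<phi>0 t)) \<longlonglongrightarrow> 0" .
    have l2: "(\<lambda>n. LBINT t. \<Phi> n t * \<psi>0 (- t)) \<longlonglongrightarrow> (LBINT t. \<phi>0 t * \<psi>0 (- t))"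
      by (rule integral_mult_bounded_tendsto[OF d\<Phi>(1) d\<phi>(1) _ _ \<Phi>l, of _ B]) (use g(3) in auto)
    show ?thesis using LIMSEQ_unique[OF l1] l2 unfolding dual by blast
  qed
qed

section \<open>Right-sided operators by reflection\<close>

lemma set_integrable_reflect:
  fixes f :: "real \<Rightarrow> real"
  shows "set_integrable lborel {-b..-a} (\<lambda>s. f (- s)) \<longleftrightarrow> set_integrable lborel {a..b} f"
proof -
  have *: "(\<lambda>s. indicator {-b..-a} s *\<^sub>R f (- s)) = (\<lambda>s. indicator {a..b} (- s) *\<^sub>R f (- s))"
    by (auto simp: fun_eq_iff indicator_def)
  show ?thesis unfolding set_integrable_def * by (rule integrable_reflect)
qed

lemma set_integral_reflect:
  fixes f :: "real \<Rightarrow> real"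
  shows "(LINT s:{-b..-a}|lborel. f (- s)) = (LINT t:{a..b}|lborel. f t)"
proof -
  have *: "(\<lambda>s. indicator {-b..-a} s *\<^sub>R f (- s)) = (\<lambda>s. indicator {a..b} (- s) *\<^sub>R f (- s))"
    by (auto simp: fun_eq_iff indicator_def)
  show ?thesis unfolding set_lebesgue_integral_def * by (rule integral_reflect)
qed

lemma AE_reflect_iff:
  "(AE t in lborel. P (- t :: real)) \<longleftrightarrow> (AE t in lborel. P t)"
proof -
  have *: "AE t in lborel. Q (- t :: real)" if ae: "AE t in lborel. Q t" for Q
  proof -
    obtain N where N: "{t \<in> space lborel. \<not> Q t} \<subseteq> N" "emeasure lborel N = 0" "N \<in> sets lborel"
      using ae by (rule AE_E)
    have [measurable]: "N \<in> sets borel" using N by auto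
    have "AE t in lborel. t \<notin> N" by (rule AE_not_in) (use N in auto)
    then have "AE t in lborel. 0 - t \<notin> N" by (rule AE_reflect_shift[rotated]) measurable
    then show ?thesis by eventually_elim (use N(1) in auto)
  qed
  show ?thesis
  proof
    assume "AE t in lborel. P (- t)"
    from *[OF this] show "AE t in lborel. P t" by simp
  qed (rule *)
qed

lemma frac_int_right_reflect: "frac_int_right \<alpha> b \<psi> t = frac_int_left \<alpha> (- b) (\<lambda>s. \<psi> (- s)) (- t)"
  unfolding frac_int_right_def frac_int_left_def
  using set_integral_reflect[of b t "\<lambda>r. (r - t) powr (\<alpha> - 1) * \<psi> r"] by (simp add: minus_diff_commute)

lemma in_frac_image_right_reflect:
  "in_frac_image_right \<alpha> a b g \<longleftrightarrow> in_frac_image_left \<alpha> (- b) (- a) (\<lambda>s. g (- s))"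
proof
  assume "in_frac_image_right \<alpha> a b g"
  then obtain \<psi> where \<psi>: "set_integrable lborel {a..b} \<psi>" "AE t in lborel. t \<in> {a..b} \<longrightarrow> g t = frac_int_right \<alpha> b \<psi> t"
    unfolding in_frac_image_right_def by blast
  show "in_frac_image_left \<alpha> (- b) (- a) (\<lambda>s. g (- s))"
    unfolding in_frac_image_left_def
  proof (intro exI[of _ "\<lambda>s. \<psi> (- s)"] conjI)
    have "AE t in lborel. - t \<in> {a..b} \<longrightarrow> g (- t) = frac_int_right \<alpha> b \<psi> (- t)"
      using AE_reflect_iff[of "\<lambda>t. t \<in> {a..b} \<longrightarrow> g t = frac_int_right \<alpha> b \<psi> t"] \<psi>(2) by simp
    then show "AE t in lborel. t \<in> {- b..- a} \<longrightarrow> g (- t) = frac_int_left \<alpha> (- b) (\<lambda>s. \<psi> (- s)) t"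
      by eventually_elim (auto simp: frac_int_right_reflect)
  qed (use \<psi>(1) in \<open>simp add: set_integrable_reflect\<close>)
next
  assume "in_frac_image_left \<alpha> (- b) (- a) (\<lambda>s. g (- s))"
  then obtain \<psi> where \<psi>: "set_integrable lborel {-b..-a} \<psi>" "AE t in lborel. t \<in> {-b..-a} \<longrightarrow> g (- t) = frac_int_left \<alpha> (- b) \<psi> t"
    unfolding in_frac_image_left_def by blast
  show "in_frac_image_right \<alpha> a b g"
    unfolding in_frac_image_right_def
  proof (intro exI[of _ "\<lambda>s. \<psi> (- s)"] conjI)
    show "set_integrable lborel {a..b} (\<lambda>s. \<psi> (- s))"
      using \<psi>(1) set_integrable_reflect[where f="\<lambda>s. \<psi> (- s)"] by simp
    have "AE t in lborel. - t \<in> {-b..-a} \<longrightarrow> g (- (- t)) = frac_int_left \<alpha> (- b) \<psi> (- t)"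
      using AE_reflect_iff[of "\<lambda>t. t \<in> {-b..-a} \<longrightarrow> g (- t) = frac_int_left \<alpha> (- b) \<psi> t"] \<psi>(2) by blast
    then show "AE t in lborel. t \<in> {a..b} \<longrightarrow> g t = frac_int_right \<alpha> b (\<lambda>s. \<psi> (- s)) t"
      by eventually_elim (auto simp: frac_int_right_reflect)
  qed
qed

lemma zero_ext_reflect: "zero_ext (- b) (- a) (\<lambda>s. f (- s)) r = zero_ext a b f (- r)"
  by (auto simp: zero_ext_def)

lemma frac_deriv_right_trunc_reflect:
  "frac_deriv_right_trunc \<alpha> a b f \<epsilon> t = frac_deriv_left_trunc \<alpha> (- b) (- a) (\<lambda>s. f (- s)) \<epsilon> (- t)"
  unfolding frac_deriv_right_trunc_def frac_deriv_left_trunc_def zero_ext_reflect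
  by (subst interval_integral_reflect) (simp add: add.commute)

lemma L1_limit_reflect:
  assumes "L1_limit (- b) (- a) (\<lambda>\<epsilon> s. F \<epsilon> (- s)) h"
  shows "L1_limit a b F (\<lambda>t. h (- t))"
proof -
  have 1: "set_integrable lborel {a..b} (\<lambda>t. h (- t))" if "set_integrable lborel {- b..- a} h"
    using that set_integrable_reflect[where f="\<lambda>s. h (- s)"] by simp
  have 2: "(LINT s:{-b..-a}|lborel. \<bar>F \<epsilon> (- s) - h s\<bar>) = (LINT t:{a..b}|lborel. \<bar>F \<epsilon> t - h (- t)\<bar>)" for \<epsilon>
    using set_integral_reflect[of b a "\<lambda>t. \<bar>F \<epsilon> t - h (- t)\<bar>"] by simp
  show ?thesis using assms 1 unfolding L1_limit_def 2 set_integrable_reflect by blast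
qed

lemma frac_rep_deriv_right:
  assumes "0 < \<alpha>" "\<alpha> < 1" "a < b" and meas: "zero_ext (- b) (- a) (\<lambda>s. g (- s)) \<in> borel_measurable borel"
    and rep: "frac_rep (- b) (- a) \<alpha> (\<lambda>s. g (- s)) \<psi>"
  shows "set_integrable lborel {a..b} (frac_deriv_right \<alpha> a b g)"
    and "AE t in lborel. t \<in> {a..b} \<longrightarrow> frac_deriv_right \<alpha> a b g t = \<psi> (- t)"
proof -
  note d = frac_repD[OF rep]
  have z: "zero_ext (- b) (- a) \<psi> = \<psi>" using d(3) by (rule zero_ext_idem)
  have si: "set_integrable lborel {-b..-a} \<psi>" using d(1) z by (simp add: zero_ext_integrable_iff[symmetric])
  have "AE t in lborel. t \<in> {-b..-a} \<longrightarrow> g (- t) = frac_int_left \<alpha> (- b) \<psi> t"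
    using d(4) by eventually_elim (simp add: frac_int_left_eq_conv[of _ "- b" "- a"] z)
  moreover have "- b < - a" using assms by simp
  ultimately have "L1_limit (- b) (- a) (frac_deriv_left_trunc \<alpha> (- b) (- a) (\<lambda>s. g (- s))) \<psi>"
    using frac_image_left_L1_limit(2)[OF assms(1,2) _ meas si] by blast
  then have l: "L1_limit a b (frac_deriv_right_trunc \<alpha> a b g) (\<lambda>t. \<psi> (- t))"
    by (intro L1_limit_reflect) (simp add: frac_deriv_right_trunc_reflect)
  then have l': "L1_limit a b (frac_deriv_right_trunc \<alpha> a b g) (frac_deriv_right \<alpha> a b g)"
    unfolding frac_deriv_right_def by (rule someI[of "\<lambda>h. L1_limit a b (frac_deriv_right_trunc \<alpha> a b g) h"])
  show "set_integrable lborel {a..b} (frac_deriv_right \<alpha> a b g)" using l' by (simp add: L1_limit_def)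
  show "AE t in lborel. t \<in> {a..b} \<longrightarrow> frac_deriv_right \<alpha> a b g t = \<psi> (- t)" by (rule L1_limit_unique[OF l' l])
qed

text \<open>The derivatives in the definition of the integral are arbitrary representatives; integrability and
  integral of their product can be computed with any other representatives.\<close>
lemma frac_deriv_product:
  assumes "0 < \<alpha>" "\<alpha> < 1" "a < b"
    and f: "zero_ext a b f \<in> borel_measurable borel" "frac_rep a b \<alpha> f \<phi>"
    and g: "zero_ext (- b) (- a) (\<lambda>s. g (- s)) \<in> borel_measurable borel" "frac_rep (- b) (- a) (1 - \<alpha>) (\<lambda>s. g (- s)) \<psi>"
  shows "set_integrable lborel {a..b} (\<lambda>t. frac_deriv_left \<alpha> a b f t * frac_deriv_right (1 - \<alpha>) a b g t)
      \<longleftrightarrow> integrable lborel (\<lambda>t. \<phi> t * \<psi> (- t))"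
    and "(LINT t:{a..b}|lborel. frac_deriv_left \<alpha> a b f t * frac_deriv_right (1 - \<alpha>) a b g t) = (LBINT t. \<phi> t * \<psi> (- t))"
proof -
  let ?D = "\<lambda>t. frac_deriv_left \<alpha> a b f t * frac_deriv_right (1 - \<alpha>) a b g t"
  note D = frac_rep_deriv[OF assms(1-3) f] 
  note D' = frac_rep_deriv_right[of "1 - \<alpha>", OF _ _ assms(3) g]
  note [measurable] = frac_repD(2)[OF f(2)] frac_repD(2)[OF g(2)]
  have m: "(\<lambda>t. indicator {a..b} t *\<^sub>R ?D t) \<in> borel_measurable borel"
  proof -
    have "(\<lambda>t. (indicator {a..b} t *\<^sub>R frac_deriv_left \<alpha> a b f t) * (indicator {a..b} t *\<^sub>R frac_deriv_right (1 - \<alpha>) a b g t)) \<in> borel_measurable borel"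
      using D(1) D'(1) assms unfolding set_integrable_def
      by (intro borel_measurable_times) (auto dest!: borel_measurable_integrable)
    also have "(\<lambda>t. (indicator {a..b} t *\<^sub>R frac_deriv_left \<alpha> a b f t) * (indicator {a..b} t *\<^sub>R frac_deriv_right (1 - \<alpha>) a b g t)) = (\<lambda>t. indicator {a..b} t *\<^sub>R ?D t)"
      by (auto simp: indicator_def)
    finally show ?thesis .
  qed
  have "AE t in lborel. t \<in> {a..b} \<longrightarrow> frac_deriv_right (1 - \<alpha>) a b g t = \<psi> (- t)"
    by (rule D'(2)) (use assms in auto)
  with D(2) have ae: "AE t in lborel. indicator {a..b} t *\<^sub>R ?D t = \<phi> t * \<psi> (- t)"
  proof eventually_elim
    case (elim t)
    then show ?case using frac_repD(3)[OF f(2), of t] by (cases "t \<in> {a..b}") auto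
  qed
  show "set_integrable lborel {a..b} ?D \<longleftrightarrow> integrable lborel (\<lambda>t. \<phi> t * \<psi> (- t))"
    unfolding set_integrable_def by (rule integrable_cong_AE) (use m ae in auto)
  show "(LINT t:{a..b}|lborel. ?D t) = (LBINT t. \<phi> t * \<psi> (- t))"
    unfolding set_lebesgue_integral_def by (rule integral_cong_AE) (use m ae in auto)
qed

text \<open>Existence and uniqueness of the value: the order \<open>\<alpha>0\<close> is admissible, and by \<open>frac_pairing_unique\<close>
  every admissible order gives the same number.\<close>
theorem frac_integral_eq:
  fixes x :: "real \<Rightarrow> real" and b :: real
  defines "g \<equiv> minus_left_limit b x"
  assumes ab: "a < b" and \<alpha>01: "0 < \<alpha>0" "\<alpha>0 < \<alpha>1" "\<alpha>1 < 1"
    and f: "zero_ext a b f \<in> borel_measurable borel" "frac_rep a b \<alpha>1 f \<phi>1" "frac_rep a b \<alpha>0 f \<phi>0"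
    and g: "zero_ext (- b) (- a) (\<lambda>s. g (- s)) \<in> borel_measurable borel"
      "frac_rep (- b) (- a) (1 - \<alpha>0) (\<lambda>s. g (- s)) \<psi>0" "\<And>t. \<bar>\<psi>0 t\<bar> \<le> B"
  shows "frac_integrable f x a b" "frac_integral f x a b = - (LBINT t. \<phi>0 t * \<psi>0 (- t))"
proof -
  let ?I = "- (LBINT t. \<phi>0 t * \<psi>0 (- t))"
  note [measurable] = frac_repD(2)[OF f(3)] frac_repD(2)[OF g(2)]
  have i0: "integrable lborel (\<lambda>t. \<phi>0 t * \<psi>0 (- t))"
  proof (rule Bochner_Integration.integrable_bound[of _ "\<lambda>t. \<phi>0 t * B"])
    show "integrable lborel (\<lambda>t. \<phi>0 t * B)" using frac_repD(1)[OF f(3)] by simp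
    show "AE t in lborel. norm (\<phi>0 t * \<psi>0 (- t)) \<le> norm (\<phi>0 t * B)"
      by (intro AE_I2) (simp add: abs_mult mult_left_mono[OF order_trans[OF g(3) abs_ge_self]])
  qed measurable
  have \<alpha>0: "0 < \<alpha>0" "\<alpha>0 < 1" using \<alpha>01 by auto
  have at: "frac_integrable_at \<alpha>0 f x a b"
    unfolding frac_integrable_at_def g_def[symmetric] in_frac_image_right_reflect in_frac_image_left_iff
    using f(3) g(2) i0 frac_deriv_product(1)[OF \<alpha>0 ab f(1,3) g(1,2)] by blast
  then show "frac_integrable f x a b" unfolding frac_integrable_def using \<alpha>0 by auto
  show "frac_integral f x a b = ?I"
    unfolding frac_integral_def
  proof (rule the_equality)
    show "has_frac_integral f x a b ?I"
      unfolding has_frac_integral_def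
      using at \<alpha>0 frac_deriv_product(2)[OF \<alpha>0 ab f(1,3) g(1,2)] unfolding g_def by (intro bexI[of _ \<alpha>0]) auto
    fix I assume "has_frac_integral f x a b I"
    then obtain \<alpha> where \<alpha>: "0 < \<alpha>" "\<alpha> < 1" "frac_integrable_at \<alpha> f x a b"
      "I = - (LINT t:{a..b}|lborel. frac_deriv_left \<alpha> a b f t * frac_deriv_right (1 - \<alpha>) a b g t)"
      unfolding has_frac_integral_def g_def by auto
    then obtain F \<psi> where F: "frac_rep a b \<alpha> f F" and \<psi>: "frac_rep (- b) (- a) (1 - \<alpha>) (\<lambda>s. g (- s)) \<psi>"
      and i: "set_integrable lborel {a..b} (\<lambda>t. frac_deriv_left \<alpha> a b f t * frac_deriv_right (1 - \<alpha>) a b g t)"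
      unfolding frac_integrable_at_def g_def[symmetric] in_frac_image_right_reflect in_frac_image_left_iff by blast
    have "integrable lborel (\<lambda>t. F t * \<psi> (- t))"
      using i frac_deriv_product(1)[OF \<alpha>(1,2) ab f(1) F g(1) \<psi>] by simp
    from frac_pairing_unique[OF ab \<alpha>01 f g \<alpha>(1,2) F \<psi> this]
    show "I = ?I" using \<alpha>(4) frac_deriv_product(2)[OF \<alpha>(1,2) ab f(1) F g(1) \<psi>] by simp
  qed
qed

section \<open>Hoelder integrators\<close>

lemma tendsto_left_of_holder:
  fixes x :: "real \<Rightarrow> real"
  assumes "a < b" "0 < \<gamma>" and C: "\<And>s. s \<in> {a..b} \<Longrightarrow> \<bar>x s - x b\<bar> \<le> C * \<bar>s - b\<bar> powr \<gamma>"
  shows "(x \<longlongrightarrow> x b) (at_left b)"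
proof -
  have "((\<lambda>s. \<bar>s - b\<bar> powr \<gamma>) \<longlongrightarrow> 0 powr \<gamma>) (at_left b)"
  proof (rule tendsto_powr')
    show "((\<lambda>s. \<bar>s - b\<bar>) \<longlongrightarrow> 0) (at_left b)"
      by (auto intro!: tendsto_eq_intros)
  qed (use assms in auto)
  then have "((\<lambda>s. C * \<bar>s - b\<bar> powr \<gamma>) \<longlongrightarrow> 0) (at_left b)"
    using tendsto_mult_right_zero by fastforce
  then have "((\<lambda>s. x s - x b) \<longlongrightarrow> 0) (at_left b)"
  proof (rule Lim_null_comparison[rotated])
    show "\<forall>\<^sub>F s in at_left b. norm (x s - x b) \<le> C * \<bar>s - b\<bar> powr \<gamma>"
      using C assms(1) by (intro eventually_at_leftI[of a]) auto
  qed
  then show ?thesis by (simp add: LIM_zero_iff)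
qed

lemma continuous_on_of_holder:
  fixes x :: "real \<Rightarrow> 'a::real_normed_vector"
  assumes "0 < \<gamma>" and C: "\<And>s t. s \<in> S \<Longrightarrow> t \<in> S \<Longrightarrow> dist (x s) (x t) \<le> C * \<bar>s - t\<bar> powr \<gamma>"
  shows "continuous_on S x"
  unfolding continuous_on_def
proof
  fix t assume t: "t \<in> S"
  have "((\<lambda>s. \<bar>s - t\<bar> powr \<gamma>) \<longlongrightarrow> 0 powr \<gamma>) (at t within S)"
  proof (rule tendsto_powr')
    show "((\<lambda>s. \<bar>s - t\<bar>) \<longlongrightarrow> 0) (at t within S)"
      by (auto intro!: tendsto_eq_intros)
  qed (use assms in auto)
  then have "((\<lambda>s. C * \<bar>s - t\<bar> powr \<gamma>) \<longlongrightarrow> 0) (at t within S)"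
    using tendsto_mult_right_zero by fastforce
  then have "((\<lambda>s. x s - x t) \<longlongrightarrow> 0) (at t within S)"
  proof (rule Lim_null_comparison[rotated])
    show "\<forall>\<^sub>F s in at t within S. norm (x s - x t) \<le> C * \<bar>s - t\<bar> powr \<gamma>"
      using C[OF _ t] by (auto simp: eventually_at dist_norm intro!: exI[of _ 1])
  qed
  then show "(x \<longlongrightarrow> x t) (at t within S)" by (simp add: LIM_zero_iff)
qed

lemma zero_ext_continuous:
  assumes "continuous_on {a..b} f"
  shows "zero_ext a b f \<in> borel_measurable borel" "integrable lborel (zero_ext a b f)"
proof -
  have "set_integrable lborel {a..b} f"
    unfolding set_integrable_def by (rule borel_integrable_compact) (use assms in auto)
  then show i: "integrable lborel (zero_ext a b f)" by (simp add: zero_ext_integrable_iff)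
  then show "zero_ext a b f \<in> borel_measurable borel" by (auto dest: borel_measurable_integrable)
qed

lemma frac_rep_cong:
  assumes "frac_rep a b \<alpha> f \<phi>" "\<And>t. t \<in> {a..b} \<Longrightarrow> f t = g t"
  shows "frac_rep a b \<alpha> g \<phi>"
proof -
  note d = frac_repD[OF assms(1)]
  have "AE t in lborel. t \<in> {a..b} \<longrightarrow> g t = conv (riesz_kernel (b - a) \<alpha>) \<phi> t"
    using d(4) by eventually_elim (use assms(2) in auto)
  then show ?thesis using d by (auto simp: frac_rep_def)
qed

text \<open>Since \<open>h\<close> vanishes at \<open>a\<close>, its extension by \<open>0\<close> to the left of \<open>a\<close> is still Hoelder continuous, and the
  integral defining the Marchaud derivative converges uniformly in \<open>t\<close>.\<close>
lemma holder_vanishing_left_bounded_deriv: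
  assumes ab: "a < b" and ord: "0 < \<alpha>" "\<alpha> < \<gamma>" "\<gamma> \<le> 1" and C: "0 \<le> C"
    and h: "\<And>s t. s \<in> {a..b} \<Longrightarrow> t \<in> {a..b} \<Longrightarrow> \<bar>h s - h t\<bar> \<le> C * \<bar>s - t\<bar> powr \<gamma>" and h0: "h a = 0"
  shows "\<exists>\<psi> B. frac_rep a b \<alpha> h \<psi> \<and> (\<forall>t. \<bar>\<psi> t\<bar> \<le> B)"
proof -
  let ?h = "zero_ext a b h"
  have cont: "continuous_on {a..b} h"
    by (rule continuous_on_of_holder[of \<gamma> _ _ C]) (use ord h in \<open>auto simp: dist_real_def\<close>)
  note zc[measurable] = zero_ext_continuous(1)[OF cont]
  have osc: "\<bar>?h t - ?h (t - u)\<bar> \<le> C * (min u (b - a)) powr \<gamma>" if "t \<in> {a..b}" "u > 0" for t u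
  proof (cases "t - u \<ge> a")
    case True
    have "min u (b - a) = u" using True that by auto
    then show ?thesis using h[of t "t - u"] True that by (simp add: zero_ext_def)
  next
    case False
    have "\<bar>h t - h a\<bar> \<le> C * \<bar>t - a\<bar> powr \<gamma>" using that by (intro h) auto
    also have "\<dots> \<le> C * (min u (b - a)) powr \<gamma>"
      using False that ord C by (intro mult_left_mono powr_mono2) auto
    finally show ?thesis using False that h0 by (simp add: zero_ext_def)
  qed
  have osc_u: "\<bar>?h t - ?h (t - u)\<bar> \<le> C * u powr \<gamma>" if "t \<in> {a..b}" "u > 0" for t u
  proof -
    have "C * (min u (b - a)) powr \<gamma> \<le> C * u powr \<gamma>"
      using that ab ord C by (intro mult_left_mono powr_mono2) auto
    then show ?thesis using osc[OF that] by linarith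
  qed
  interpret nikolskii a b \<alpha> \<gamma> "C * (b - a)" ?h
  proof
    fix u :: real assume u: "u > 0"
    have "L1_modulus a b ?h u \<le> (\<integral>\<^sup>+t\<in>{a..b}. ennreal (C * u powr \<gamma>) \<partial>lborel)"
      unfolding L1_modulus_def using osc_u u by (intro nn_integral_mono) (auto simp: indicator_def intro!: ennreal_leI)
    also have "\<dots> = ennreal (C * u powr \<gamma>) * ennreal (b - a)"
      using ab by (subst nn_integral_cmult_indicator) auto
    also have "\<dots> = ennreal (C * (b - a) * u powr \<gamma>)"
      using ab C by (simp add: mult_ac flip: ennreal_mult)
    finally show "L1_modulus a b ?h u \<le> ennreal (C * (b - a) * u powr \<gamma>)" .
  qed (use ab ord C zero_ext_continuous(2)[OF cont] in \<open>auto simp: zero_ext_def\<close>)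
  define K where "K = C * 1 powr (\<gamma> - \<alpha>) / (\<gamma> - \<alpha>) + (C * (b - a) powr \<gamma>) * 1 powr (-\<alpha>) / \<alpha>"
  have K: "K \<ge> 0" unfolding K_def using C ord ab by (intro add_nonneg_nonneg divide_nonneg_pos mult_nonneg_nonneg) auto
  have G: "Gamma (1 - \<alpha>) > 0" using ord by (intro Gamma_real_pos) auto
  have mb: "\<bar>marchaud \<alpha> ?h t\<bar> \<le> \<alpha> / Gamma (1 - \<alpha>) * K" if t: "t \<in> {a..b}" for t
  proof -
    \<comment> \<open>At a fixed \<open>t\<close> the increments of the path play the role of the modulus in the splitting lemma.\<close>
    define \<omega> where "\<omega> u = ennreal (if 0 < u then \<bar>?h t - ?h (t - u)\<bar> else 0)" for u
    have "ennreal \<bar>LBINT u. (?h t - ?h (t - u)) * singular_kernel \<alpha> u\<bar> \<le> L1norm (\<lambda>u. (?h t - ?h (t - u)) * singular_kernel \<alpha> u)"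
      by (rule ennreal_abs_integral_le)
    also have "\<dots> = (\<integral>\<^sup>+u. ennreal (singular_kernel \<alpha> u) * \<omega> u \<partial>lborel)"
      by (intro nn_integral_cong) (auto simp: \<omega>_def singular_kernel_def abs_mult mult.commute simp flip: ennreal_mult)
    also have "\<dots> \<le> ennreal K"
      unfolding K_def
    proof (rule singular_kernel_L1_modulus_split)
      show "\<omega> u \<le> ennreal (C * u powr \<gamma>)" if "u > 0" for u
        using osc_u[OF t that] that by (auto simp: \<omega>_def intro!: ennreal_leI)
      show "\<omega> u \<le> ennreal (C * (b - a) powr \<gamma>)" for u
      proof (cases "u > 0")
        case True
        have "C * (min u (b - a)) powr \<gamma> \<le> C * (b - a) powr \<gamma>"
          using True ab ord C by (intro mult_left_mono powr_mono2) auto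
        then show ?thesis using osc[OF t True] True by (auto simp: \<omega>_def intro!: ennreal_leI)
      qed (simp add: \<omega>_def)
      show "\<omega> \<in> borel_measurable borel" unfolding \<omega>_def by measurable
    qed (use ord C in auto)
    finally have "\<bar>LBINT u. (?h t - ?h (t - u)) * singular_kernel \<alpha> u\<bar> \<le> K" using K by (simp add: ennreal_le_iff)
    then show ?thesis unfolding marchaud_def using ord G by (simp add: abs_mult divide_right_mono)
  qed
  show ?thesis
  proof (intro exI conjI allI)
    show "frac_rep a b \<alpha> h (zero_ext a b (marchaud \<alpha> ?h))"
      by (rule frac_rep_cong[OF frac_rep_marchaud]) (simp add: zero_ext_def)
    show "\<bar>zero_ext a b (marchaud \<alpha> ?h) t\<bar> \<le> \<alpha> / Gamma (1 - \<alpha>) * K" for t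
      using mb[of t] K G ord by (auto simp: zero_ext_def)
  qed
qed

text \<open>Subtracting \<open>x b\<close> makes the reflected path vanish at the left end point \<open>-b\<close>.\<close>
lemma holder_integrator:
  fixes x :: "real \<Rightarrow> real"
  defines "g \<equiv> \<lambda>b. minus_left_limit b x"
  assumes x: "holder_on \<gamma> {0..T} x" and \<gamma>: "0 < \<alpha>" "\<alpha> < \<gamma>" "\<gamma> \<le> 1" and ab: "0 \<le> a" "a < b" "b \<le> T"
  shows "zero_ext (- b) (- a) (\<lambda>s. g b (- s)) \<in> borel_measurable borel"
    and "\<exists>\<psi> B. frac_rep (- b) (- a) \<alpha> (\<lambda>s. g b (- s)) \<psi> \<and> (\<forall>t. \<bar>\<psi> t\<bar> \<le> B)"
proof -
  obtain C0 where C0: "\<And>s t. s \<in> {0..T} \<Longrightarrow> t \<in> {0..T} \<Longrightarrow> \<bar>x s - x t\<bar> \<le> C0 * \<bar>s - t\<bar> powr \<gamma>"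
    using x unfolding holder_on_def dist_real_def by blast
  define C where "C = \<bar>C0\<bar>"
  have C: "\<bar>x s - x t\<bar> \<le> C * \<bar>s - t\<bar> powr \<gamma>" if "s \<in> {0..T}" "t \<in> {0..T}" for s t
  proof -
    have "C0 * \<bar>s - t\<bar> powr \<gamma> \<le> C * \<bar>s - t\<bar> powr \<gamma>" by (intro mult_right_mono) (auto simp: C_def)
    then show ?thesis using C0[OF that] by linarith
  qed
  have "(x \<longlongrightarrow> x b) (at_left b)"
  proof (rule tendsto_left_of_holder[of a b \<gamma> x C])
    show "\<bar>x s - x b\<bar> \<le> C * \<bar>s - b\<bar> powr \<gamma>" if "s \<in> {a..b}" for s
      by (rule C) (use that ab in auto)
  qed (use ab \<gamma> in auto)
  then have "Lim (at_left b) x = x b" by (intro tendsto_Lim) auto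
  then have g: "g b r = x r - x b" for r by (simp add: g_def minus_left_limit_def)
  have h: "\<bar>g b (- s) - g b (- t)\<bar> \<le> C * \<bar>s - t\<bar> powr \<gamma>" if "s \<in> {-b..-a}" "t \<in> {-b..-a}" for s t
    using C[of "- s" "- t"] that ab by (simp add: g abs_minus_commute)
  have "continuous_on {-b..-a} (\<lambda>s. g b (- s))"
    by (rule continuous_on_of_holder[of \<gamma> _ _ C]) (use \<gamma> h in \<open>auto simp: dist_real_def\<close>)
  then show "zero_ext (- b) (- a) (\<lambda>s. g b (- s)) \<in> borel_measurable borel" by (rule zero_ext_continuous)
  show "\<exists>\<psi> B. frac_rep (- b) (- a) \<alpha> (\<lambda>s. g b (- s)) \<psi> \<and> (\<forall>t. \<bar>\<psi> t\<bar> \<le> B)"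
    by (rule holder_vanishing_left_bounded_deriv[of _ _ _ \<gamma> C]) (use h \<gamma> ab in \<open>auto simp: C_def g\<close>)
qed

section \<open>Averages over a uniform partition\<close>

abbreviation cell :: "real \<Rightarrow> real \<Rightarrow> nat \<Rightarrow> nat \<Rightarrow> real set" where
  "cell a b n i \<equiv> {part_pt a b n (i - 1)<..part_pt a b n i}"

definition step_mean :: "real \<Rightarrow> real \<Rightarrow> nat \<Rightarrow> (real \<Rightarrow> real) \<Rightarrow> real \<Rightarrow> real" where
  "step_mean a b n f s = (\<Sum>i=2..n. indicator (cell a b n i) s *
     (1 / mesh a b n * (LINT r:{part_pt a b n (i - 1)..part_pt a b n i}|lborel. f r)))"

lemma emeasure_Ioc_finite: "emeasure lborel {x<..y::real} < \<infinity>"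
  by (cases "x \<le> y") auto

lemma emeasure_Icc_finite: "emeasure lborel {x..y::real} < \<infinity>"
  by (cases "x \<le> y") auto

context
  fixes a b :: real and n :: nat
  assumes ab: "a < b" and n: "2 \<le> n"
begin

lemma mesh_pos: "0 < mesh a b n"
  using ab n by (simp add: mesh_def)

lemma part_pt_step: "1 \<le> i \<Longrightarrow> part_pt a b n i = part_pt a b n (i - 1) + mesh a b n"
  by (simp add: part_pt_def of_nat_diff algebra_simps)

lemma part_pt_mono: "i \<le> j \<Longrightarrow> part_pt a b n i \<le> part_pt a b n j"
  using mesh_pos by (simp add: part_pt_def)

lemma part_pt_first: "part_pt a b n 1 = a" and part_pt_last: "part_pt a b n n = b"
  using n by (auto simp: part_pt_def mesh_def field_simps)

lemma cell_subset:
  assumes "i \<in> {2..n}"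
  shows "a \<le> part_pt a b n (i - 1)" "part_pt a b n i \<le> b"
proof -
  have "1 \<le> i - 1" "i \<le> n" using assms by auto
  then show "a \<le> part_pt a b n (i - 1)" "part_pt a b n i \<le> b"
    using part_pt_mono part_pt_first part_pt_last by metis+
qed

lemma cell_exists:
  assumes t: "t \<in> {a<..b}"
  obtains i where "i \<in> {2..n}" "t \<in> cell a b n i"
proof -
  define q where "q = (t - a) / mesh a b n"
  have q: "0 < q" "q \<le> real n - 1"
  proof -
    show "0 < q" using t mesh_pos by (simp add: q_def)
    have "q \<le> (b - a) / mesh a b n" using t mesh_pos by (simp add: q_def divide_right_mono)
    also have "(b - a) / mesh a b n = real n - 1" using ab n by (simp add: mesh_def)
    finally show "q \<le> real n - 1" .
  qed
  \<comment> \<open>The ceiling matches cells that are open on the left, and cells are numbered from \<open>2\<close>.\<close>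
  define k where "k = nat \<lceil>q\<rceil>"
  have k: "real k - 1 < q" "q \<le> real k" "1 \<le> k"
    using q(1) by (simp_all add: k_def) linarith+
  have "k \<le> n - 1" using q(2) k n by linarith
  have ta: "t = a + q * mesh a b n" using mesh_pos by (simp add: q_def)
  show ?thesis
  proof (rule that[of "k + 1"])
    show "k + 1 \<in> {2..n}" using \<open>k \<le> n - 1\<close> k n by auto
    show "t \<in> {part_pt a b n (k + 1 - 1)<..part_pt a b n (k + 1)}"
      using k mesh_pos by (simp add: ta part_pt_def)
  qed
qed

lemma cell_indicator:
  assumes "t \<in> cell a b n i"
  shows "indicator (cell a b n j) t = (if j = i then 1 else 0 :: 'c::zero_neq_one)"
proof -
  have "t \<notin> cell a b n j" if "j < i"
  proof -
    have "j \<le> i - 1" using that by simp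
    from part_pt_mono[OF this] show ?thesis using assms by auto
  qed
  moreover have "t \<notin> cell a b n j" if "i < j"
  proof -
    have "i \<le> j - 1" using that by simp
    from part_pt_mono[OF this] show ?thesis using assms by auto
  qed
  ultimately show ?thesis using assms by (cases i j rule: linorder_cases) auto
qed

lemma sum_cell_indicator_le: "(\<Sum>i=2..n. indicator (cell a b n i) t) \<le> (indicator {a..b} t :: ennreal)"
proof (cases "\<exists>i\<in>{2..n}. t \<in> cell a b n i")
  case True
  then obtain i where i: "i \<in> {2..n}" "t \<in> cell a b n i" by blast
  have "t \<in> {a..b}"
    using i(2) cell_subset[OF i(1)] by auto
  moreover have "(\<Sum>j=2..n. indicator (cell a b n j) t) = (\<Sum>j=2..n. if j = i then 1 else 0 :: ennreal)"
    by (intro sum.cong refl cell_indicator[OF i(2)])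
  ultimately show ?thesis using i by simp
next
  case False
  then have "(\<Sum>i=2..n. indicator (cell a b n i) t) = (0 :: ennreal)"
    by (intro sum.neutral) (auto simp: indicator_def)
  then show ?thesis by simp
qed

text \<open>The extension by \<open>0\<close> makes the formula meaningful also for the cell with index \<open>1\<close>, which ends at \<open>a\<close>. Its
  mean is \<open>0\<close>, the value of the step function before \<open>a\<close>, so the jump at \<open>a\<close> needs no special
  treatment.\<close>
definition cell_mean :: "(real \<Rightarrow> real) \<Rightarrow> nat \<Rightarrow> real" where
  "cell_mean f i = 1 / mesh a b n * (LBINT r. indicator {part_pt a b n (i - 1)..part_pt a b n i} r * zero_ext a b f r)"

lemma step_mean_cell:
  assumes i: "i \<in> {2..n}" and t: "t \<in> cell a b n i"
  shows "step_mean a b n f t = cell_mean f i"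
proof -
  have "step_mean a b n f t = (\<Sum>j=2..n. if j = i then 1 / mesh a b n * (LINT r:{part_pt a b n (i - 1)..part_pt a b n i}|lborel. f r) else 0)"
    unfolding step_mean_def by (intro sum.cong refl, unfold cell_indicator[OF t]) simp
  also have "\<dots> = 1 / mesh a b n * (LINT r:{part_pt a b n (i - 1)..part_pt a b n i}|lborel. f r)"
    using i by simp
  also have "(LINT r:{part_pt a b n (i - 1)..part_pt a b n i}|lborel. f r)
      = (LBINT r. indicator {part_pt a b n (i - 1)..part_pt a b n i} r * zero_ext a b f r)"
    unfolding set_lebesgue_integral_def
    using cell_subset[OF i]
    by (intro Bochner_Integration.integral_cong refl) (auto simp: indicator_def zero_ext_def)
  finally show ?thesis by (simp add: cell_mean_def)
qed

lemma step_mean_outside: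
  assumes "t \<notin> {a<..b}" shows "step_mean a b n f t = 0"
  unfolding step_mean_def
proof (intro sum.neutral ballI)
  fix i assume i: "i \<in> {2..n}"
  have "t \<notin> cell a b n i"
    using assms cell_subset[OF i] by auto
  then show "indicator (cell a b n i) t *
    (1 / mesh a b n * (LINT r:{part_pt a b n (i - 1)..part_pt a b n i}|lborel. f r)) = 0" by simp
qed

lemma cell_mean_first: "cell_mean f 1 = 0"
proof -
  have "(LBINT r. indicator {part_pt a b n (1 - 1)..part_pt a b n 1} r * zero_ext a b f r) = (LBINT r. indicator {a} r * f a)"
    unfolding part_pt_first using ab by (intro Bochner_Integration.integral_cong) 
      (auto simp: indicator_def zero_ext_def part_pt_def mesh_pos less_imp_le)
  then show ?thesis by (simp add: cell_mean_def)
qed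

lemma step_mean_measurable [measurable]: "step_mean a b n f \<in> borel_measurable borel"
  unfolding step_mean_def by measurable

lemma step_mean_integrable: "integrable lborel (step_mean a b n f)"
  unfolding step_mean_def
  by (intro Bochner_Integration.integrable_sum integrable_mult_left integrable_real_indicator)
     (simp, rule emeasure_Ioc_finite)

text \<open>A jump is the mean over the cell of the increment of \<open>f\<close> across one mesh width.\<close>
lemma cell_mean_diff:
  assumes i: "i \<in> {2..n}" and f: "integrable lborel (zero_ext a b f)"
  shows "ennreal \<bar>cell_mean f i - cell_mean f (i - 1)\<bar> \<le> ennreal (1 / mesh a b n) *
    (\<integral>\<^sup>+t. ennreal \<bar>zero_ext a b f t - zero_ext a b f (t - mesh a b n)\<bar> * indicator (cell a b n i) t \<partial>lborel)"
proof -
  let ?f = "zero_ext a b f" and ?\<Delta> = "mesh a b n" and ?c = "{part_pt a b n (i - 1)..part_pt a b n i}"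
  have i1: "1 \<le> i" "1 \<le> i - 1" using i by auto
  have fs: "integrable lborel (\<lambda>t. ?f (t - ?\<Delta>))"
    using lborel_integrable_real_affine[OF f, of 1 "- ?\<Delta>"] by simp
  have mi: "integrable lborel (\<lambda>t. indicator ?c t * g t)" if "integrable lborel g" for g :: "real \<Rightarrow> real"
    using integrable_mult_indicator[OF _ that, of ?c] by simp
  have "(LBINT r. indicator {part_pt a b n (i - 1 - 1)..part_pt a b n (i - 1)} r * ?f r)
     = (LBINT t. indicator {part_pt a b n (i - 1 - 1)..part_pt a b n (i - 1)} (- ?\<Delta> + 1 * t) * ?f (- ?\<Delta> + 1 * t))"
    by (subst lborel_integral_real_affine[of 1 _ "- ?\<Delta>"]) auto
  also have "\<dots> = (LBINT t. indicator ?c t * ?f (t - ?\<Delta>))"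
    using part_pt_step[OF i1(1)] part_pt_step[OF i1(2)]
    by (intro Bochner_Integration.integral_cong refl) (auto simp: indicator_def)
  finally have "cell_mean f i - cell_mean f (i - 1) = 1 / ?\<Delta> * (LBINT t. indicator ?c t * (?f t - ?f (t - ?\<Delta>)))"
    unfolding cell_mean_def using mi[OF f] mi[OF fs] by (simp add: right_diff_distrib)
  then have "ennreal \<bar>cell_mean f i - cell_mean f (i - 1)\<bar> = ennreal (1 / ?\<Delta>) * ennreal \<bar>LBINT t. indicator ?c t * (?f t - ?f (t - ?\<Delta>))\<bar>"
    using mesh_pos by (simp add: abs_mult flip: ennreal_mult)
  also have "\<dots> \<le> ennreal (1 / ?\<Delta>) * L1norm (\<lambda>t. indicator ?c t * (?f t - ?f (t - ?\<Delta>)))"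
    by (intro mult_left_mono ennreal_abs_integral_le) auto
  also have "L1norm (\<lambda>t. indicator ?c t * (?f t - ?f (t - ?\<Delta>)))
    = (\<integral>\<^sup>+t. ennreal \<bar>?f t - ?f (t - ?\<Delta>)\<bar> * indicator (cell a b n i) t \<partial>lborel)"
  proof (rule nn_integral_cong_AE)
    have "AE t in lborel. t \<noteq> part_pt a b n (i - 1)" by (rule AE_lborel_singleton)
    then show "AE t in lborel. ennreal \<bar>indicator ?c t * (?f t - ?f (t - ?\<Delta>))\<bar>
      = ennreal \<bar>?f t - ?f (t - ?\<Delta>)\<bar> * indicator (cell a b n i) t"
      by eventually_elim (auto simp: indicator_def)
  qed
  finally show ?thesis .
qed

text \<open>A shift by at most one mesh width moves a point at most into the preceding cell, and only if the point
  lies within \<open>u\<close> of the left end of its cell.\<close>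
lemma step_mean_increment:
  assumes u: "0 < u" "u \<le> mesh a b n"
  shows "ennreal \<bar>step_mean a b n f t - step_mean a b n f (t - u)\<bar> * indicator {a..b} t
    \<le> (\<Sum>i=2..n. ennreal \<bar>cell_mean f i - cell_mean f (i - 1)\<bar> * indicator {part_pt a b n (i - 1)<..part_pt a b n (i - 1) + u} t)"
proof (cases "t \<in> {a<..b}")
  case False
  then have "step_mean a b n f t = 0" "step_mean a b n f (t - u) = 0 \<or> t \<notin> {a..b}"
    using u by (auto intro!: step_mean_outside)
  then show ?thesis by auto
next
  case True
  then obtain i where i: "i \<in> {2..n}" "t \<in> cell a b n i" by (rule cell_exists)
  show ?thesis
  proof (cases "part_pt a b n (i - 1) < t - u")
    case True
    then have "t - u \<in> cell a b n i" using i u by auto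
    then show ?thesis using i step_mean_cell[of i t f] step_mean_cell[of i "t - u" f] by simp
  next
    case False
    have "step_mean a b n f (t - u) = cell_mean f (i - 1)"
    proof (cases "i = 2")
      case True
      then have "t - u \<notin> {a<..b}" using False part_pt_first by auto
      then show ?thesis using True step_mean_outside cell_mean_first by simp
    next
      case i2: False
      then have "i - 1 \<in> {2..n}" using i by auto
      moreover have "t - u \<in> {part_pt a b n (i - 1 - 1)<..part_pt a b n (i - 1)}"
        using False i u part_pt_step[of "i - 1"] i2 by auto
      ultimately show ?thesis by (rule step_mean_cell)
    qed
    then have eq: "\<bar>step_mean a b n f t - step_mean a b n f (t - u)\<bar> = \<bar>cell_mean f i - cell_mean f (i - 1)\<bar>"
      using step_mean_cell[OF i] by simp
    have "ennreal \<bar>cell_mean f i - cell_mean f (i - 1)\<bar> * indicator {part_pt a b n (i - 1)<..part_pt a b n (i - 1) + u} t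
      \<le> (\<Sum>i=2..n. ennreal \<bar>cell_mean f i - cell_mean f (i - 1)\<bar> * indicator {part_pt a b n (i - 1)<..part_pt a b n (i - 1) + u} t)"
      using i(1) by (intro member_le_sum) auto
    then show ?thesis using False i(2) \<open>t \<in> {a<..b}\<close> by (simp add: eq)
  qed
qed

text \<open>Each jump contributes its size times \<open>u\<close>, and by \<open>cell_mean_diff\<close> the jumps together amount to the \<open>L\<^sup>1\<close>
  modulus of \<open>f\<close> at the mesh width.\<close>
lemma step_mean_L1_modulus:
  assumes u: "0 < u" "u \<le> mesh a b n" and f: "integrable lborel (zero_ext a b f)"
  shows "L1_modulus a b (step_mean a b n f) u \<le> ennreal (u / mesh a b n) * L1_modulus a b (zero_ext a b f) (mesh a b n)"
proof -
  let ?f = "zero_ext a b f" and ?\<Delta> = "mesh a b n"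
  let ?J = "\<lambda>i. ennreal \<bar>cell_mean f i - cell_mean f (i - 1)\<bar>"
  let ?c = "\<lambda>i. cell a b n i"
  note [measurable] = integrable_borel[OF f]
  have "L1_modulus a b (step_mean a b n f) u \<le> (\<integral>\<^sup>+t. (\<Sum>i=2..n. ?J i * indicator {part_pt a b n (i - 1)<..part_pt a b n (i - 1) + u} t) \<partial>lborel)"
    unfolding L1_modulus_def by (intro nn_integral_mono step_mean_increment u)
  also have "\<dots> = (\<Sum>i=2..n. ?J i * ennreal u)"
    using u by (subst nn_integral_sum) (auto simp: nn_integral_cmult_indicator)
  also have "\<dots> \<le> (\<Sum>i=2..n. (ennreal (1 / ?\<Delta>) * (\<integral>\<^sup>+t. ennreal \<bar>?f t - ?f (t - ?\<Delta>)\<bar> * indicator (?c i) t \<partial>lborel)) * ennreal u)"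
    by (intro sum_mono mult_right_mono cell_mean_diff f) auto
  also have "\<dots> = ennreal (u / ?\<Delta>) * (\<Sum>i=2..n. (\<integral>\<^sup>+t. ennreal \<bar>?f t - ?f (t - ?\<Delta>)\<bar> * indicator (?c i) t \<partial>lborel))"
  proof -
    have "ennreal (u / ?\<Delta>) = ennreal (1 / ?\<Delta>) * ennreal u" using u mesh_pos by (simp flip: ennreal_mult)
    then show ?thesis by (simp add: sum_distrib_left mult_ac)
  qed
  also have "(\<Sum>i=2..n. (\<integral>\<^sup>+t. ennreal \<bar>?f t - ?f (t - ?\<Delta>)\<bar> * indicator (?c i) t \<partial>lborel))
    = (\<integral>\<^sup>+t. ennreal \<bar>?f t - ?f (t - ?\<Delta>)\<bar> * (\<Sum>i=2..n. indicator (?c i) t) \<partial>lborel)"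
    by (subst nn_integral_sum[symmetric]) (auto simp: sum_distrib_left)
  also have "\<dots> \<le> L1_modulus a b ?f ?\<Delta>"
    unfolding L1_modulus_def by (intro nn_integral_mono mult_left_mono sum_cell_indicator_le) auto
  finally show ?thesis by (simp add: mult_left_mono)
qed

end

section \<open>Convergence of integrals of step averages\<close>

text \<open>A Hoelder condition whose constant is an integrable function of one of the two points. It is stated in
  \<open>ennreal\<close>, so that the weight may be infinite where \<open>f\<close> is only continuous.\<close>
locale weighted_holder =
  fixes a b \<beta> :: real and f :: "real \<Rightarrow> real" and W :: "real \<Rightarrow> ennreal"
  assumes ab: "a < b" and \<beta>: "0 < \<beta>" "\<beta> < 1" and cont: "continuous_on {a..b} f"
    and W_meas [measurable]: "W \<in> borel_measurable borel"
    and W_fin: "(\<integral>\<^sup>+t\<in>{a..b}. W t \<partial>lborel) < \<infinity>"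
    and osc: "\<And>s t. s \<in> {a..b} \<Longrightarrow> t \<in> {a..b} \<Longrightarrow> ennreal \<bar>f t - f s\<bar> \<le> W t * ennreal (\<bar>t - s\<bar> powr \<beta>)"
begin

lemma fz_meas [measurable]: "zero_ext a b f \<in> borel_measurable borel" and fz_int: "integrable lborel (zero_ext a b f)"
  using zero_ext_continuous[OF cont] by auto

text \<open>Where \<open>t - u\<close> lies before \<open>a\<close> the increment is \<open>f t\<close>, and \<open>1 \<le> u powr \<beta> * (t - a) powr (- \<beta>)\<close>. So the
  jump of the extension at \<open>a\<close> only adds the integrable function \<open>B * (t - a) powr (- \<beta>)\<close> to the
  weight; this is where \<open>\<beta> < 1\<close> enters.\<close>
lemma L1_modulus_bound:
  "\<exists>M\<ge>0. (\<integral>\<^sup>+t\<in>{a..b}. W t \<partial>lborel) \<le> ennreal M \<and> (\<forall>u>0. L1_modulus a b (zero_ext a b f) u \<le> ennreal (M * u powr \<beta>))"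
proof -
  obtain w where w: "0 \<le> w" "(\<integral>\<^sup>+t\<in>{a..b}. W t \<partial>lborel) = ennreal w"
    using W_fin by (cases "\<integral>\<^sup>+t\<in>{a..b}. W t \<partial>lborel") auto
  have "bounded (f ` {a..b})" by (intro compact_imp_bounded compact_continuous_image cont) auto
  then obtain B where B: "\<And>t. t \<in> {a..b} \<Longrightarrow> \<bar>f t\<bar> \<le> B"
    unfolding bounded_iff by (metis imageI real_norm_def)
  have B0: "0 \<le> B" using B[of a] ab by auto
  define K where "K = (b - a) powr (1 - \<beta>) / (1 - \<beta>)"
  have K: "0 \<le> K" using \<beta> by (simp add: K_def)
  have powK: "(\<integral>\<^sup>+t. ennreal (indicator {0..b - a} t * t powr (- \<beta>)) \<partial>lborel) = ennreal K"
    using nn_integral_powr_from_0[of "- \<beta>" "b - a"] ab \<beta> by (simp add: K_def add.commute)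
  have powK': "(\<integral>\<^sup>+t. ennreal (indicator {0..b - a} (t - a) * (t - a) powr (- \<beta>)) \<partial>lborel) = ennreal K"
    using nn_integral_shift[of "\<lambda>t. ennreal (indicator {0..b - a} t * t powr (- \<beta>))" a] powK by simp
  show ?thesis
  proof (intro exI[of _ "w + B * K"] conjI allI impI)
    show "0 \<le> w + B * K" using w B0 K by simp
    show "(\<integral>\<^sup>+t\<in>{a..b}. W t \<partial>lborel) \<le> ennreal (w + B * K)" using w B0 K by (simp add: ennreal_leI)
    fix u :: real assume u: "u > 0"
    have "L1_modulus a b (zero_ext a b f) u
      \<le> (\<integral>\<^sup>+t. ennreal (u powr \<beta>) * (W t * indicator {a..b} t + ennreal B * ennreal (indicator {0..b - a} (t - a) * (t - a) powr (- \<beta>))) \<partial>lborel)"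
      unfolding L1_modulus_def
    proof (rule nn_integral_mono_AE)
      have "AE t in lborel. t \<noteq> a" by (rule AE_lborel_singleton)
      then show "AE t in lborel. ennreal \<bar>zero_ext a b f t - zero_ext a b f (t - u)\<bar> * indicator {a..b} t
        \<le> ennreal (u powr \<beta>) * (W t * indicator {a..b} t + ennreal B * ennreal (indicator {0..b - a} (t - a) * (t - a) powr (- \<beta>)))"
      proof eventually_elim
        case (elim t)
        show ?case
        proof (cases "t \<in> {a..b}")
          case True
          show ?thesis
          proof (cases "a \<le> t - u")
            case ge: True
            have "ennreal \<bar>f t - f (t - u)\<bar> \<le> W t * ennreal (\<bar>t - (t - u)\<bar> powr \<beta>)"
              by (rule osc) (use True ge u in auto)
            also have "\<dots> = ennreal (u powr \<beta>) * W t" using u by (simp add: mult.commute)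
            also have "\<dots> \<le> ennreal (u powr \<beta>) * (W t + ennreal B * ennreal (indicator {0..b - a} (t - a) * (t - a) powr (- \<beta>)))"
              by (intro mult_left_mono) auto
            finally show ?thesis using True ge u by (simp add: zero_ext_def)
          next
            case lt: False
            have ta: "0 < t - a" using True elim by auto
            have "1 = (t - a) powr \<beta> * (t - a) powr (- \<beta>)" using ta by (simp add: powr_add[symmetric])
            also have "\<dots> \<le> u powr \<beta> * (t - a) powr (- \<beta>)" using lt ta \<beta> by (intro mult_right_mono powr_mono2) auto
            finally have "\<bar>f t\<bar> \<le> B * (u powr \<beta> * (t - a) powr (- \<beta>))"
              using B[OF True] B0 mult_left_mono[of 1 "u powr \<beta> * (t - a) powr (- \<beta>)" B] by linarith
            then have "ennreal \<bar>f t\<bar> \<le> ennreal (u powr \<beta>) * (ennreal B * ennreal ((t - a) powr (- \<beta>)))"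
              using B0 by (simp add: ennreal_leI mult_ac flip: ennreal_mult)
            also have "\<dots> \<le> ennreal (u powr \<beta>) * (W t + ennreal B * ennreal ((t - a) powr (- \<beta>)))"
              by (intro mult_left_mono) auto
            finally show ?thesis using True lt by (simp add: zero_ext_def)
          qed
        qed simp
      qed
    qed
    also have "\<dots> = ennreal (u powr \<beta>) * (ennreal w + ennreal B * ennreal K)"
      by (subst nn_integral_cmult, measurable, subst nn_integral_add, measurable, subst nn_integral_cmult, measurable)
         (simp only: w powK')
    also have "\<dots> = ennreal ((w + B * K) * u powr \<beta>)"
      using w B0 K by (simp add: mult.commute flip: ennreal_mult ennreal_plus)
    finally show "L1_modulus a b (zero_ext a b f) u \<le> ennreal ((w + B * K) * u powr \<beta>)" .
  qed
qed

lemma step_mean_error_pointwise: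
  assumes n: "2 \<le> n" and t: "t \<in> {a<..b}"
  shows "ennreal \<bar>step_mean a b n f t - f t\<bar> \<le> W t * ennreal (mesh a b n powr \<beta>)"
proof -
  obtain i where i: "i \<in> {2..n}" "t \<in> cell a b n i" by (rule cell_exists[OF ab n t])
  let ?\<Delta> = "mesh a b n" and ?p = "part_pt a b n (i - 1)" and ?q = "part_pt a b n i"
  have \<Delta>: "?\<Delta> > 0" by (rule mesh_pos[OF ab n])
  have pq: "?q = ?p + ?\<Delta>" by (rule part_pt_step[OF ab n]) (use i in auto)
  have sub: "a \<le> ?p" "?q \<le> b"
    using cell_subset[OF ab n i(1)] by auto
  show ?thesis
  proof (cases "W t")
    case top
    have "?\<Delta> powr \<beta> > 0" using \<Delta> by simp
    then have "W t * ennreal (?\<Delta> powr \<beta>) = top" unfolding top by (simp add: ennreal_top_mult)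
    then show ?thesis by simp
  next
    case (real v)
    have le: "\<bar>f r - f t\<bar> \<le> v * ?\<Delta> powr \<beta>" if "r \<in> {?p..?q}" for r
    proof -
      have "ennreal \<bar>f t - f r\<bar> \<le> W t * ennreal (\<bar>t - r\<bar> powr \<beta>)"
        by (rule osc) (use that sub t in auto)
      then have "\<bar>f t - f r\<bar> \<le> v * \<bar>t - r\<bar> powr \<beta>" using real by (simp add: ennreal_le_iff flip: ennreal_mult)
      also have "\<dots> \<le> v * ?\<Delta> powr \<beta>"
        using that i(2) pq \<beta> real by (intro mult_left_mono powr_mono2) auto
      finally show ?thesis by (simp add: abs_minus_commute)
    qed
    have fi: "integrable lborel (\<lambda>r. indicator {?p..?q} r * zero_ext a b f r)"
      using integrable_mult_indicator[OF _ fz_int, of "{?p..?q}"] by simp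
    have ci: "integrable lborel (\<lambda>r. indicator {?p..?q} r * c)" for c :: real
      by (intro integrable_mult_left integrable_real_indicator) (simp, rule emeasure_Icc_finite)
    have c: "(LBINT r. indicator {?p..?q} r * f t) = ?\<Delta> * f t" using pq \<Delta> by simp
    have "step_mean a b n f t - f t = 1 / ?\<Delta> * ((LBINT r. indicator {?p..?q} r * zero_ext a b f r) - (LBINT r. indicator {?p..?q} r * f t))"
      unfolding c step_mean_cell[OF ab n i] cell_mean_def[OF ab n]
      using \<Delta> by (simp add: right_diff_distrib)
    also have "(LBINT r. indicator {?p..?q} r * zero_ext a b f r) - (LBINT r. indicator {?p..?q} r * f t)
      = (LBINT r. indicator {?p..?q} r * zero_ext a b f r - indicator {?p..?q} r * f t)"
      by (rule Bochner_Integration.integral_diff[symmetric, OF fi ci])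
    finally have "\<bar>step_mean a b n f t - f t\<bar> = 1 / ?\<Delta> * \<bar>LBINT r. indicator {?p..?q} r * zero_ext a b f r - indicator {?p..?q} r * f t\<bar>"
      using \<Delta> by (simp add: abs_mult)
    also have "\<dots> \<le> 1 / ?\<Delta> * (LBINT r. indicator {?p..?q} r * (v * ?\<Delta> powr \<beta>))"
    proof (intro mult_left_mono integral_abs_bound_integral)
      show "\<bar>indicator {?p..?q} r * zero_ext a b f r - indicator {?p..?q} r * f t\<bar> \<le> indicator {?p..?q} r * (v * ?\<Delta> powr \<beta>)" for r
        using le[of r] sub by (auto simp: indicator_def zero_ext_def)
    qed (use fi ci \<Delta> in auto)
    also have "\<dots> = v * ?\<Delta> powr \<beta>" using pq \<Delta> by simp
    finally show ?thesis using real by (simp add: ennreal_leI flip: ennreal_mult)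
  qed
qed

context
  fixes M :: real
  assumes M: "0 \<le> M" "(\<integral>\<^sup>+t\<in>{a..b}. W t \<partial>lborel) \<le> ennreal M"
    and mod: "\<And>u. u > 0 \<Longrightarrow> L1_modulus a b (zero_ext a b f) u \<le> ennreal (M * u powr \<beta>)"
begin

lemma step_mean_error_L1:
  assumes n: "2 \<le> n"
  shows "L1norm (\<lambda>t. step_mean a b n f t - zero_ext a b f t) \<le> ennreal (M * mesh a b n powr \<beta>)"
proof -
  have "L1norm (\<lambda>t. step_mean a b n f t - zero_ext a b f t)
    \<le> (\<integral>\<^sup>+t. (W t * indicator {a..b} t) * ennreal (mesh a b n powr \<beta>) \<partial>lborel)"
  proof (rule nn_integral_mono_AE)
    have "AE t in lborel. t \<noteq> a" by (rule AE_lborel_singleton)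
    then show "AE t in lborel. ennreal \<bar>step_mean a b n f t - zero_ext a b f t\<bar> \<le> (W t * indicator {a..b} t) * ennreal (mesh a b n powr \<beta>)"
    proof eventually_elim
      case (elim t)
      show ?case
      proof (cases "t \<in> {a<..b}")
        case True
        then show ?thesis using step_mean_error_pointwise[OF n True] by (simp add: zero_ext_def)
      next
        case False
        then show ?thesis using elim step_mean_outside[OF ab n False] by (auto simp: zero_ext_def)
      qed
    qed
  qed
  also have "\<dots> = (\<integral>\<^sup>+t\<in>{a..b}. W t \<partial>lborel) * ennreal (mesh a b n powr \<beta>)"
    by (rule nn_integral_multc) measurable
  also have "\<dots> \<le> ennreal M * ennreal (mesh a b n powr \<beta>)" by (intro mult_right_mono M) auto
  finally show ?thesis using M by (simp flip: ennreal_mult)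
qed

text \<open>Up to one mesh width, \<open>step_mean_L1_modulus\<close> bounds the modulus of the step function by
  \<open>M * u * mesh powr (\<beta> - 1)\<close>, and \<open>mesh powr (\<beta> - 1) \<le> u powr (\<beta> - 1)\<close>. Beyond it, the \<open>L\<^sup>1\<close> norm of the
  error is at most \<open>M * mesh powr \<beta> \<le> M * u powr \<beta>\<close>.\<close>
lemma step_mean_error_L1_modulus:
  assumes n: "2 \<le> n" and u: "u > 0"
  shows "L1_modulus a b (\<lambda>t. step_mean a b n f t - zero_ext a b f t) u \<le> ennreal (2 * M * u powr \<beta>)"
proof (cases "u \<le> mesh a b n")
  case True
  have \<Delta>: "mesh a b n > 0" by (rule mesh_pos[OF ab n])
  have [measurable]: "step_mean a b n f \<in> borel_measurable borel" by (rule step_mean_measurable[OF ab n])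
  have "L1_modulus a b (step_mean a b n f) u \<le> ennreal (u / mesh a b n) * L1_modulus a b (zero_ext a b f) (mesh a b n)"
    by (rule step_mean_L1_modulus[OF ab n u True fz_int])
  also have "\<dots> \<le> ennreal (u / mesh a b n) * ennreal (M * mesh a b n powr \<beta>)"
    by (intro mult_left_mono mod \<Delta>) auto
  also have "\<dots> = ennreal (u / mesh a b n * (M * mesh a b n powr \<beta>))"
    by (rule ennreal_mult[symmetric]) (use u \<Delta> M in auto)
  also have "\<dots> \<le> ennreal (M * u powr \<beta>)"
  proof (rule ennreal_leI)
    have "u / mesh a b n * mesh a b n powr \<beta> = u * mesh a b n powr (\<beta> - 1)"
      using \<Delta> by (simp add: powr_diff)
    also have "\<dots> \<le> u * u powr (\<beta> - 1)"
      using u True \<beta> by (intro mult_left_mono powr_mono2') auto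
    also have "\<dots> = u powr \<beta>" using u by (simp add: powr_diff)
    finally have "u / mesh a b n * mesh a b n powr \<beta> \<le> u powr \<beta>" .
    then have "M * (u / mesh a b n * mesh a b n powr \<beta>) \<le> M * u powr \<beta>" using M(1) by (rule mult_left_mono)
    then show "u / mesh a b n * (M * mesh a b n powr \<beta>) \<le> M * u powr \<beta>" by (simp add: mult_ac)
  qed
  finally have z: "L1_modulus a b (step_mean a b n f) u \<le> ennreal (M * u powr \<beta>)" .
  have "L1_modulus a b (\<lambda>t. step_mean a b n f t - zero_ext a b f t) u \<le> L1_modulus a b (step_mean a b n f) u + L1_modulus a b (zero_ext a b f) u"
    by (rule L1_modulus_triangle) measurable
  also have "\<dots> \<le> ennreal (M * u powr \<beta>) + ennreal (M * u powr \<beta>)" by (intro add_mono z mod u)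
  also have "\<dots> = ennreal (2 * M * u powr \<beta>)" using M by (simp flip: ennreal_plus)
  finally show ?thesis .
next
  case False
  have \<Delta>: "mesh a b n > 0" by (rule mesh_pos[OF ab n])
  have [measurable]: "step_mean a b n f \<in> borel_measurable borel" by (rule step_mean_measurable[OF ab n])
  have "L1_modulus a b (\<lambda>t. step_mean a b n f t - zero_ext a b f t) u \<le> 2 * L1norm (\<lambda>t. step_mean a b n f t - zero_ext a b f t)"
    by (rule L1_modulus_le_norm) measurable
  also have "\<dots> \<le> 2 * ennreal (M * mesh a b n powr \<beta>)" by (intro mult_left_mono step_mean_error_L1 n) auto
  also have "\<dots> \<le> 2 * ennreal (M * u powr \<beta>)"
    using False \<Delta> \<beta> M by (intro mult_left_mono ennreal_leI powr_mono2) auto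
  also have "\<dots> = ennreal (2 * (M * u powr \<beta>))" using M by (subst ennreal_mult) auto
  finally show ?thesis by (simp add: mult.assoc)
qed

end

text \<open>The integrals are pairings of derivatives of order \<open>\<alpha>0\<close> with one bounded function, and the error
  \<open>step_mean - f\<close> satisfies the hypotheses of \<open>singular_kernel_L1_modulus_tendsto_0\<close>.\<close>
theorem frac_integral_step_mean_tendsto:
  fixes x :: "real \<Rightarrow> real"
  assumes x: "holder_on \<gamma> {0..T} x" and \<gamma>: "0 < \<gamma>" "\<gamma> < 1" "1 - \<gamma> < \<beta>" and T: "0 \<le> a" "b \<le> T"
  shows "\<And>n. 2 \<le> n \<Longrightarrow> frac_integrable (step_mean a b n f) x a b"
    and "frac_integrable f x a b"
    and "(\<lambda>n. frac_integral (step_mean a b n f) x a b) \<longlonglongrightarrow> frac_integral f x a b"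
proof -
  obtain M where M: "0 \<le> M" "(\<integral>\<^sup>+t\<in>{a..b}. W t \<partial>lborel) \<le> ennreal M"
    and mod: "\<And>u. u > 0 \<Longrightarrow> L1_modulus a b (zero_ext a b f) u \<le> ennreal (M * u powr \<beta>)"
    using L1_modulus_bound by blast
  \<comment> \<open>Two orders strictly between \<open>1 - \<gamma>\<close> and \<open>\<beta>\<close>, as required by \<open>frac_integral_eq\<close>.\<close>
  define \<alpha>0 \<alpha>1 where "\<alpha>0 = (2 * (1 - \<gamma>) + \<beta>) / 3" and "\<alpha>1 = ((1 - \<gamma>) + 2 * \<beta>) / 3"
  have \<alpha>: "1 - \<gamma> < \<alpha>0" "\<alpha>0 < \<alpha>1" "\<alpha>1 < \<beta>" "0 < \<alpha>0" "\<alpha>0 < 1" "\<alpha>1 < 1" "0 < \<alpha>1" "\<alpha>0 < \<beta>"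
    using \<gamma> \<beta> by (auto simp: \<alpha>0_def \<alpha>1_def)
  note g = holder_integrator[OF x, of "1 - \<alpha>0" a b, OF _ _ _ T(1) ab T(2)]
  have gm: "zero_ext (- b) (- a) (\<lambda>s. minus_left_limit b x (- s)) \<in> borel_measurable borel"
    by (rule g(1)) (use \<alpha> \<gamma> in auto)
  obtain \<psi> B where \<psi>: "frac_rep (- b) (- a) (1 - \<alpha>0) (\<lambda>s. minus_left_limit b x (- s)) \<psi>" "\<And>t. \<bar>\<psi> t\<bar> \<le> B"
    using g(2) \<alpha> \<gamma> by auto
  have [measurable]: "\<psi> \<in> borel_measurable borel" using frac_repD(2)[OF \<psi>(1)] .
  let ?f = "zero_ext a b f"
  let ?z = "\<lambda>n. step_mean a b n f"
  interpret f0: nikolskii a b \<alpha>0 \<beta> M ?f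
    by standard (use ab \<alpha> M mod fz_int in \<open>auto simp: zero_ext_def\<close>)
  interpret f1: nikolskii a b \<alpha>1 \<beta> M ?f
    by standard (use ab \<alpha> M mod fz_int in \<open>auto simp: zero_ext_def\<close>)
  have zmod: "L1_modulus a b (?z n) u \<le> ennreal (3 * M * u powr \<beta>)" if n: "2 \<le> n" and u: "u > 0" for n u
  proof -
    have [measurable]: "?z n \<in> borel_measurable borel" by (rule step_mean_measurable[OF ab n])
    have eq: "?z n = (\<lambda>t. (?z n t - ?f t) - (- ?f t))" by (simp add: fun_eq_iff)
    have neg: "L1_modulus a b (\<lambda>t. - ?f t) u = L1_modulus a b ?f u"
      unfolding L1_modulus_def by (intro nn_integral_cong) (simp add: abs_minus_commute)
    have "L1_modulus a b (?z n) u \<le> L1_modulus a b (\<lambda>t. ?z n t - ?f t) u + L1_modulus a b (\<lambda>t. - ?f t) u"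
      by (subst eq, rule L1_modulus_triangle) measurable
    also have "\<dots> \<le> ennreal (2 * M * u powr \<beta>) + ennreal (M * u powr \<beta>)"
      unfolding neg by (intro add_mono step_mean_error_L1_modulus[OF M mod n u] mod u)
    also have "\<dots> = ennreal (3 * M * u powr \<beta>)" using M by (simp flip: ennreal_plus)
    finally show ?thesis .
  qed
  have nz: "nikolskii a b \<alpha> \<beta> (3 * M) (?z n)" if n: "2 \<le> n" and "0 < \<alpha>" "\<alpha> < 1" "\<alpha> < \<beta>" for n \<alpha>
    by standard (use that ab M zmod[OF n] step_mean_integrable[OF ab n] step_mean_outside[OF ab n] in auto)
  have zz: "zero_ext a b (?z n) = ?z n" if "2 \<le> n" for n
    using step_mean_outside[OF ab that] by (auto simp: zero_ext_def fun_eq_iff)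
  have zm: "zero_ext a b (?z n) \<in> borel_measurable borel" if "2 \<le> n" for n
    unfolding zz[OF that] by (rule step_mean_measurable[OF ab that])
  define \<phi> where "\<phi> = zero_ext a b (marchaud \<alpha>0 ?f)"
  define \<phi>n where "\<phi>n n = zero_ext a b (marchaud \<alpha>0 (?z n))" for n
  have repf0: "frac_rep a b \<alpha>0 f \<phi>"
    unfolding \<phi>_def by (rule frac_rep_cong[OF f0.frac_rep_marchaud]) (simp add: zero_ext_def)
  have repf1: "frac_rep a b \<alpha>1 f (zero_ext a b (marchaud \<alpha>1 ?f))"
    by (rule frac_rep_cong[OF f1.frac_rep_marchaud]) (simp add: zero_ext_def)
  have repz0: "frac_rep a b \<alpha>0 (?z n) (\<phi>n n)" if "2 \<le> n" for n
    unfolding \<phi>n_def by (rule nikolskii.frac_rep_marchaud[OF nz]) (use that \<alpha> in auto)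
  have repz1: "frac_rep a b \<alpha>1 (?z n) (zero_ext a b (marchaud \<alpha>1 (?z n)))" if "2 \<le> n" for n
    by (rule nikolskii.frac_rep_marchaud[OF nz]) (use that \<alpha> in auto)
  note If = frac_integral_eq[OF ab \<alpha>(4,2,6) fz_meas repf1 repf0 gm \<psi>]
  note Iz = frac_integral_eq[OF ab \<alpha>(4,2,6) zm repz1 repz0 gm \<psi>]
  show "frac_integrable (?z n) x a b" if "2 \<le> n" for n by (rule Iz(1)[OF that that that])
  show "frac_integrable f x a b" by (rule If(1))
  have mesh0: "(\<lambda>n. mesh a b (n + 2)) \<longlonglongrightarrow> 0"
  proof -
    have "(\<lambda>n. (b - a) * (1 / real (Suc n))) \<longlonglongrightarrow> (b - a) * 0"
      by (intro tendsto_mult tendsto_const LIMSEQ_Suc[OF lim_1_over_n])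
    then show ?thesis by (simp add: mesh_def add.commute)
  qed
  have err: "(\<lambda>n. L1norm (\<lambda>t. ?z (n + 2) t - ?f t)) \<longlonglongrightarrow> 0"
  proof (rule LIMSEQ_zero_le)
    have "(\<lambda>n. mesh a b (n + 2) powr \<beta>) \<longlonglongrightarrow> 0 powr \<beta>"
      by (intro tendsto_powr' mesh0 tendsto_const) (use \<beta> ab in \<open>auto intro!: always_eventually simp: mesh_def\<close>)
    then have "(\<lambda>n. M * mesh a b (n + 2) powr \<beta>) \<longlonglongrightarrow> M * 0" using \<beta> by (intro tendsto_mult tendsto_const) simp
    then show "(\<lambda>n. ennreal (M * mesh a b (n + 2) powr \<beta>)) \<longlonglongrightarrow> 0" using tendsto_ennrealI by fastforce
    show "L1norm (\<lambda>t. ?z (n + 2) t - ?f t) \<le> ennreal (M * mesh a b (n + 2) powr \<beta>)" for n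
      by (rule step_mean_error_L1[OF M mod]) auto
  qed
  have zmeas: "step_mean a b (n + 2) f \<in> borel_measurable borel" for n by (rule step_mean_measurable[OF ab]) simp
  have tl: "(\<lambda>n. \<integral>\<^sup>+u. ennreal (singular_kernel \<alpha>0 u) * L1_modulus a b (\<lambda>t. ?z (n + 2) t - ?f t) u \<partial>lborel) \<longlonglongrightarrow> 0"
  proof (rule singular_kernel_L1_modulus_tendsto_0[where \<beta>=\<beta> and M="2 * M"])
    show "L1_modulus a b (\<lambda>t. ?z (n + 2) t - ?f t) u \<le> ennreal (2 * M * u powr \<beta>)" if "u > 0" for n u
      by (rule step_mean_error_L1_modulus[OF M mod _ that]) auto
    show "(\<lambda>t. ?z (n + 2) t - ?f t) \<in> borel_measurable borel" for n
      using zmeas[of n] fz_meas by (rule borel_measurable_diff)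
    show "(\<lambda>n. L1norm (\<lambda>t. ?z (n + 2) t - ?f t)) \<longlonglongrightarrow> 0" by (rule err)
  qed (use \<alpha> M in auto)
  have "(\<lambda>n. L1norm (\<lambda>t. \<phi>n (n + 2) t - \<phi> t)) \<longlonglongrightarrow> 0"
  proof (rule LIMSEQ_zero_le)
    show "(\<lambda>n. ennreal (\<alpha>0 / Gamma (1 - \<alpha>0)) * (\<integral>\<^sup>+u. ennreal (singular_kernel \<alpha>0 u) * L1_modulus a b (\<lambda>t. ?z (n + 2) t - ?f t) u \<partial>lborel)) \<longlonglongrightarrow> 0"
      using ennreal_tendsto_cmult[OF _ tl, of "ennreal (\<alpha>0 / Gamma (1 - \<alpha>0))"] by simp
    fix n
    have [measurable]: "?z (n + 2) \<in> borel_measurable borel" by (rule zmeas)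
    interpret z0: nikolskii a b \<alpha>0 \<beta> "3 * M" "?z (n + 2)" by (rule nz) (use \<alpha> in auto)
    have "L1norm (\<lambda>t. \<phi>n (n + 2) t - \<phi> t) = L1norm_on {a..b} (\<lambda>t. marchaud \<alpha>0 (\<lambda>t. ?z (n + 2) t - ?f t) t)"
    proof (rule nn_integral_cong_AE)
      show "AE t in lborel. ennreal \<bar>\<phi>n (n + 2) t - \<phi> t\<bar> = ennreal \<bar>marchaud \<alpha>0 (\<lambda>t. ?z (n + 2) t - ?f t) t\<bar> * indicator {a..b} t"
        using marchaud_diff_AE[OF zmeas fz_meas z0.singular_kernel_finite f0.singular_kernel_finite]
        by eventually_elim (auto simp: \<phi>n_def \<phi>_def zero_ext_def indicator_def)
    qed
    also have "\<dots> \<le> ennreal (\<alpha>0 / Gamma (1 - \<alpha>0)) * (\<integral>\<^sup>+u. ennreal (singular_kernel \<alpha>0 u) * L1_modulus a b (\<lambda>t. ?z (n + 2) t - ?f t) u \<partial>lborel)"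
      using \<alpha> by (intro marchaud_nn_le borel_measurable_diff zmeas fz_meas) auto
    finally show "L1norm (\<lambda>t. \<phi>n (n + 2) t - \<phi> t)
      \<le> ennreal (\<alpha>0 / Gamma (1 - \<alpha>0)) * (\<integral>\<^sup>+u. ennreal (singular_kernel \<alpha>0 u) * L1_modulus a b (\<lambda>t. ?z (n + 2) t - ?f t) u \<partial>lborel)" .
  qed
  then have "(\<lambda>n. LBINT t. \<phi>n (n + 2) t * \<psi> (- t)) \<longlonglongrightarrow> (LBINT t. \<phi> t * \<psi> (- t))"
    by (intro integral_mult_bounded_tendsto[where B=B])
       (use \<psi>(2) in \<open>auto intro: frac_repD(1)[OF repz0] frac_repD(1)[OF repf0]\<close>)
  then have "(\<lambda>n. - (LBINT t. \<phi>n (n + 2) t * \<psi> (- t))) \<longlonglongrightarrow> - (LBINT t. \<phi> t * \<psi> (- t))"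
    by (rule tendsto_minus)
  also have "(\<lambda>n. - (LBINT t. \<phi>n (n + 2) t * \<psi> (- t))) = (\<lambda>n. frac_integral (?z (n + 2)) x a b)"
    by (intro ext Iz(2)[symmetric]) auto
  also have "- (LBINT t. \<phi> t * \<psi> (- t)) = frac_integral f x a b" by (rule If(2)[symmetric])
  finally show "(\<lambda>n. frac_integral (?z n) x a b) \<longlonglongrightarrow> frac_integral f x a b" by (rule LIMSEQ_offset)
qed

end

section \<open>Powers of norms and the convergence theorem\<close>

text \<open>Subadditivity of \<open>u powr \<kappa>\<close>, from \<open>s \<le> s powr \<kappa>\<close> on \<open>[0, 1]\<close> applied to the proportions \<open>v / u\<close> and
  \<open>(u - v) / u\<close>.\<close>
lemma powr_diff_le_powr:
  fixes u v \<kappa> :: real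
  assumes "0 \<le> v" "v \<le> u" "0 < \<kappa>" "\<kappa> \<le> 1"
  shows "u powr \<kappa> - v powr \<kappa> \<le> (u - v) powr \<kappa>"
proof (cases "u = 0")
  case False
  then have u: "u > 0" using assms by auto
  have self: "s \<le> s powr \<kappa>" if "0 \<le> s" "s \<le> 1" for s :: real
    using powr_mono'[of \<kappa> 1 s] that assms by simp
  have "1 = v / u + (u - v) / u" using u by (simp add: field_simps)
  also have "\<dots> \<le> (v / u) powr \<kappa> + ((u - v) / u) powr \<kappa>"
    using u assms by (intro add_mono self) auto
  also have "\<dots> = (v powr \<kappa> + (u - v) powr \<kappa>) / u powr \<kappa>"
    using u assms by (simp add: powr_divide add_divide_distrib)
  finally have "u powr \<kappa> \<le> v powr \<kappa> + (u - v) powr \<kappa>" using u by (simp add: field_simps)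
  then show ?thesis by simp
qed (use assms in auto)

lemma abs_powr_diff_le_powr:
  fixes u v \<kappa> :: real
  assumes "0 \<le> u" "0 \<le> v" "0 < \<kappa>" "\<kappa> \<le> 1"
  shows "\<bar>u powr \<kappa> - v powr \<kappa>\<bar> \<le> \<bar>u - v\<bar> powr \<kappa>"
proof (cases "v \<le> u")
  case True
  then show ?thesis using powr_diff_le_powr[of v u \<kappa>] powr_mono2[of \<kappa> v u] assms by simp
next
  case False
  then show ?thesis using powr_diff_le_powr[of u v \<kappa>] powr_mono2[of \<kappa> u v] assms by simp
qed

lemma abs_powr_diff_le_linear:
  fixes u v \<kappa> :: real
  assumes "0 < u" "0 \<le> v" "0 < \<kappa>" "\<kappa> \<le> 1"
  shows "\<bar>u powr \<kappa> - v powr \<kappa>\<bar> \<le> u powr (\<kappa> - 1) * \<bar>u - v\<bar>"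
proof -
  define s where "s = v / u"
  have s: "0 \<le> s" "v = s * u" using assms by (auto simp: s_def)
  have "\<bar>1 - s powr \<kappa>\<bar> \<le> \<bar>1 - s\<bar>"
  proof (cases "s \<le> 1")
    case True
    have "s powr 1 \<le> s powr \<kappa>" using powr_mono'[of \<kappa> 1 s] True s assms by simp
    moreover have "s powr \<kappa> \<le> 1" using True s assms powr_mono2[of \<kappa> s 1] by simp
    ultimately show ?thesis using s by simp
  next
    case False
    have "s powr \<kappa> \<le> s powr 1" using powr_mono[of \<kappa> 1 s] False assms by simp
    moreover have "1 \<le> s powr \<kappa>" using False assms ge_one_powr_ge_zero[of s \<kappa>] by simp
    ultimately show ?thesis using s by simp
  qed
  then have "u powr \<kappa> * \<bar>1 - s powr \<kappa>\<bar> \<le> u powr \<kappa> * \<bar>1 - s\<bar>" by (rule mult_left_mono) simp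
  moreover have "u powr \<kappa> * \<bar>1 - s powr \<kappa>\<bar> = \<bar>u powr \<kappa> - v powr \<kappa>\<bar>"
  proof -
    have "\<bar>u powr \<kappa> - v powr \<kappa>\<bar> = \<bar>u powr \<kappa> * (1 - s powr \<kappa>)\<bar>"
      unfolding s(2) using s assms by (simp add: powr_mult algebra_simps)
    then show ?thesis by (simp add: abs_mult)
  qed
  moreover have "u powr \<kappa> * \<bar>1 - s\<bar> = u powr (\<kappa> - 1) * \<bar>u - v\<bar>"
  proof -
    have "u powr \<kappa> = u powr (\<kappa> - 1) * u" using assms by (simp add: powr_diff)
    moreover have "u * \<bar>1 - s\<bar> = \<bar>u - v\<bar>"
      unfolding s(2) using assms abs_mult[of u "1 - s"] by (simp add: algebra_simps)
    ultimately show ?thesis by (simp add: mult.assoc)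
  qed
  ultimately show ?thesis by simp
qed

text \<open>If \<open>\<bar>u - v\<bar> \<le> u\<close>, a power of \<open>u\<close> with negative exponent in the Lipschitz bound is replaced by the same
  power of \<open>\<bar>u - v\<bar>\<close>; otherwise the surplus negative power of \<open>\<bar>u - v\<bar>\<close> in the Hoelder bound is
  replaced by one of \<open>u\<close>.\<close>
lemma abs_powr_diff_le_interpolated:
  fixes u v \<kappa> \<eta> :: real
  assumes "0 < u" "0 \<le> v" "0 < \<kappa>" "\<kappa> < 1" "0 < \<eta>" "\<eta> < 1 - \<kappa>"
  shows "\<bar>u powr \<kappa> - v powr \<kappa>\<bar> \<le> u powr (- \<eta>) * \<bar>u - v\<bar> powr (\<kappa> + \<eta>)"
proof (cases "\<bar>u - v\<bar> \<le> u")
  case True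
  show ?thesis
  proof (cases "u = v")
    case False
    then have d: "0 < \<bar>u - v\<bar>" by simp
    have "\<bar>u powr \<kappa> - v powr \<kappa>\<bar> \<le> u powr (\<kappa> - 1) * \<bar>u - v\<bar>"
      using assms by (intro abs_powr_diff_le_linear) auto
    also have "\<dots> = u powr (- \<eta>) * (u powr (\<kappa> + \<eta> - 1) * \<bar>u - v\<bar>)"
      by (simp add: powr_add[symmetric] mult.assoc[symmetric])
    also have "\<dots> \<le> u powr (- \<eta>) * (\<bar>u - v\<bar> powr (\<kappa> + \<eta> - 1) * \<bar>u - v\<bar>)"
      using True d assms by (intro mult_left_mono mult_right_mono powr_mono2') auto
    also have "\<bar>u - v\<bar> powr (\<kappa> + \<eta> - 1) * \<bar>u - v\<bar> = \<bar>u - v\<bar> powr (\<kappa> + \<eta>)"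
      using d by (simp add: powr_diff)
    finally show ?thesis .
  qed simp
next
  case False
  then have d: "0 < \<bar>u - v\<bar>" using assms by linarith
  have "\<bar>u powr \<kappa> - v powr \<kappa>\<bar> \<le> \<bar>u - v\<bar> powr \<kappa>"
    using assms by (intro abs_powr_diff_le_powr) auto
  also have "\<dots> = \<bar>u - v\<bar> powr (- \<eta>) * \<bar>u - v\<bar> powr (\<kappa> + \<eta>)"
    by (simp add: powr_add[symmetric])
  also have "\<dots> \<le> u powr (- \<eta>) * \<bar>u - v\<bar> powr (\<kappa> + \<eta>)"
    using False assms by (intro mult_right_mono powr_mono2') auto
  finally show ?thesis .
qed

lemma step_average_component:
  fixes g :: "real \<Rightarrow> real ^ 'm::finite"
  assumes "a < b" "2 \<le> n" and g: "continuous_on {a..b} g"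
  shows "step_average a b n g t $ i = step_mean a b n (\<lambda>t. g t $ i) t"
proof -
  have "(LINT r:{part_pt a b n (j - 1)..part_pt a b n j}|lborel. g r) $ i
      = (LINT r:{part_pt a b n (j - 1)..part_pt a b n j}|lborel. g r $ i)" if j: "j \<in> {2..n}" for j
  proof -
    let ?A = "{part_pt a b n (j - 1)..part_pt a b n j}"
    have "?A \<subseteq> {a..b}" using cell_subset[OF assms(1,2) j] by auto
    then have "integrable lborel (\<lambda>r. indicator ?A r *\<^sub>R g r)"
      by (intro borel_integrable_compact continuous_on_subset[OF g]) auto
    from integral_bounded_linear[OF bounded_linear_vec_nth this, of i]
    show ?thesis by (simp add: set_lebesgue_integral_def)
  qed
  then show ?thesis unfolding step_average_def step_mean_def by (simp add: sum_component)
qed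

theorem theorem2p6:
  fixes T \<gamma> \<kappa> \<eta> :: real
    and x :: "real \<Rightarrow> real"
    and \<sigma> :: "real ^ 'm::finite \<Rightarrow> real ^ 'm"
    and y :: "real \<Rightarrow> real ^ 'm"
  assumes "T > 0"
    and "1 / 2 < \<gamma>" "\<gamma> < 1"
    and "0 < \<kappa>" "\<kappa> < 1"
    and "\<gamma> * (\<kappa> + 1) < 1"
    and "holder_on \<gamma> {0..T} x"
    and "\<sigma> 0 = 0"
    and "\<exists>C. \<forall>\<xi>\<^sub>1 \<xi>\<^sub>2. norm (\<sigma> \<xi>\<^sub>2 - \<sigma> \<xi>\<^sub>1) \<le> C * \<bar>norm \<xi>\<^sub>2 powr \<kappa> - norm \<xi>\<^sub>1 powr \<kappa>\<bar>"
    and "(1 - \<gamma> * (1 + \<kappa>)) / \<gamma> < \<eta>" "\<eta> < 1 - \<kappa>"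
    and "holder_on \<gamma> {0..T} y"
    and "recip_norm_in_L \<eta> T y"
  shows "\<forall>a b. 0 \<le> a \<and> a < b \<and> b \<le> T \<longrightarrow>
    (\<forall>n\<ge>2. frac_integrable_vec (step_average a b n (\<lambda>r. \<sigma> (y r))) x a b) \<and>
    frac_integrable_vec (\<lambda>s. \<sigma> (y s)) x a b \<and>
    (\<lambda>n. frac_integral_vec (step_average a b n (\<lambda>r. \<sigma> (y r))) x a b)
      \<longlonglongrightarrow> frac_integral_vec (\<lambda>s. \<sigma> (y s)) x a b"
proof (intro allI impI)
  fix a b :: real
  assume "0 \<le> a \<and> a < b \<and> b \<le> T"
  then have ab: "0 \<le> a" "a < b" "b \<le> T" by auto
  define \<beta> where "\<beta> = \<gamma> * (\<kappa> + \<eta>)"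
  have \<gamma>0: "0 < \<gamma>" using assms(2) by simp
  have "0 < (1 - \<gamma> * (1 + \<kappa>)) / \<gamma>" using assms(6) \<gamma>0 by (simp add: algebra_simps)
  then have \<eta>: "0 < \<eta>" using assms(10) by linarith
  have \<beta>1: "1 - \<gamma> < \<beta>" using assms(10) \<gamma>0 by (simp add: \<beta>_def pos_divide_less_eq algebra_simps)
  have "\<beta> < \<gamma> * 1" unfolding \<beta>_def using assms(11) \<gamma>0 by (intro mult_strict_left_mono) auto
  then have \<beta>: "0 < \<beta>" "\<beta> < 1" using assms(3) \<beta>1 by auto
  obtain C0 where C0: "\<And>\<xi>1 \<xi>2. norm (\<sigma> \<xi>2 - \<sigma> \<xi>1) \<le> C0 * \<bar>norm \<xi>2 powr \<kappa> - norm \<xi>1 powr \<kappa>\<bar>"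
    using assms(9) by blast
  \<comment> \<open>A positive constant is needed: it makes the weight \<open>W\<close> below infinite at the zeros of \<open>y\<close>.\<close>
  define C where "C = max C0 1"
  have C: "norm (\<sigma> \<xi>2 - \<sigma> \<xi>1) \<le> C * \<bar>norm \<xi>2 powr \<kappa> - norm \<xi>1 powr \<kappa>\<bar>" "0 < C" for \<xi>1 \<xi>2
    using C0[of \<xi>2 \<xi>1] mult_right_mono[of C0 C "\<bar>norm \<xi>2 powr \<kappa> - norm \<xi>1 powr \<kappa>\<bar>"] by (auto simp: C_def)
  obtain D0 where D0: "\<forall>s\<in>{0..T}. \<forall>t\<in>{0..T}. dist (y s) (y t) \<le> D0 * \<bar>s - t\<bar> powr \<gamma>"
    using assms(12) unfolding holder_on_def by blast
  define D where "D = max D0 1"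
  have D: "dist (y s) (y t) \<le> D * \<bar>s - t\<bar> powr \<gamma>" if "s \<in> {0..T}" "t \<in> {0..T}" for s t
    using D0 that mult_right_mono[of D0 D "\<bar>s - t\<bar> powr \<gamma>"] by (fastforce simp: D_def)
  have D0: "0 < D" by (simp add: D_def)
  have ydiff: "\<bar>norm (y t) - norm (y s)\<bar> \<le> D * \<bar>t - s\<bar> powr \<gamma>" if "s \<in> {0..T}" "t \<in> {0..T}" for s t
    using D[OF that(2,1)] norm_triangle_ineq3[of "y t" "y s"] by (simp add: dist_norm)
  have ycont: "continuous_on {0..T} y" by (rule continuous_on_of_holder[OF \<gamma>0 D])
  let ?f = "\<lambda>t. \<sigma> (y t)"
  have fcont: "continuous_on {0..T} ?f"
  proof (rule continuous_on_of_holder[of "\<gamma> * \<kappa>" _ _ "C * D powr \<kappa>"])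
    fix s t assume st: "s \<in> {0..T}" "t \<in> {0..T}"
    have "dist (?f s) (?f t) \<le> C * \<bar>norm (y s) powr \<kappa> - norm (y t) powr \<kappa>\<bar>" using C(1) by (simp add: dist_norm)
    also have "\<dots> \<le> C * \<bar>norm (y s) - norm (y t)\<bar> powr \<kappa>"
      using C(2) assms(4,5) by (intro mult_left_mono abs_powr_diff_le_powr) auto
    also have "\<dots> \<le> C * (D * \<bar>s - t\<bar> powr \<gamma>) powr \<kappa>"
      using C(2) assms(4,5) ydiff[OF st(2,1)] by (intro mult_left_mono powr_mono2) auto
    also have "\<dots> = C * D powr \<kappa> * \<bar>s - t\<bar> powr (\<gamma> * \<kappa>)"
      using D0 by (simp add: powr_mult powr_powr)
    finally show "dist (?f s) (?f t) \<le> C * D powr \<kappa> * \<bar>s - t\<bar> powr (\<gamma> * \<kappa>)" .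
  qed (use \<gamma>0 assms(4) in auto)
  have sub: "{a..b} \<subseteq> {0..T}" using ab by auto
  \<comment> \<open>The indicator makes the weight measurable on the whole line, while \<open>y\<close> is continuous on \<open>[0, T]\<close> only.\<close>
  define W where "W t = ennreal (C * D powr (\<kappa> + \<eta>)) * inverse (ennreal (norm (indicator {0..T} t *\<^sub>R y t) powr \<eta>))" for t
  have [measurable]: "(\<lambda>t. indicator {0..T} t *\<^sub>R y t) \<in> borel_measurable borel"
    by (rule borel_measurable_continuous_on_indicator) (use ycont in auto)
  have Wm: "W \<in> borel_measurable borel" unfolding W_def by measurable
  have Wfin: "(\<integral>\<^sup>+t\<in>{a..b}. W t \<partial>lborel) < \<infinity>"
  proof -
    have "(\<integral>\<^sup>+t\<in>{a..b}. W t \<partial>lborel) \<le> (\<integral>\<^sup>+t. ennreal (C * D powr (\<kappa> + \<eta>)) * (inverse (ennreal (norm (indicator {0..T} t *\<^sub>R y t) powr \<eta>)) * indicator {0..T} t) \<partial>lborel)"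
      using sub by (intro nn_integral_mono) (auto simp: W_def indicator_def)
    also have "\<dots> = ennreal (C * D powr (\<kappa> + \<eta>)) * (\<integral>\<^sup>+t\<in>{0..T}. inverse (ennreal (norm (indicator {0..T} t *\<^sub>R y t) powr \<eta>)) \<partial>lborel)"
      by (rule nn_integral_cmult) measurable
    also have "(\<integral>\<^sup>+t\<in>{0..T}. inverse (ennreal (norm (indicator {0..T} t *\<^sub>R y t) powr \<eta>)) \<partial>lborel) = (\<integral>\<^sup>+t\<in>{0..T}. inverse (ennreal (norm (y t) powr \<eta>)) \<partial>lborel)"
      by (intro nn_integral_cong) (auto simp: indicator_def)
    also have "ennreal (C * D powr (\<kappa> + \<eta>)) * \<dots> < \<infinity>"
      using assms(13) unfolding recip_norm_in_L_def by (simp add: ennreal_mult_less_top)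
    finally show ?thesis .
  qed
  have osc: "ennreal \<bar>?f t $ i - ?f s $ i\<bar> \<le> W t * ennreal (\<bar>t - s\<bar> powr \<beta>)" if "s \<in> {a..b}" "t \<in> {a..b}" for s t i
  proof (cases "s = t")
    case False
    have st: "s \<in> {0..T}" "t \<in> {0..T}" using that sub by auto
    show ?thesis
    proof (cases "y t = 0")
      case True
      have "W t = \<infinity>" using True C(2) D0 \<eta> st by (simp add: W_def ennreal_mult_top)
      then show ?thesis using False by (simp add: ennreal_top_mult)
    next
      case y0: False
      have "\<bar>?f t $ i - ?f s $ i\<bar> \<le> norm (?f t - ?f s)"
        using component_le_norm_cart[of "?f t - ?f s" i] by simp
      also have "\<dots> \<le> C * \<bar>norm (y t) powr \<kappa> - norm (y s) powr \<kappa>\<bar>" by (rule C(1))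
      also have "\<dots> \<le> C * (norm (y t) powr (- \<eta>) * \<bar>norm (y t) - norm (y s)\<bar> powr (\<kappa> + \<eta>))"
        using C(2) y0 assms(4,5,11) \<eta> by (intro mult_left_mono abs_powr_diff_le_interpolated) auto
      also have "\<dots> \<le> C * (norm (y t) powr (- \<eta>) * (D * \<bar>t - s\<bar> powr \<gamma>) powr (\<kappa> + \<eta>))"
        using C(2) assms(4) \<eta> ydiff[OF st] by (intro mult_left_mono powr_mono2) auto
      also have "\<dots> = C * D powr (\<kappa> + \<eta>) * inverse (norm (y t) powr \<eta>) * \<bar>t - s\<bar> powr \<beta>"
        using D0 by (simp add: powr_mult powr_powr powr_minus \<beta>_def)
      finally have "ennreal \<bar>?f t $ i - ?f s $ i\<bar> \<le> ennreal (C * D powr (\<kappa> + \<eta>) * inverse (norm (y t) powr \<eta>) * \<bar>t - s\<bar> powr \<beta>)"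
        by (rule ennreal_leI)
      also have "\<dots> = W t * ennreal (\<bar>t - s\<bar> powr \<beta>)"
        using C(2) y0 st by (simp add: W_def inverse_ennreal ennreal_mult)
      finally show ?thesis .
    qed
  qed simp
  have comp: "continuous_on {a..b} (\<lambda>t. ?f t $ i)" for i
    using fcont sub by (intro continuous_intros continuous_on_subset[OF fcont])
  have wh: "weighted_holder a b \<beta> (\<lambda>t. ?f t $ i) W" for i
    by standard (use ab \<beta> comp Wm Wfin osc in auto)
  note lim = weighted_holder.frac_integral_step_mean_tendsto[OF wh assms(7) \<gamma>0 assms(3) \<beta>1 ab(1,3)]
  have fab: "continuous_on {a..b} ?f" by (rule continuous_on_subset[OF fcont sub])
  have sa: "(\<lambda>t. step_average a b n ?f t $ i) = step_mean a b n (\<lambda>t. ?f t $ i)" if "2 \<le> n" for n i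
    using step_average_component[OF ab(2) that fab] by (intro ext)
  show "(\<forall>n\<ge>2. frac_integrable_vec (step_average a b n ?f) x a b) \<and> frac_integrable_vec ?f x a b \<and>
    (\<lambda>n. frac_integral_vec (step_average a b n ?f) x a b) \<longlonglongrightarrow> frac_integral_vec ?f x a b"
  proof (intro conjI allI impI)
    fix n :: nat assume "2 \<le> n"
    then show "frac_integrable_vec (step_average a b n ?f) x a b"
      unfolding frac_integrable_vec_def using sa lim(1) by simp
  next
    show "frac_integrable_vec ?f x a b" unfolding frac_integrable_vec_def using lim(2) by simp
    show "(\<lambda>n. frac_integral_vec (step_average a b n ?f) x a b) \<longlonglongrightarrow> frac_integral_vec ?f x a b"
    proof (rule vec_tendstoI)
      fix i
      have "\<forall>\<^sub>F n in sequentially. frac_integral (step_mean a b n (\<lambda>t. ?f t $ i)) x a b = frac_integral_vec (step_average a b n ?f) x a b $ i"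
        using eventually_ge_at_top[of 2] by eventually_elim (simp add: frac_integral_vec_def sa)
      moreover have "(\<lambda>n. frac_integral (step_mean a b n (\<lambda>t. ?f t $ i)) x a b) \<longlonglongrightarrow> frac_integral_vec ?f x a b $ i"
        using lim(3) by (simp add: frac_integral_vec_def)
      ultimately show "(\<lambda>n. frac_integral_vec (step_average a b n ?f) x a b $ i) \<longlonglongrightarrow> frac_integral_vec ?f x a b $ i"
        by (rule Lim_transform_eventually[rotated])
    qed
  qed
qed

end
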